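(* Let $0<\alpha\le 1$, let $L\in C^1([a,b]\times\mathbb{R}^2)$, $L=L(x,y,v)$, and let $$\mathcal{J}(y)=\int_a^b L\left(x,y(x),y^{(\alpha)}_a(x)\right)\,d^\alpha_a x .$$ Let $y:[a,b]\to\mathbb{R}$ be an $\alpha$-differentiable function with $y(a)=y_a$ and $y(b)=y_b$, where $y_a,y_b\in\mathbb{R}$. Furthermore, let $y\,\frac{\partial L}{\partial y^{(\alpha)}_a}$ be a differentiable function of $x$, and let $\frac{\partial L}{\partial y^{(\alpha)}_a}$ be $\alpha$-differentiable (as functions of $x$ along $y$). If $y$ is an extremizer of $\mathcal{J}$, then $y$ satisfies the fractional Euler--Lagrange equation $$\frac{\partial L}{\partial y}-\frac{d^\alpha_a}{dx^\alpha_a}\left(\frac{\partial L}{\partial y^{(\alpha)}_a}\right)=0 .$$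
   Context: Let $a<b$ be real and $0<\alpha\le1$. The left conformable fractional derivative of order $\alpha$ starting from $a$ of $f:[a,b]\to\mathbb{R}$ is $$f^{(\alpha)}_a(x)=\frac{d^\alpha_a}{dx^\alpha_a}f(x)=\lim_{\epsilon\to0}\frac{f(x+\epsilon(x-a)^{1-\alpha})-f(x)}{\epsilon};$$ if it exists, $f$ is called $\alpha$-differentiable. If it exists on $(a,b)$, the endpoint values are $f^{(\alpha)}_a(a)=\lim_{x\to a^+}f^{(\alpha)}_a(x)$ and $f^{(\alpha)}_a(b)=\lim_{x\to b^-}f^{(\alpha)}_a(x)$. The conformable integral is $\int_a^b f(x)\,d^\alpha_a x=\int_a^b f(x)(x-a)^{\alpha-1}\,dx$. The functional $\mathcal{J}$ is considered on the set of continuous functions $y:[a,b]\to\mathbb{R}$ such that $y^{(\alpha)}_a$ exists on $[a,b]$. An extremizer of $\mathcal{J}$ is a function giving $\mathcal{J}$ a minimum or a maximum among the admissible functions with the same boundary values $y(a)=y_a$, $y(b)=y_b$. The symbols $\frac{\partial L}{\partial y}$ and $\frac{\partial L}{\partial y^{(\alpha)}_a}$ denote the partial derivatives of $L$ with respect to its second and third arguments, evaluated at $(x,y(x),y^{(\alpha)}_a(x))$; the operator $\frac{d^\alpha_a}{dx^\alpha_a}$ acts on the resulting function of $x$. *)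

theory Defs
  imports "HOL-Analysis.Analysis"
begin

text \<open>
  Functions on \<open>[a,b]\<close> are represented by total functions on the reals. Derivatives on
  \<open>[a,b]\<close>, integrals and extremality do not depend on the values of the function outside \<open>[a,b]\<close>.
\<close>

definition conf_quotient :: "real \<Rightarrow> real \<Rightarrow> (real \<Rightarrow> real) \<Rightarrow> real \<Rightarrow> real \<Rightarrow> real" where
  "conf_quotient \<alpha> a f x = (\<lambda>\<epsilon>. (f (x + \<epsilon> * (x - a) powr (1 - \<alpha>)) - f x) / \<epsilon>)"

definition conf_deriv_interior :: "real \<Rightarrow> real \<Rightarrow> (real \<Rightarrow> real) \<Rightarrow> real \<Rightarrow> real" where
  "conf_deriv_interior \<alpha> a f x = Lim (at 0) (conf_quotient \<alpha> a f x)"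

text \<open>
  At the endpoints the value is by convention the one-sided limit of the values in \<open>(a,b)\<close>, not
  the limit of the difference quotient, which is degenerate at \<open>x = a\<close>.
\<close>

definition conf_deriv :: "real \<Rightarrow> real \<Rightarrow> real \<Rightarrow> (real \<Rightarrow> real) \<Rightarrow> real \<Rightarrow> real" where
  "conf_deriv \<alpha> a b f x =
     (if x = a then Lim (at_right a) (conf_deriv_interior \<alpha> a f)
      else if x = b then Lim (at_left b) (conf_deriv_interior \<alpha> a f)
      else conf_deriv_interior \<alpha> a f x)"

text \<open>
  \<open>Lim\<close> is unspecified where there is no limit, so the existence of all the limits in
  \<open>conf_deriv\<close>, that is, of the derivative on the whole of \<open>[a,b]\<close>, is a separate predicate.
\<close>

definition conf_differentiable :: "real \<Rightarrow> real \<Rightarrow> real \<Rightarrow> (real \<Rightarrow> real) \<Rightarrow> bool" where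
  "conf_differentiable \<alpha> a b f \<longleftrightarrow>
     (\<forall>x\<in>{a<..<b}. \<exists>D. (conf_quotient \<alpha> a f x \<longlongrightarrow> D) (at 0)) \<and>
     (\<exists>D. (conf_deriv_interior \<alpha> a f \<longlongrightarrow> D) (at_right a)) \<and>
     (\<exists>D. (conf_deriv_interior \<alpha> a f \<longlongrightarrow> D) (at_left b))"

definition conf_integrable :: "real \<Rightarrow> real \<Rightarrow> real \<Rightarrow> (real \<Rightarrow> real) \<Rightarrow> bool" where
  "conf_integrable \<alpha> a b f \<longleftrightarrow> (\<lambda>x. f x * (x - a) powr (\<alpha> - 1)) integrable_on {a..b}"

definition conf_integral :: "real \<Rightarrow> real \<Rightarrow> real \<Rightarrow> (real \<Rightarrow> real) \<Rightarrow> real" where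
  "conf_integral \<alpha> a b f = integral {a..b} (\<lambda>x. f x * (x - a) powr (\<alpha> - 1))"

text \<open>
  Continuous differentiability on a subset of a Euclidean space; on \<open>[a,b] \<times> \<real>\<^sup>2\<close> the derivative
  in the first argument is thus one-sided at \<open>a\<close> and \<open>b\<close>.
\<close>

definition C1_on :: "'a::euclidean_space set \<Rightarrow> ('a \<Rightarrow> real) \<Rightarrow> bool" where
  "C1_on S f \<longleftrightarrow>
     (\<exists>f'. (\<forall>z\<in>S. (f has_derivative blinfun_apply (f' z)) (at z within S)) \<and> continuous_on S f')"

definition partial_y :: "(real \<times> real \<times> real \<Rightarrow> real) \<Rightarrow> real \<times> real \<times> real \<Rightarrow> real" where
  "partial_y L = (\<lambda>(x, y, v). deriv (\<lambda>u. L (x, u, v)) y)"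

definition partial_v :: "(real \<times> real \<times> real \<Rightarrow> real) \<Rightarrow> real \<times> real \<times> real \<Rightarrow> real" where
  "partial_v L = (\<lambda>(x, y, v). deriv (\<lambda>w. L (x, y, w)) v)"

definition along :: "real \<Rightarrow> real \<Rightarrow> real \<Rightarrow> (real \<times> real \<times> real \<Rightarrow> real) \<Rightarrow> (real \<Rightarrow> real) \<Rightarrow> real \<Rightarrow> real" where
  "along \<alpha> a b F y = (\<lambda>x. F (x, y x, conf_deriv \<alpha> a b y x))"

definition functional_J :: "real \<Rightarrow> real \<Rightarrow> real \<Rightarrow> (real \<times> real \<times> real \<Rightarrow> real) \<Rightarrow> (real \<Rightarrow> real) \<Rightarrow> real" where
  "functional_J \<alpha> a b L y = conf_integral \<alpha> a b (along \<alpha> a b L y)"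

text \<open>
  The last conjunct says that the functional is defined at \<open>y\<close>. It cannot be dropped: \<open>integral\<close>
  has the spurious value \<open>0\<close> on functions that are not integrable.
\<close>

definition admissible :: "real \<Rightarrow> real \<Rightarrow> real \<Rightarrow> (real \<times> real \<times> real \<Rightarrow> real) \<Rightarrow> (real \<Rightarrow> real) \<Rightarrow> bool" where
  "admissible \<alpha> a b L y \<longleftrightarrow>
     continuous_on {a..b} y \<and> conf_differentiable \<alpha> a b y \<and>
     conf_integrable \<alpha> a b (along \<alpha> a b L y)"

definition extremizer :: "real \<Rightarrow> real \<Rightarrow> real \<Rightarrow> (real \<times> real \<times> real \<Rightarrow> real) \<Rightarrow> (real \<Rightarrow> real) \<Rightarrow> bool" where
  "extremizer \<alpha> a b L y \<longleftrightarrow>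
     admissible \<alpha> a b L y \<and>
     ((\<forall>z. admissible \<alpha> a b L z \<and> z a = y a \<and> z b = y b \<longrightarrow>
           functional_J \<alpha> a b L y \<le> functional_J \<alpha> a b L z) \<or>
      (\<forall>z. admissible \<alpha> a b L z \<and> z a = y a \<and> z b = y b \<longrightarrow>
           functional_J \<alpha> a b L z \<le> functional_J \<alpha> a b L y))"

end

theory Submission imports Defs begin

text \<open>
  On \<open>(a,b)\<close> the functional is a classical one for a \<open>C\<^sup>1\<close> Lagrangian \<open>M (x, y, v)\<close>, but \<open>v = y'\<close> is only
  a derivative: it may be discontinuous and unbounded, so that \<open>y + \<epsilon> \<eta>\<close> need not be admissible.
  Replacing \<open>y\<close> on an interval by a curve of bounded slope is always possible. With \<open>p = M\<^sub>v\<close> along \<open>y\<close> and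
  two-slope broken lines this gives the Weierstrass condition, first almost everywhere by Henstock's
  lemma, then at every \<open>x\<close>, since a derivative does not take values in an open interval only on a null set
  (Denjoy, Clarkson): the line of slope \<open>p x\<close> supports \<open>M (x, y x, \<cdot>)\<close> at \<open>v x\<close>. If \<open>v\<close> is
  bounded near \<open>e\<close>, the first variation (if \<open>v e\<close> is a one-sided limit of \<open>v\<close>) or a comparison with a small tent
  (if \<open>v\<close> oscillates around \<open>v e\<close>) yields \<open>M\<^sub>y = p'\<close> at \<open>e\<close>.

  Now let the defect \<open>d = M\<^sub>y - p'\<close> be nonzero at \<open>e\<close>, say positive. The supporting lines force \<open>v\<close>, near \<open>e\<close> and
  for values near \<open>v e\<close>, to cross bands of velocities only upwards where \<open>d\<close> is clearly smaller than \<open>d e\<close>. Hence,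
  if that is the case off a closed set on which \<open>v\<close> oscillates little, \<open>v\<close> is bounded near \<open>e\<close>, and so \<open>d e = 0\<close>.
  To obtain such a set from Baire's theorem one needs a gap in the values of \<open>d\<close>: where \<open>v\<close> is unbounded near
  points \<open>s \<rightarrow> e\<close>, with \<open>v s\<close> bounded, the supporting lines touch along half-lines, which leaves only
  three possible limits for \<open>d s\<close>.
\<close>

section \<open>Derivatives of functions of one real variable\<close>

text \<open>The equation is claimed at every point, while neither \<open>v\<close> nor
  \<open>p'\<close> need be continuous, so an identity almost everywhere would not suffice. The
  substitute for the first variation is that all contact values \<open>w\<close> at \<open>s\<close>
  minimise the same function \<open>M (s, y s, w) - p s * w\<close>, and that the minimum moves at
  the same rate for all of them. Two different contact values thus determine \<open>p' s\<close>,
  and with it the defect.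

  This is why crossings go upwards. In a downward crossing of a band the upper edge is a contact
  value no later than the lower edge, and the mean value theorem bounds \<open>p'\<close> between
  them, up to oscillation of \<open>My\<close>, by what the same two velocities prescribe at
  \<open>e\<close>; the defect there is almost as large as \<open>d e\<close>.

  Of the three limits, one is \<open>d e\<close>, one comes from points where \<open>v\<close> is
  unbounded below and one from points where it is unbounded above. Finitely many limits leave room
  for a threshold: at such points near \<open>e\<close>, \<bar>d s\<bar> is below \<epsilon> or
  above 3 * \<epsilon>, so being below 3 * \<epsilon> already means being well below it.\<close>

lemma darboux_derivative_aux:
  fixes y v :: "real \<Rightarrow> real"
  assumes "x1 < x2" and der: "\<And>x. x1 \<le> x \<Longrightarrow> x \<le> x2 \<Longrightarrow> (y has_real_derivative v x) (at x)"
    and "v x1 < k" "k < v x2"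
  shows "\<exists>x. x1 < x \<and> x < x2 \<and> v x = k"
proof -
  define g where "g x = y x - k * x" for x
  have dg: "(g has_real_derivative v x - k) (at x)" if "x1 \<le> x" "x \<le> x2" for x
    unfolding g_def by (auto intro!: derivative_eq_intros der that)
  have "continuous_on {x1..x2} g"
    using dg by (intro continuous_at_imp_continuous_on ballI DERIV_isCont) auto
  then obtain m where m: "m \<in> {x1..x2}" "\<And>x. x \<in> {x1..x2} \<Longrightarrow> g m \<le> g x"
    using continuous_attains_inf[of "{x1..x2}" g] \<open>x1 < x2\<close> by auto
  have "m \<noteq> x1"
  proof
    assume "m = x1"
    obtain d where d: "d > 0" "\<And>h. h > 0 \<Longrightarrow> h < d \<Longrightarrow> g (x1 + h) < g x1"
      using DERIV_neg_dec_right[OF dg[of x1]] assms by auto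
    define h where "h = min (d/2) (x2 - x1)"
    have "h > 0" "h < d" "x1 + h \<in> {x1..x2}" using d assms by (auto simp: h_def)
    with d(2)[of h] m(2)[of "x1+h"] \<open>m = x1\<close> show False by auto
  qed
  moreover have "m \<noteq> x2"
  proof
    assume "m = x2"
    obtain d where d: "d > 0" "\<And>h. h > 0 \<Longrightarrow> h < d \<Longrightarrow> g (x2 - h) < g x2"
      using DERIV_pos_inc_left[OF dg[of x2]] assms by auto
    define h where "h = min (d/2) (x2 - x1)"
    have "h > 0" "h < d" "x2 - h \<in> {x1..x2}" using d assms by (auto simp: h_def)
    with d(2)[of h] m(2)[of "x2-h"] \<open>m = x2\<close> show False by auto
  qed
  ultimately have mm: "x1 < m" "m < x2" using m by auto
  have "v m - k = 0"
  proof (rule DERIV_local_min[OF dg])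
    show "0 < min (m - x1) (x2 - m)" using mm by auto
    show "\<forall>x. \<bar>m - x\<bar> < min (m - x1) (x2 - m) \<longrightarrow> g m \<le> g x"
      by (intro allI impI m) (auto simp: abs_if split: if_splits)
  qed (use mm in auto)
  then show ?thesis using mm by auto
qed

lemma darboux_derivative:
  fixes y v :: "real \<Rightarrow> real"
  assumes der: "\<And>x. x \<in> closed_segment x1 x2 \<Longrightarrow> (y has_real_derivative v x) (at x)"
    and k: "v x1 < k" "k < v x2"
  shows "\<exists>x \<in> open_segment x1 x2. v x = k"
proof (cases "x1 < x2")
  case True
  then show ?thesis
    using darboux_derivative_aux[OF True, of y v k] der k
    by (auto simp: closed_segment_eq_real_ivl open_segment_eq_real_ivl)
next
  case False
  moreover have "x1 \<noteq> x2" using k by auto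
  ultimately have "x2 < x1" by simp
  have "\<exists>x. x2 < x \<and> x < x1 \<and> - v x = - k"
  proof (rule darboux_derivative_aux[OF \<open>x2 < x1\<close>])
    fix x assume "x2 \<le> x" "x \<le> x1"
    then have "(y has_real_derivative v x) (at x)"
      using \<open>x2 < x1\<close> by (intro der) (auto simp: closed_segment_eq_real_ivl)
    then show "((\<lambda>x. - y x) has_real_derivative - v x) (at x)" by (rule DERIV_minus)
  qed (use k in auto)
  then show ?thesis using \<open>x2 < x1\<close> by (auto simp: open_segment_eq_real_ivl)
qed

text \<open>Derivatives are of Baire class one, through difference quotients of step
  \<open>h n\<close>. Starting at index \<open>N0\<close> keeps \<open>x + h n\<close> to the left
  of \<open>b\<close> for all \<open>x\<close> in the interval.\<close>

lemma derivative_limit_of_continuous: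
  fixes y v :: "real \<Rightarrow> real"
  assumes der: "\<And>x. a < x \<Longrightarrow> x < b \<Longrightarrow> (y has_real_derivative v x) (at x)"
    and cd: "a < c" "d < b"
  obtains f :: "nat \<Rightarrow> real \<Rightarrow> real" where "\<And>n. continuous_on {c..d} (f n)"
    "\<And>x. x \<in> {c..d} \<Longrightarrow> (\<lambda>n. f n x) \<longlonglongrightarrow> v x"
proof -
  obtain N0 :: nat where N0: "N0 > 0" "1 / real N0 < b - d"
    using cd by (metis diff_gt_0_iff_gt nat_approx_posE not_gr_zero zero_less_Suc)
  define h where "h n = 1 / real (N0 + n)" for n
  have h: "0 < h n" "h n < b - d" for n
  proof -
    show "0 < h n" using N0 by (simp add: h_def)
    have "h n \<le> 1 / real N0" unfolding h_def using N0 by (intro divide_left_mono) auto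
    then show "h n < b - d" using N0 by simp
  qed
  have h0: "h \<longlonglongrightarrow> 0" unfolding h_def
    by (rule LIMSEQ_ignore_initial_segment[OF lim_inverse_n', of N0, unfolded add.commute[of _ N0]])
  define f where "f n x = (y (x + h n) - y x) / h n" for n x
  have conty: "isCont y x" if "a < x" "x < b" for x using der[OF that] DERIV_isCont by blast
  have contf: "continuous_on {c..d} (f n)" for n
  proof -
    have "isCont (f n) x" if "x \<in> {c..d}" for x
    proof -
      have "a < x" "x \<le> d" "x < b" using that cd by auto
      then have "isCont y x" "isCont y (x + h n)" using h[of n] by (auto intro!: conty)
      then show ?thesis unfolding f_def
        using h[of n] by (auto intro!: continuous_intros isCont_o2[of x "\<lambda>x. x + h n" y])
    qed
    then show ?thesis by (simp add: continuous_at_imp_continuous_on)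
  qed
  have limf: "(\<lambda>n. f n x) \<longlonglongrightarrow> v x" if "x \<in> {c..d}" for x
  proof -
    have "(y has_real_derivative v x) (at x)" using that cd by (intro der) auto
    then have "((\<lambda>k. (y (x + k) - y x) / k) \<longlongrightarrow> v x) (at 0)"
      by (simp add: DERIV_def)
    moreover have "filterlim h (at 0) sequentially"
      using h0 h by (auto simp: filterlim_at less_imp_neq[THEN not_sym])
    ultimately show ?thesis unfolding f_def by (rule filterlim_compose)
  qed
  show ?thesis using that[OF contf limf] by blast
qed

text \<open>Baire category: the closed sets \<open>K N\<close>, where the continuous approximants
  have settled to within \<epsilon>/4 from index \<open>N\<close> on, cover \<open>F\<close>, so one
  of them contains a relatively open piece of \<open>F\<close>. On that piece \<open>v\<close> is
  uniformly close to the continuous \<open>f N\<close>.\<close>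

lemma derivative_small_oscillation:
  fixes y v :: "real \<Rightarrow> real"
  assumes der: "\<And>x. a < x \<Longrightarrow> x < b \<Longrightarrow> (y has_real_derivative v x) (at x)"
    and F: "closed F" "F \<subseteq> {c..d}" "F \<noteq> {}" and cd: "a < c" "d < b" and "\<epsilon> > 0"
  shows "\<exists>x\<in>F. \<exists>\<delta>>0. \<forall>s\<in>F. \<bar>s - x\<bar> < \<delta> \<longrightarrow> \<bar>v s - v x\<bar> \<le> \<epsilon>"
proof -
  obtain f :: "nat \<Rightarrow> real \<Rightarrow> real" where cf: "\<And>n. continuous_on {c..d} (f n)"
    and lf: "\<And>x. x \<in> {c..d} \<Longrightarrow> (\<lambda>n. f n x) \<longlonglongrightarrow> v x"
    using derivative_limit_of_continuous[OF der cd] by blast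
  have contf: "continuous_on F (f n)" for n using cf F(2) by (rule continuous_on_subset)
  have limf: "(\<lambda>n. f n x) \<longlonglongrightarrow> v x" if "x \<in> F" for x using lf that F(2) by blast
  define K where "K N = {x\<in>F. \<forall>m\<ge>N. \<forall>n\<ge>N. \<bar>f m x - f n x\<bar> \<le> \<epsilon>/4}" for N
  have clK: "closed (K N)" for N
  proof -
    have K: "K N = F \<inter> (\<Inter>m\<in>{N..}. \<Inter>n\<in>{N..}. {x\<in>F. \<bar>f m x - f n x\<bar> \<le> \<epsilon>/4})"
      by (auto simp: K_def)
    have "closed {x\<in>F. \<bar>f m x - f n x\<bar> \<le> \<epsilon>/4}" for m n
    proof -
      have "continuous_on F (\<lambda>x. \<bar>f m x - f n x\<bar>)" by (intro continuous_intros contf)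
      then have "closed (F \<inter> (\<lambda>x. \<bar>f m x - f n x\<bar>) -` {..\<epsilon>/4})"
        by (rule continuous_closed_preimage) (use F in auto)
      then show ?thesis by (simp add: vimage_def Int_def)
    qed
    then have "closed (\<Inter>n\<in>{N..}. {x\<in>F. \<bar>f m x - f n x\<bar> \<le> \<epsilon>/4})" for m
      by (rule closed_INT[OF ballI])
    then have "closed (\<Inter>m\<in>{N..}. \<Inter>n\<in>{N..}. {x\<in>F. \<bar>f m x - f n x\<bar> \<le> \<epsilon>/4})"
      by (rule closed_INT[OF ballI])
    then show ?thesis unfolding K by (rule closed_Int[OF F(1)])
  qed
  have UK: "\<exists>N. x \<in> K N" if "x \<in> F" for x
  proof -
    have "Cauchy (\<lambda>n. f n x)" using limf[OF that] LIMSEQ_imp_Cauchy by blast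
    then obtain N where "\<forall>m\<ge>N. \<forall>n\<ge>N. \<bar>f m x - f n x\<bar> < \<epsilon>/4"
      unfolding Cauchy_def dist_real_def using \<open>\<epsilon> > 0\<close> by (meson divide_pos_pos zero_less_numeral)
    then show ?thesis using that unfolding K_def by (auto intro: less_imp_le)
  qed
  have "\<exists>N. \<not> F \<subseteq> closure (F - K N)"
  proof (rule ccontr)
    assume "\<not> ?thesis"
    then have dense: "F \<subseteq> closure (F - K N)" for N by auto
    have "F \<subseteq> closure (\<Inter>(range (\<lambda>N. F - K N)))"
    proof (rule Baire[OF F(1)])
      fix T assume "T \<in> range (\<lambda>N. F - K N)"
      then obtain N where "T = F - K N" by auto
      then show "openin (top_of_set F) T \<and> F \<subseteq> closure T"
        using dense[of N] closed_subset[OF _ clK[of N], of F]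
        by (auto intro!: openin_diff simp: K_def)
    qed auto
    moreover have "\<Inter>(range (\<lambda>N. F - K N)) = {}" using UK by auto
    ultimately show False using F(3) closure_empty by (metis subset_empty)
  qed
  then obtain N x where x: "x \<in> F" "x \<notin> closure (F - K N)" by auto
  then obtain r where r: "r > 0" "\<And>s. s \<in> F - K N \<Longrightarrow> \<not> \<bar>s - x\<bar> < r"
    unfolding closure_approachable dist_real_def by auto
  have close: "\<bar>v s - f N s\<bar> \<le> \<epsilon>/4" if "s \<in> F" "\<bar>s - x\<bar> < r" for s
  proof -
    have "s \<in> K N" using that r by blast
    then have ev: "\<forall>\<^sub>F m in sequentially. \<bar>f m s - f N s\<bar> \<le> \<epsilon>/4"
      unfolding K_def eventually_sequentially by auto
    have "(\<lambda>m. \<bar>f m s - f N s\<bar>) \<longlonglongrightarrow> \<bar>v s - f N s\<bar>"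
      by (intro tendsto_intros limf that)
    then show ?thesis by (rule tendsto_upperbound[OF _ ev trivial_limit_sequentially])
  qed
  obtain r' where r': "r' > 0" "\<And>s. s \<in> F \<Longrightarrow> \<bar>s - x\<bar> < r' \<Longrightarrow> \<bar>f N s - f N x\<bar> < \<epsilon>/4"
    using contf[of N, unfolded continuous_on_iff dist_real_def, rule_format, OF x(1), of "\<epsilon>/4"]
      \<open>\<epsilon> > 0\<close> by auto
  have "\<bar>v s - v x\<bar> \<le> \<epsilon>" if "s \<in> F" "\<bar>s - x\<bar> < min r r'" for s
  proof -
    have "\<bar>v s - f N s\<bar> \<le> \<epsilon>/4" "\<bar>v x - f N x\<bar> \<le> \<epsilon>/4" "\<bar>f N s - f N x\<bar> < \<epsilon>/4"
      using close[of s] close[OF x(1)] r'(2)[of s] that r(1) by simp_all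
    then show ?thesis by linarith
  qed
  then show ?thesis using x r r' by (intro bexI[of _ x] exI[of _ "min r r'"]) auto
qed

text \<open>The building block for rounded corners in \<open>broken_line\<close>: a C^1 function
  whose derivative is a ramp.\<close>

lemma DERIV_max_0_power2: "((\<lambda>x::real. (max 0 x)\<^sup>2) has_real_derivative 2 * max 0 x) (at x)"
proof -
  consider "x < 0" | "x > 0" | "x = 0" by linarith
  then show ?thesis
  proof cases
    case 1
    have "((\<lambda>x. 0) has_real_derivative 2 * max 0 x) (at x)" using 1 by simp
    then show ?thesis
      by (rule has_field_derivative_transform_within_open[of _ _ _ "{..<0}"]) (use 1 in auto)
  next
    case 2
    have "((\<lambda>x. x\<^sup>2) has_real_derivative 2 * max 0 x) (at x)"
      using 2 by (auto intro!: derivative_eq_intros)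
    then show ?thesis
      by (rule has_field_derivative_transform_within_open[of _ _ _ "{0<..}"]) (use 2 in auto)
  next
    case 3
    have "((\<lambda>h::real. (max 0 h)\<^sup>2 / h) \<longlongrightarrow> 0) (at 0)"
    proof (rule Lim_null_comparison[OF _ tendsto_ident_at[THEN tendsto_rabs_zero]])
      have "norm ((max 0 h)\<^sup>2 / h) \<le> \<bar>h\<bar>" for h :: real
        by (auto simp: max_def power2_eq_square)
      then show "\<forall>\<^sub>F h::real in at 0. norm ((max 0 h)\<^sup>2 / h) \<le> \<bar>h\<bar>" by simp
    qed
    then show ?thesis using 3 by (simp add: DERIV_def)
  qed
qed

section \<open>Contact values\<close>

text \<open>The classical setting, kept on the open interval because the weight absorbed into
  \<open>M\<close> in \<open>euler_lagrange_interior\<close> may be singular at \<open>a\<close>.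
  \<open>p\<close> is the momentum along \<open>y\<close>; that it is differentiable is an
  assumption on the curve and does not come from \<open>v\<close>.\<close>

locale lagrange =
  fixes a b :: real
    and M Mx My Mw :: "real \<times> real \<times> real \<Rightarrow> real"
    and y v p p' :: "real \<Rightarrow> real"
  assumes M_deriv: "\<And>q. q \<in> {a<..<b} \<times> UNIV \<Longrightarrow>
      (M has_derivative (\<lambda>h. Mx q * fst h + My q * fst (snd h) + Mw q * snd (snd h))) (at q)"
    and cont_Mx: "continuous_on ({a<..<b} \<times> UNIV) Mx"
    and cont_My: "continuous_on ({a<..<b} \<times> UNIV) My"
    and cont_Mw: "continuous_on ({a<..<b} \<times> UNIV) Mw"
    and y_deriv: "\<And>x. a < x \<Longrightarrow> x < b \<Longrightarrow> (y has_real_derivative v x) (at x)"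
    and p_deriv: "\<And>x. a < x \<Longrightarrow> x < b \<Longrightarrow> (p has_real_derivative p' x) (at x)"
    and p_eq: "\<And>x. a < x \<Longrightarrow> x < b \<Longrightarrow> p x = Mw (x, y x, v x)"
begin

text \<open>\<open>w\<close> minimises \<open>M (s, y s, w') - p s * w'\<close> over
  \<open>w'\<close>. For \<open>w = v s\<close> this is Weierstrass's condition that the excess
  function is nonnegative, since \<open>p s\<close> is the derivative of
  \<open>M (s, y s, \<cdot>)\<close> at \<open>v s\<close>.\<close>

definition Ct :: "real \<Rightarrow> real \<Rightarrow> bool" where
  "Ct s w \<longleftrightarrow> (\<forall>w'. M (s, y s, w) + p s * (w' - w) \<le> M (s, y s, w'))"

text \<open>The Euler-Lagrange equation is \<open>d x = 0\<close>.\<close>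

definition d :: "real \<Rightarrow> real" where
  "d x = My (x, y x, v x) - p' x"

lemma open_dom: "open ({a<..<b} \<times> (UNIV :: (real \<times> real) set))"
  by (intro open_Times) auto

lemma isCont_M: "a < x \<Longrightarrow> x < b \<Longrightarrow> isCont M (x, q)"
  by (rule has_derivative_continuous[OF M_deriv]) auto

lemma isCont_parts:
  assumes "a < x" "x < b"
  shows "isCont Mx (x, q)" "isCont My (x, q)" "isCont Mw (x, q)"
  using assms cont_Mx cont_My cont_Mw
  by (cases q; auto simp: continuous_on_eq_continuous_at[OF open_dom])+

lemma isCont_y: "a < x \<Longrightarrow> x < b \<Longrightarrow> isCont y x"
  using y_deriv DERIV_isCont by blast

lemma isCont_p: "a < x \<Longrightarrow> x < b \<Longrightarrow> isCont p x"
  using p_deriv DERIV_isCont by blast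

lemma seq_lims:
  assumes "a < x" "x < b" "X \<longlonglongrightarrow> x" "Z \<longlonglongrightarrow> z" "W \<longlonglongrightarrow> w"
  shows "(\<lambda>n. M (X n, Z n, W n)) \<longlonglongrightarrow> M (x, z, w)"
    and "(\<lambda>n. Mx (X n, Z n, W n)) \<longlonglongrightarrow> Mx (x, z, w)"
    and "(\<lambda>n. My (X n, Z n, W n)) \<longlonglongrightarrow> My (x, z, w)"
    and "(\<lambda>n. Mw (X n, Z n, W n)) \<longlonglongrightarrow> Mw (x, z, w)"
  using assms by (auto intro!: isCont_tendsto_compose[OF isCont_M]
      isCont_tendsto_compose[OF isCont_parts(1)] isCont_tendsto_compose[OF isCont_parts(2)]
      isCont_tendsto_compose[OF isCont_parts(3)] tendsto_Pair)

lemma y_seq: "a < x \<Longrightarrow> x < b \<Longrightarrow> X \<longlonglongrightarrow> x \<Longrightarrow> (\<lambda>n. y (X n)) \<longlonglongrightarrow> y x"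
  by (rule isCont_tendsto_compose[OF isCont_y])

lemma p_seq: "a < x \<Longrightarrow> x < b \<Longrightarrow> X \<longlonglongrightarrow> x \<Longrightarrow> (\<lambda>n. p (X n)) \<longlonglongrightarrow> p x"
  by (rule isCont_tendsto_compose[OF isCont_p])

lemma M_chain:
  assumes "a < f t" "f t < b"
    and "(f has_real_derivative f') (at t)" "(g has_real_derivative g') (at t)"
    and "(h has_real_derivative h') (at t)"
  shows "((\<lambda>t. M (f t, g t, h t)) has_real_derivative
      Mx (f t, g t, h t) * f' + My (f t, g t, h t) * g' + Mw (f t, g t, h t) * h') (at t)"
proof -
  have "((\<lambda>t. (f t, g t, h t)) has_derivative (\<lambda>s. (f' * s, g' * s, h' * s))) (at t)"
    using assms(3-5) unfolding has_field_derivative_def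
    by (intro has_derivative_Pair)
  from has_derivative_compose[OF this M_deriv[of "(f t, g t, h t)"]] assms(1,2)
  have "((\<lambda>t. M (f t, g t, h t)) has_derivative (\<lambda>s. Mx (f t, g t, h t) * (f' * s)
      + My (f t, g t, h t) * (g' * s) + Mw (f t, g t, h t) * (h' * s))) (at t)"
    by simp
  then show ?thesis unfolding has_field_derivative_def
    by (rule has_derivative_eq_rhs) (auto simp: algebra_simps)
qed

lemma M_mvt:
  assumes "a < x0" "x0 < b" "a < x1" "x1 < b"
  obtains t where "0 < t" "t < 1"
    "M (x1, z1, w1) - M (x0, z0, w0) =
       Mx (x0 + t * (x1 - x0), z0 + t * (z1 - z0), w0 + t * (w1 - w0)) * (x1 - x0) +
       My (x0 + t * (x1 - x0), z0 + t * (z1 - z0), w0 + t * (w1 - w0)) * (z1 - z0) +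
       Mw (x0 + t * (x1 - x0), z0 + t * (z1 - z0), w0 + t * (w1 - w0)) * (w1 - w0)"
proof -
  let ?f = "\<lambda>t. x0 + t * (x1 - x0)" and ?g = "\<lambda>t. z0 + t * (z1 - z0)"
    and ?h = "\<lambda>t. w0 + t * (w1 - w0)"
  have "\<exists>t>0. t < 1 \<and> M (?f 1, ?g 1, ?h 1) - M (?f 0, ?g 0, ?h 0) = (1 - 0) *
      (Mx (?f t, ?g t, ?h t) * (x1 - x0) + My (?f t, ?g t, ?h t) * (z1 - z0)
        + Mw (?f t, ?g t, ?h t) * (w1 - w0))"
  proof (rule MVT2)
    fix t :: real assume t: "0 \<le> t" "t \<le> 1"
    have "?f t = (1 - t) * x0 + t * x1" by (simp add: algebra_simps)
    then have "a < ?f t" "?f t < b"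
      using convex_bound_lt[of x0 b x1 "1-t" t] convex_bound_lt[of "-x0" "-a" "-x1" "1-t" t] assms t
      by auto
    then show "((\<lambda>t. M (?f t, ?g t, ?h t)) has_real_derivative
        (Mx (?f t, ?g t, ?h t) * (x1 - x0) + My (?f t, ?g t, ?h t) * (z1 - z0)
        + Mw (?f t, ?g t, ?h t) * (w1 - w0))) (at t)"
      by (intro M_chain) (auto intro!: derivative_eq_intros)
  qed simp
  then show ?thesis using that by auto
qed

lemma phi_deriv:
  assumes "a < x" "x < b"
  shows "((\<lambda>x. M (x, y x, w)) has_real_derivative Mx (x, y x, w) + My (x, y x, w) * v x) (at x)"
  using M_chain[of "\<lambda>x. x" x 1 y "v x" "\<lambda>_. w" 0] assms y_deriv by auto

text \<open>The velocity \<open>W n\<close> moves with \<open>n\<close>, so \<open>phi_deriv\<close>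
  at a fixed velocity is not enough. The mean value theorem on the segment from \<open>s\<close> to
  \<open>X n\<close> evaluates \<open>Mx\<close> and \<open>My\<close> at points that converge to
  the limit point.\<close>

lemma phi_quot:
  assumes s: "a < s" "s < b" and X: "X \<longlonglongrightarrow> s" "\<And>n. a < X n" "\<And>n. X n < b" "\<And>n. X n \<noteq> s"
    and W: "W \<longlonglongrightarrow> w"
  shows "(\<lambda>n. (M (X n, y (X n), W n) - M (s, y s, W n)) / (X n - s))
    \<longlonglongrightarrow> Mx (s, y s, w) + My (s, y s, w) * v s"
proof -
  have "\<exists>t. 0 < t \<and> t < 1 \<and> M (X n, y (X n), W n) - M (s, y s, W n) =
     Mx (s + t * (X n - s), y s + t * (y (X n) - y s), W n) * (X n - s) +
     My (s + t * (X n - s), y s + t * (y (X n) - y s), W n) * (y (X n) - y s)" for n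
    using M_mvt[OF s X(2,3)[of n], of "y (X n)" "W n" "y s" "W n"]
    by (metis (no_types, lifting) add.right_neutral diff_self mult_zero_right)
  then obtain t where t: "\<And>n. 0 < t n \<and> t n < 1" "\<And>n. M (X n, y (X n), W n) - M (s, y s, W n) =
     Mx (s + t n * (X n - s), y s + t n * (y (X n) - y s), W n) * (X n - s) +
     My (s + t n * (X n - s), y s + t n * (y (X n) - y s), W n) * (y (X n) - y s)"
    by metis
  have small: "(\<lambda>n. t n * u n) \<longlonglongrightarrow> 0" if "u \<longlonglongrightarrow> 0" for u :: "nat \<Rightarrow> real"
  proof (rule Lim_null_comparison[OF _ tendsto_norm_zero[OF that]])
    have "\<bar>t n\<bar> * \<bar>u n\<bar> \<le> \<bar>u n\<bar>" for n
      using t(1)[of n] by (intro mult_left_le_one_le) auto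
    then show "\<forall>\<^sub>F n in sequentially. norm (t n * u n) \<le> norm (u n)" by (simp add: abs_mult)
  qed
  have l1: "(\<lambda>n. s + t n * (X n - s)) \<longlonglongrightarrow> s + 0"
    by (intro tendsto_intros small LIM_zero X)
  have l2: "(\<lambda>n. y s + t n * (y (X n) - y s)) \<longlonglongrightarrow> y s + 0"
    by (intro tendsto_intros small LIM_zero y_seq s X)
  have "((\<lambda>x. (y x - y s) / (x - s)) \<longlongrightarrow> v s) (at s)"
    using y_deriv[OF s] by (simp add: has_field_derivative_iff)
  moreover have "filterlim X (at s) sequentially"
    using X by (auto simp: filterlim_at)
  ultimately have l3: "(\<lambda>n. (y (X n) - y s) / (X n - s)) \<longlonglongrightarrow> v s"
    by (rule filterlim_compose)
  have "(M (X n, y (X n), W n) - M (s, y s, W n)) / (X n - s) =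
     Mx (s + t n * (X n - s), y s + t n * (y (X n) - y s), W n) +
     My (s + t n * (X n - s), y s + t n * (y (X n) - y s), W n) * ((y (X n) - y s) / (X n - s))" for n
    using t(2)[of n] X(4)[of n] by (simp add: add_divide_distrib)
  moreover have "(\<lambda>n. Mx (s + t n * (X n - s), y s + t n * (y (X n) - y s), W n) +
     My (s + t n * (X n - s), y s + t n * (y (X n) - y s), W n) * ((y (X n) - y s) / (X n - s)))
     \<longlonglongrightarrow> Mx (s, y s, w) + My (s, y s, w) * v s"
    using l1 l2 l3 W s by (intro tendsto_intros seq_lims) auto
  ultimately show ?thesis by presburger
qed

lemma Ct_closed:
  assumes s: "a < s" "s < b" and "X \<longlonglongrightarrow> s" "W \<longlonglongrightarrow> w" "\<And>n. Ct (X n) (W n)"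
  shows "Ct s w"
  unfolding Ct_def
proof
  fix w'
  show "M (s, y s, w) + p s * (w' - w) \<le> M (s, y s, w')"
  proof (rule LIMSEQ_le)
    show "(\<lambda>n. M (X n, y (X n), W n) + p (X n) * (w' - W n)) \<longlonglongrightarrow> M (s, y s, w) + p s * (w' - w)"
      using assms by (intro tendsto_intros seq_lims y_seq p_seq) auto
    show "(\<lambda>n. M (X n, y (X n), w')) \<longlonglongrightarrow> M (s, y s, w')"
      using assms by (intro tendsto_intros seq_lims y_seq) auto
  qed (use assms(5) in \<open>auto simp: Ct_def\<close>)
qed

text \<open>By the mean value theorem the difference quotients of \<open>y\<close> at
  \<open>s\<close> are values of \<open>v\<close> to the right of \<open>s\<close>. Hence
  \<open>v s\<close> is a limit value of \<open>v\<close> from each side, however discontinuous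
  \<open>v\<close> is.\<close>

lemma right_seq:
  assumes s: "a < s" "s < b"
  obtains X where "X \<longlonglongrightarrow> s" "\<And>n. s < X n" "\<And>n. X n < b" "(\<lambda>n. v (X n)) \<longlonglongrightarrow> v s"
proof -
  define h where "h n = (b - s) / real (Suc (Suc n))" for n
  have h: "0 < h n" "s + h n < b" for n
  proof -
    show "0 < h n" using s by (simp add: h_def)
    have "(b - s) / real (Suc (Suc n)) < (b - s) / 1" using s by (intro divide_strict_left_mono) auto
    then show "s + h n < b" by (simp add: h_def)
  qed
  have h0: "h \<longlonglongrightarrow> 0" unfolding h_def
    using LIMSEQ_Suc[OF LIMSEQ_Suc[OF lim_const_over_n[of "b - s"]]] by simp
  have "\<exists>x. s < x \<and> x < s + h n \<and> y (s + h n) - y s = (s + h n - s) * v x" for n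
    using h[of n] s by (intro MVT2 y_deriv) auto
  then obtain X where X: "\<And>n. s < X n" "\<And>n. X n < s + h n"
    "\<And>n. y (s + h n) - y s = h n * v (X n)" by (metis add_diff_cancel_left')
  have "((\<lambda>k. (y (s + k) - y s) / k) \<longlongrightarrow> v s) (at 0)"
    using y_deriv[OF s] by (simp add: DERIV_def)
  moreover have "filterlim h (at 0) sequentially"
    using h0 h by (auto simp: filterlim_at less_imp_neq[THEN not_sym])
  ultimately have "(\<lambda>n. (y (s + h n) - y s) / h n) \<longlonglongrightarrow> v s" by (rule filterlim_compose)
  moreover have "(y (s + h n) - y s) / h n = v (X n)" for n using X(3)[of n] h(1)[of n] by simp
  ultimately have "(\<lambda>n. v (X n)) \<longlonglongrightarrow> v s" by simp
  moreover have "X \<longlonglongrightarrow> s"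
  proof (rule tendsto_sandwich)
    show "(\<lambda>n. s) \<longlonglongrightarrow> s" by simp
    show "(\<lambda>n. s + h n) \<longlonglongrightarrow> s" using tendsto_add[OF tendsto_const h0, of s] by simp
  qed (use X(1,2) in \<open>simp_all add: less_imp_le\<close>)
  ultimately show ?thesis using X h that by (meson order.strict_trans)
qed

lemma left_seq:
  assumes s: "a < s" "s < b"
  obtains X where "X \<longlonglongrightarrow> s" "\<And>n. X n < s" "\<And>n. a < X n" "(\<lambda>n. v (X n)) \<longlonglongrightarrow> v s"
proof -
  define h where "h n = (s - a) / real (Suc (Suc n))" for n
  have h: "0 < h n" "a < s - h n" for n
  proof -
    show "0 < h n" using s by (simp add: h_def)
    have "(s - a) / real (Suc (Suc n)) < (s - a) / 1" using s by (intro divide_strict_left_mono) auto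
    then show "a < s - h n" by (simp add: h_def)
  qed
  have h0: "h \<longlonglongrightarrow> 0" unfolding h_def
    using LIMSEQ_Suc[OF LIMSEQ_Suc[OF lim_const_over_n[of "s - a"]]] by simp
  have "\<exists>x. s - h n < x \<and> x < s \<and> y s - y (s - h n) = (s - (s - h n)) * v x" for n
    using h[of n] s by (intro MVT2 y_deriv) auto
  then obtain X where X: "\<And>n. X n < s" "\<And>n. s - h n < X n"
    "\<And>n. y s - y (s - h n) = h n * v (X n)" by (metis diff_diff_eq2 add_diff_cancel_left')
  have "((\<lambda>k. (y (s + k) - y s) / k) \<longlongrightarrow> v s) (at 0)"
    using y_deriv[OF s] by (simp add: DERIV_def)
  moreover have "filterlim (\<lambda>n. - h n) (at 0) sequentially"
    using tendsto_minus[OF h0] h by (auto simp: filterlim_at less_imp_neq[THEN not_sym])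
  ultimately have "(\<lambda>n. (y (s + - h n) - y s) / (- h n)) \<longlonglongrightarrow> v s" by (rule filterlim_compose)
  moreover have "(y (s + - h n) - y s) / (- h n) = v (X n)" for n
    using X(3)[of n] h(1)[of n] by (simp add: field_simps)
  ultimately have "(\<lambda>n. v (X n)) \<longlonglongrightarrow> v s" by simp
  moreover have "X \<longlonglongrightarrow> s"
  proof (rule tendsto_sandwich)
    show "(\<lambda>n. s - h n) \<longlonglongrightarrow> s" using tendsto_diff[OF tendsto_const h0, of s] by simp
    show "(\<lambda>n. s) \<longlonglongrightarrow> s" by simp
  qed (use X(1,2) in \<open>simp_all add: less_imp_le\<close>)
  ultimately show ?thesis using X h that by (meson order.strict_trans)
qed

end

locale contact = lagrange +
  assumes contact: "\<And>x. a < x \<Longrightarrow> x < b \<Longrightarrow> Ct x (v x)"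
begin

text \<open>Contact at \<open>X n\<close> is tested against \<open>w\<close>, and contact of
  \<open>w\<close> at \<open>s\<close> against \<open>v (X n)\<close>. Adding the two inequalities
  leaves increments over \<open>[s, X n]\<close>, which are divided by \<open>X n - s\<close>; the
  sign \<sigma> records the side of \<open>s\<close> and so the direction of the inequality.\<close>

lemma tau_le:
  assumes s: "a < s" "s < b" and X: "X \<longlonglongrightarrow> s" "\<And>n. a < X n" "\<And>n. X n < b"
    and vX: "(\<lambda>n. v (X n)) \<longlonglongrightarrow> v s" and w: "Ct s w" and \<sigma>: "\<bar>\<sigma>\<bar> = 1" "\<And>n. \<sigma> * (X n - s) > 0"
  shows "\<sigma> * (Mx (s, y s, v s) + My (s, y s, v s) * v s - p' s * v s)
    \<le> \<sigma> * (Mx (s, y s, w) + My (s, y s, w) * v s - p' s * w)"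
proof -
  have ne: "X n \<noteq> s" for n using \<sigma>(2)[of n] by auto
  have "((\<lambda>x. (p x - p s) / (x - s)) \<longlongrightarrow> p' s) (at s)"
    using p_deriv[OF s] by (simp add: has_field_derivative_iff)
  moreover have "filterlim X (at s) sequentially"
    using X ne by (auto simp: filterlim_at)
  ultimately have lp: "(\<lambda>n. (p (X n) - p s) / (X n - s)) \<longlonglongrightarrow> p' s"
    by (rule filterlim_compose)
  show ?thesis
  proof (rule LIMSEQ_le)
    show "(\<lambda>n. \<sigma> * ((M (X n, y (X n), v (X n)) - M (s, y s, v (X n))) / (X n - s)
        - (p (X n) - p s) / (X n - s) * v (X n)))
      \<longlonglongrightarrow> \<sigma> * (Mx (s, y s, v s) + My (s, y s, v s) * v s - p' s * v s)"
      by (intro tendsto_intros phi_quot lp s X ne vX)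
    show "(\<lambda>n. \<sigma> * ((M (X n, y (X n), w) - M (s, y s, w)) / (X n - s)
        - (p (X n) - p s) / (X n - s) * w))
      \<longlonglongrightarrow> \<sigma> * (Mx (s, y s, w) + My (s, y s, w) * v s - p' s * w)"
      by (intro tendsto_intros phi_quot lp s X ne)
    have "\<sigma> * ((M (X n, y (X n), v (X n)) - M (s, y s, v (X n))) / (X n - s)
        - (p (X n) - p s) / (X n - s) * v (X n))
      \<le> \<sigma> * ((M (X n, y (X n), w) - M (s, y s, w)) / (X n - s)
        - (p (X n) - p s) / (X n - s) * w)" (is "\<sigma> * (?A / ?D - ?P / ?D * _) \<le> \<sigma> * (?B / ?D - _)") for n
    proof -
      have 1: "M (X n, y (X n), v (X n)) + p (X n) * (w - v (X n)) \<le> M (X n, y (X n), w)"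
        using contact[OF X(2,3)[of n]] by (simp add: Ct_def)
      have 2: "M (s, y s, w) + p s * (v (X n) - w) \<le> M (s, y s, v (X n))"
        using w by (simp add: Ct_def)
      have le: "?A - ?P * v (X n) \<le> ?B - ?P * w"
        using 1 2 by (simp add: algebra_simps)
      have pos: "0 < \<sigma> / ?D"
      proof -
        have "\<sigma> / ?D = \<sigma> * ?D / ?D^2" by (simp add: power2_eq_square)
        then show ?thesis using \<sigma>(2)[of n] ne[of n] by auto
      qed
      have "\<sigma> * (?A / ?D - ?P / ?D * v (X n)) = \<sigma> / ?D * (?A - ?P * v (X n))"
        by (simp add: algebra_simps diff_divide_distrib)
      also have "\<dots> \<le> \<sigma> / ?D * (?B - ?P * w)" using le pos by (intro mult_left_mono) auto
      also have "\<dots> = \<sigma> * (?B / ?D - ?P / ?D * w)"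
        by (simp add: algebra_simps diff_divide_distrib)
      finally show ?thesis .
    qed
    then show "\<exists>N. \<forall>n\<ge>N. \<sigma> * ((M (X n, y (X n), v (X n)) - M (s, y s, v (X n))) / (X n - s)
        - (p (X n) - p s) / (X n - s) * v (X n))
      \<le> \<sigma> * ((M (X n, y (X n), w) - M (s, y s, w)) / (X n - s)
        - (p (X n) - p s) / (X n - s) * w)" by auto
  qed
qed

text \<open>The envelope \<open>\<min>\<^sub>w (M (x, y x, w) - p x w)\<close> is touched from above at \<open>s\<close> by the graphs belonging to
  the contact values, so these have a common slope.\<close>

lemma tau:
  assumes s: "a < s" "s < b" and w: "Ct s w"
  shows "Mx (s, y s, w) + My (s, y s, w) * v s - p' s * w
    = Mx (s, y s, v s) + My (s, y s, v s) * v s - p' s * v s"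
proof -
  obtain X where X: "X \<longlonglongrightarrow> s" "\<And>n. s < X n" "\<And>n. X n < b" "(\<lambda>n. v (X n)) \<longlonglongrightarrow> v s"
    using right_seq[OF s] by blast
  have 1: "1 * (Mx (s, y s, v s) + My (s, y s, v s) * v s - p' s * v s)
    \<le> 1 * (Mx (s, y s, w) + My (s, y s, w) * v s - p' s * w)"
    by (rule tau_le[OF s X(1) _ X(3,4) w]) (use X(2) s in \<open>auto intro: order.strict_trans\<close>)
  obtain X where X: "X \<longlonglongrightarrow> s" "\<And>n. X n < s" "\<And>n. a < X n" "(\<lambda>n. v (X n)) \<longlonglongrightarrow> v s"
    using left_seq[OF s] by blast
  have 2: "- 1 * (Mx (s, y s, v s) + My (s, y s, v s) * v s - p' s * v s)
    \<le> - 1 * (Mx (s, y s, w) + My (s, y s, w) * v s - p' s * w)"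
    by (rule tau_le[OF s X(1,3) _ X(4) w]) (use X(2) s in \<open>auto intro: order.strict_trans\<close>)
  show ?thesis
    using 1 2 unfolding mult_1 mult_minus1 neg_le_iff_le by (rule antisym[rotated])
qed

text \<open>Used with two different contact values, this computes \<open>p' s\<close> from data that
  do not involve \<open>p'\<close>.\<close>

lemma tau_diff:
  assumes "a < s" "s < b" "Ct s w" "Ct s w'"
  shows "p' s * (w - w') = Mx (s, y s, w) - Mx (s, y s, w') + v s * (My (s, y s, w) - My (s, y s, w'))"
  using tau[OF assms(1-3)] tau[OF assms(1,2,4)] by (simp add: algebra_simps)

end

section \<open>Downward crossings of a band of velocities\<close>

context contact
begin

text \<open>Darboux's property yields points arbitrarily near \<open>s\<close> where
  \<open>v\<close> equals \<open>w\<close>. There \<open>w\<close> is a contact value, and contact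
  passes to limits.\<close>

lemma Ct_between:
  assumes s: "a < s" "s < b"
    and near: "\<And>\<epsilon>. \<epsilon> > 0 \<Longrightarrow> \<exists>x1 x2. a < x1 \<and> x1 < b \<and> \<bar>x1 - s\<bar> < \<epsilon> \<and> v x1 \<le> w
      \<and> a < x2 \<and> x2 < b \<and> \<bar>x2 - s\<bar> < \<epsilon> \<and> w \<le> v x2"
  shows "Ct s w"
proof -
  have "\<exists>x. a < x \<and> x < b \<and> \<bar>x - s\<bar> < \<epsilon> \<and> v x = w" if "\<epsilon> > 0" for \<epsilon>
  proof -
    from near[OF that] obtain x1 x2 where x: "a < x1" "x1 < b" "\<bar>x1 - s\<bar> < \<epsilon>" "v x1 \<le> w"
      "a < x2" "x2 < b" "\<bar>x2 - s\<bar> < \<epsilon>" "w \<le> v x2" by blast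
    show ?thesis
    proof (cases "v x1 = w \<or> v x2 = w")
      case True
      then show ?thesis using x by blast
    next
      case False
      have "\<exists>x \<in> open_segment x1 x2. v x = w"
        using x False
        by (intro darboux_derivative[of x1 x2 y v w] y_deriv) (auto simp: closed_segment_eq_real_ivl split: if_splits)
      then obtain x0 where "x0 \<in> open_segment x1 x2" "v x0 = w" by blast
      then show ?thesis using x
        by (intro exI[of _ x0]) (auto simp: open_segment_eq_real_ivl split: if_splits)
    qed
  qed
  then have "\<forall>n. \<exists>x. a < x \<and> x < b \<and> \<bar>x - s\<bar> < inverse (real (Suc n)) \<and> v x = w" by simp
  then obtain X where X: "\<And>n. a < X n" "\<And>n. X n < b" "\<And>n. \<bar>X n - s\<bar> < inverse (real (Suc n))"
    "\<And>n. v (X n) = w" by metis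
  have "(\<lambda>n. X n - s) \<longlonglongrightarrow> 0"
    by (rule Lim_null_comparison[OF _ LIMSEQ_inverse_real_of_nat]) (use X(3) in \<open>auto intro!: always_eventually less_imp_le\<close>)
  then have "X \<longlonglongrightarrow> s" by (rule LIM_zero_cancel)
  moreover have "Ct (X n) w" for n using contact[OF X(1,2), of n] X(4)[of n] by simp
  ultimately show ?thesis using Ct_closed[OF s _ tendsto_const] by blast
qed

text \<open>\<open>s\<close> is the supremum of the points with \<open>\<beta>2 \<le> v\<close>, and
  \<open>t\<close> the infimum of the later ones with \<open>v \<le> \<beta>1\<close>. As
  \<open>v\<close> is discontinuous, \<open>v s\<close> and \<open>v t\<close> need not equal the
  edges; these are recovered as contact values, and the last two conclusions keep the approach to
  them. A crossing that is a jump has \<open>s = t\<close>.\<close>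

lemma downward_crossing:
  assumes x: "a < x1" "x1 < x2" "x2 < b" and v: "\<beta>2 \<le> v x1" "v x2 \<le> \<beta>1" and \<beta>: "\<beta>1 < \<beta>2"
  obtains s t where "x1 \<le> s" "s \<le> t" "t \<le> x2" "Ct s \<beta>2" "Ct t \<beta>1"
    "\<And>x. s < x \<Longrightarrow> x < t \<Longrightarrow> \<beta>1 < v x \<and> v x < \<beta>2"
    "\<And>\<epsilon>. \<epsilon> > 0 \<Longrightarrow> \<exists>x. x1 \<le> x \<and> x \<le> s \<and> s - \<epsilon> < x \<and> \<beta>2 \<le> v x"
    "\<And>\<epsilon>. \<epsilon> > 0 \<Longrightarrow> \<exists>x. t \<le> x \<and> x \<le> x2 \<and> x < t + \<epsilon> \<and> v x \<le> \<beta>1"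
proof -
  define A where "A = {x \<in> {x1..x2}. \<beta>2 \<le> v x}"
  define s where "s = Sup A"
  have "x1 \<in> A" using x v by (auto simp: A_def)
  then have A: "A \<noteq> {}" "bdd_above A" "A \<subseteq> {x1..x2}" unfolding A_def by (auto intro!: bdd_aboveI[of _ x2])
  have s: "x1 \<le> s" "s \<le> x2"
  proof -
    have "x1 \<in> A" using x v by (auto simp: A_def)
    then show "x1 \<le> s" unfolding s_def using A by (intro cSup_upper)
    show "s \<le> x2" unfolding s_def using A by (intro cSup_least) auto
  qed
  have above_s: "v x < \<beta>2" if "s < x" "x \<le> x2" for x
    using that s cSup_upper[OF _ A(2), of x] unfolding s_def[symmetric] by (force simp: A_def)
  have near_s: "\<exists>x. x1 \<le> x \<and> x \<le> s \<and> s - \<epsilon> < x \<and> \<beta>2 \<le> v x" if "\<epsilon> > 0" for \<epsilon>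
  proof -
    have "s - \<epsilon> < Sup A" using that by (simp add: s_def)
    then obtain z where "z \<in> A" "s - \<epsilon> < z" using less_cSup_iff[OF A(1,2)] by auto
    moreover have "z \<le> s" unfolding s_def using \<open>z \<in> A\<close> A by (intro cSup_upper)
    ultimately show ?thesis by (auto simp: A_def)
  qed
  define C where "C = {x \<in> {s..x2}. v x \<le> \<beta>1}"
  define t where "t = Inf C"
  have "x2 \<in> C" using s v by (auto simp: C_def)
  have C: "C \<noteq> {}" "bdd_below C" "C \<subseteq> {s..x2}"
    using \<open>x2 \<in> C\<close> unfolding C_def by (auto intro!: bdd_belowI[of _ s])
  have t: "s \<le> t" "t \<le> x2"
  proof -
    show "t \<le> x2" unfolding t_def using \<open>x2 \<in> C\<close> C by (intro cInf_lower)
    show "s \<le> t" unfolding t_def using C by (intro cInf_greatest) auto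
  qed
  have below_t: "\<beta>1 < v x" if "s \<le> x" "x < t" for x
    using that t cInf_lower[OF _ C(2), of x] unfolding t_def[symmetric] by (force simp: C_def)
  have near_t: "\<exists>x. t \<le> x \<and> x \<le> x2 \<and> x < t + \<epsilon> \<and> v x \<le> \<beta>1" if "\<epsilon> > 0" for \<epsilon>
  proof -
    have "Inf C < t + \<epsilon>" using that by (simp add: t_def)
    then obtain z where "z \<in> C" "z < t + \<epsilon>" using cInf_less_iff[OF C(1,2)] by auto
    moreover have "t \<le> z" unfolding t_def using \<open>z \<in> C\<close> C by (intro cInf_lower)
    ultimately show ?thesis by (auto simp: C_def)
  qed
  have ct1: "Ct s \<beta>2"
  proof (rule Ct_between)
    fix \<epsilon> :: real assume "\<epsilon> > 0"
    obtain u2 where "x1 \<le> u2" "u2 \<le> s" "s - \<epsilon> < u2" "\<beta>2 \<le> v u2" using near_s[OF \<open>\<epsilon> > 0\<close>] by blast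
    moreover obtain u1 where "s \<le> u1" "u1 \<le> x2" "u1 < s + \<epsilon>" "v u1 \<le> \<beta>2"
    proof (cases "s = x2")
      case True
      then show ?thesis using that[of s] v \<beta> \<open>\<epsilon> > 0\<close> by auto
    next
      case False
      define u1 where "u1 = min x2 (s + \<epsilon>/2)"
      have "s < u1" "u1 \<le> x2" "u1 < s + \<epsilon>" using False s \<open>\<epsilon> > 0\<close> by (auto simp: u1_def min_def)
      then show ?thesis using that[of u1] above_s[of u1] by auto
    qed
    ultimately show "\<exists>x1 x2. a < x1 \<and> x1 < b \<and> \<bar>x1 - s\<bar> < \<epsilon> \<and> v x1 \<le> \<beta>2
      \<and> a < x2 \<and> x2 < b \<and> \<bar>x2 - s\<bar> < \<epsilon> \<and> \<beta>2 \<le> v x2"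
      using x s by (intro exI[of _ u1] exI[of _ u2]) auto
  qed (use x s in auto)
  have ct2: "Ct t \<beta>1"
  proof (rule Ct_between)
    fix \<epsilon> :: real assume "\<epsilon> > 0"
    obtain u1 where "t \<le> u1" "u1 \<le> x2" "u1 < t + \<epsilon>" "v u1 \<le> \<beta>1" using near_t[OF \<open>\<epsilon> > 0\<close>] by blast
    moreover obtain u2 where "x1 \<le> u2" "u2 \<le> t" "t - \<epsilon> < u2" "\<beta>1 \<le> v u2"
    proof (cases "s = t")
      case True
      then show ?thesis using that near_s[OF \<open>\<epsilon> > 0\<close>] \<beta> by fastforce
    next
      case False
      define u2 where "u2 = max s (t - \<epsilon>/2)"
      have "s \<le> u2" "u2 < t" "t - \<epsilon> < u2" using False t \<open>\<epsilon> > 0\<close> by (auto simp: u2_def max_def)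
      then show ?thesis using that[of u2] below_t[of u2] s by auto
    qed
    ultimately show "\<exists>x1 x2. a < x1 \<and> x1 < b \<and> \<bar>x1 - t\<bar> < \<epsilon> \<and> v x1 \<le> \<beta>1
      \<and> a < x2 \<and> x2 < b \<and> \<bar>x2 - t\<bar> < \<epsilon> \<and> \<beta>1 \<le> v x2"
      using x s t by (intro exI[of _ u1] exI[of _ u2]) auto
  qed (use x s t in auto)
  show ?thesis
  proof (rule that[OF s(1) t ct1 ct2 _ near_s near_t])
    fix x assume "s < x" "x < t"
    then show "\<beta>1 < v x \<and> v x < \<beta>2" using above_s[of x] below_t[of x] t by auto
  qed
qed

text \<open>If downward crossings of a band can only be jumps, and only at points where \<open>v\<close> lies outside
  the band, there are none: on the closed set of jumps Baire's theorem gives a piece where \<open>v\<close> stays on one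
  side of the band, and at the first (or last) jump of a crossing inside this piece
  \<open>v\<close> has the wrong one-sided limit values.\<close>

lemma no_downward_crossing:
  assumes lr: "a \<le> l" "r \<le> b" and \<beta>: "\<beta>1 < \<beta>2"
    and H1: "\<And>s t. l < s \<Longrightarrow> s < t \<Longrightarrow> t < r \<Longrightarrow> Ct s \<beta>2 \<Longrightarrow> Ct t \<beta>1 \<Longrightarrow>
        (\<And>x. s < x \<Longrightarrow> x < t \<Longrightarrow> \<beta>1 < v x \<and> v x < \<beta>2) \<Longrightarrow> False"
    and H2: "\<And>s. l < s \<Longrightarrow> s < r \<Longrightarrow> Ct s \<beta>2 \<Longrightarrow> Ct s \<beta>1 \<Longrightarrow> \<beta>1 \<le> v s \<Longrightarrow> v s \<le> \<beta>2 \<Longrightarrow> False"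
    and x: "l < x1" "x1 < x2" "x2 < r" and v: "\<beta>2 \<le> v x1" "v x2 \<le> \<beta>1"
  shows False
proof -
  define S where "S = {s \<in> {x1..x2}. \<forall>\<epsilon>>0. \<exists>u1 u2. x1 \<le> u1 \<and> u1 < u2 \<and> u2 \<le> x2 \<and>
      \<bar>u1 - s\<bar> < \<epsilon> \<and> \<bar>u2 - s\<bar> < \<epsilon> \<and> \<beta>2 \<le> v u1 \<and> v u2 \<le> \<beta>1}"
  have jump: "\<exists>s\<in>S. u1 \<le> s \<and> s \<le> u2"
    if u: "x1 \<le> u1" "u1 < u2" "u2 \<le> x2" "\<beta>2 \<le> v u1" "v u2 \<le> \<beta>1" for u1 u2
  proof -
    have "a < u1" "u2 < b" using u x lr by auto
    then obtain s t where st: "u1 \<le> s" "s \<le> t" "t \<le> u2" "Ct s \<beta>2" "Ct t \<beta>1"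
      "\<And>x. s < x \<Longrightarrow> x < t \<Longrightarrow> \<beta>1 < v x \<and> v x < \<beta>2"
      "\<And>\<epsilon>. \<epsilon> > 0 \<Longrightarrow> \<exists>x. u1 \<le> x \<and> x \<le> s \<and> s - \<epsilon> < x \<and> \<beta>2 \<le> v x"
      "\<And>\<epsilon>. \<epsilon> > 0 \<Longrightarrow> \<exists>x. t \<le> x \<and> x \<le> u2 \<and> x < t + \<epsilon> \<and> v x \<le> \<beta>1"
      using downward_crossing[OF _ u(2) _ u(4,5) \<beta>] by metis
    have "s = t"
    proof (rule ccontr)
      assume "s \<noteq> t"
      then show False using H1[of s t] st(1-6) u x by simp
    qed
    have "s \<in> S" unfolding S_def
    proof (intro CollectI conjI allI impI)
      show "s \<in> {x1..x2}" using st u by auto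
      fix \<epsilon> :: real assume "\<epsilon> > 0"
      obtain z1 where z1: "u1 \<le> z1" "z1 \<le> s" "s - \<epsilon> < z1" "\<beta>2 \<le> v z1" using st(7)[OF \<open>\<epsilon> > 0\<close>] by blast
      obtain z2 where z2: "t \<le> z2" "z2 \<le> u2" "z2 < t + \<epsilon>" "v z2 \<le> \<beta>1" using st(8)[OF \<open>\<epsilon> > 0\<close>] by blast
      have "z1 \<noteq> z2" using z1 z2 \<beta> by auto
      then show "\<exists>u1 u2. x1 \<le> u1 \<and> u1 < u2 \<and> u2 \<le> x2 \<and>
        \<bar>u1 - s\<bar> < \<epsilon> \<and> \<bar>u2 - s\<bar> < \<epsilon> \<and> \<beta>2 \<le> v u1 \<and> v u2 \<le> \<beta>1"
        using z1 z2 u \<open>s = t\<close> by (intro exI[of _ z1] exI[of _ z2]) auto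
    qed
    then show ?thesis using st by (auto intro!: bexI[of _ s])
  qed
  have "closure S \<subseteq> S"
  proof
    fix s assume "s \<in> closure S"
    then have cl: "\<exists>z\<in>S. \<bar>z - s\<bar> < \<epsilon>" if "\<epsilon> > 0" for \<epsilon>
      using that by (auto simp: closure_approachable dist_real_def)
    have "S \<subseteq> {x1..x2}" by (auto simp: S_def)
    then have "s \<in> {x1..x2}" using \<open>s \<in> closure S\<close> by (meson closed_atLeastAtMost closure_minimal subsetD)
    moreover have "\<exists>u1 u2. x1 \<le> u1 \<and> u1 < u2 \<and> u2 \<le> x2 \<and>
        \<bar>u1 - s\<bar> < \<epsilon> \<and> \<bar>u2 - s\<bar> < \<epsilon> \<and> \<beta>2 \<le> v u1 \<and> v u2 \<le> \<beta>1" if \<epsilon>: "\<epsilon> > 0" for \<epsilon>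
    proof -
      obtain z where z: "z \<in> S" "\<bar>z - s\<bar> < \<epsilon>/2" using cl[of "\<epsilon>/2"] \<epsilon> by auto
      then obtain u1 u2 where "x1 \<le> u1" "u1 < u2" "u2 \<le> x2" "\<bar>u1 - z\<bar> < \<epsilon>/2" "\<bar>u2 - z\<bar> < \<epsilon>/2"
        "\<beta>2 \<le> v u1" "v u2 \<le> \<beta>1" using \<epsilon> by (auto simp: S_def dest!: spec[of _ "\<epsilon>/2"])
      moreover have "\<bar>u1 - s\<bar> < \<epsilon>" "\<bar>u2 - s\<bar> < \<epsilon>" using calculation z(2) by linarith+
      ultimately show ?thesis by blast
    qed
    ultimately show "s \<in> S" by (simp add: S_def)
  qed
  then have clS: "closed S" by (simp add: closure_subset_eq)
  have neS: "S \<noteq> {}" using jump[of x1 x2] x v by auto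
  have off: "v s < \<beta>1 \<or> \<beta>2 < v s" if "s \<in> S" for s
  proof (rule ccontr)
    assume "\<not> ?thesis"
    then have mid: "\<beta>1 \<le> v s" "v s \<le> \<beta>2" by auto
    have s: "l < s" "s < r" "a < s" "s < b" using that x lr by (auto simp: S_def)
    have near: "\<exists>u1 u2. a < u1 \<and> u1 < b \<and> \<bar>u1 - s\<bar> < \<epsilon> \<and> v u1 \<le> \<beta>1
      \<and> a < u2 \<and> u2 < b \<and> \<bar>u2 - s\<bar> < \<epsilon> \<and> \<beta>2 \<le> v u2" if "\<epsilon> > 0" for \<epsilon>
    proof -
      from \<open>s \<in> S\<close> \<open>\<epsilon> > 0\<close> obtain u1 u2 where "x1 \<le> u1" "u1 < u2" "u2 \<le> x2" "\<bar>u1 - s\<bar> < \<epsilon>" "\<bar>u2 - s\<bar> < \<epsilon>"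
        "\<beta>2 \<le> v u1" "v u2 \<le> \<beta>1" by (auto simp: S_def)
      then show ?thesis using x lr by (intro exI[of _ u2] exI[of _ u1]) auto
    qed
    have "Ct s \<beta>1" using \<beta> near by (intro Ct_between s) (meson less_imp_le order.trans)
    moreover have "Ct s \<beta>2" using \<beta> near by (intro Ct_between s) (meson less_imp_le order.trans)
    ultimately show False using H2 s mid by blast
  qed
  \<comment> \<open>On \<open>S\<close> the values of \<open>v\<close> avoid the band. Oscillation
    of at most half its width therefore forces them to one and the same side of it near
    \<open>z\<close>.\<close>
  have "\<exists>x\<in>S. \<exists>\<delta>>0. \<forall>s\<in>S. \<bar>s - x\<bar> < \<delta> \<longrightarrow> \<bar>v s - v x\<bar> \<le> (\<beta>2 - \<beta>1)/2"
  proof (rule derivative_small_oscillation[OF y_deriv clS _ neS])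
    show "S \<subseteq> {x1..x2}" by (auto simp: S_def)
  qed (use x lr \<beta> in auto)
  then obtain z \<delta> where z: "z \<in> S" "\<delta> > 0" and
    osc: "\<And>s. s \<in> S \<Longrightarrow> \<bar>s - z\<bar> < \<delta> \<Longrightarrow> \<bar>v s - v z\<bar> \<le> (\<beta>2 - \<beta>1)/2" by auto
  obtain u1 u2 where u: "x1 \<le> u1" "u1 < u2" "u2 \<le> x2" "\<bar>u1 - z\<bar> < \<delta>" "\<bar>u2 - z\<bar> < \<delta>"
    "\<beta>2 \<le> v u1" "v u2 \<le> \<beta>1" using z by (auto simp: S_def)
  define T where "T = S \<inter> {u1..u2}"
  have T: "compact T" "T \<noteq> {}"
    using jump[OF u(1-3,6,7)] clS by (auto simp: T_def intro!: closed_Int_compact)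
  have oscT: "\<bar>v s - v z\<bar> \<le> (\<beta>2 - \<beta>1)/2" if "s \<in> T" for s
    using that u by (intro osc) (auto simp: T_def)
  show False
  proof (cases "v z < \<beta>1")
    case True
    \<comment> \<open>The first jump after \<open>u1\<close>. Since
      \<open>v \<sigma> < \<beta>1\<close>, there are points just before \<sigma> with
      \<open>v < \<beta>1\<close>, and a crossing from \<open>u1\<close> down to such a point
      contains an earlier jump.\<close>
    obtain \<sigma> where \<sigma>: "\<sigma> \<in> T" "\<And>s. s \<in> T \<Longrightarrow> \<sigma> \<le> s" using compact_attains_inf[OF T] by auto
    have "v \<sigma> < \<beta>1" using oscT[OF \<sigma>(1)] off[of \<sigma>] \<sigma>(1) True \<beta> by (auto simp: T_def abs_if split: if_splits)
    then have "u1 \<noteq> \<sigma>" using u \<beta> by auto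
    then have \<sigma>': "u1 < \<sigma>" "\<sigma> \<le> u2" "a < \<sigma>" "\<sigma> < b" using \<sigma> u x lr by (auto simp: T_def)
    obtain X where X: "X \<longlonglongrightarrow> \<sigma>" "\<And>n. X n < \<sigma>" "(\<lambda>n. v (X n)) \<longlonglongrightarrow> v \<sigma>"
      using left_seq[OF \<sigma>'(3,4)] by metis
    have "\<forall>\<^sub>F n in sequentially. u1 < X n \<and> v (X n) < \<beta>1"
      using order_tendstoD(1)[OF X(1) \<sigma>'(1)] order_tendstoD(2)[OF X(3) \<open>v \<sigma> < \<beta>1\<close>] by eventually_elim auto
    then obtain n where "u1 < X n" "v (X n) < \<beta>1" by (auto simp: eventually_sequentially)
    then obtain s where "s \<in> S" "u1 \<le> s" "s \<le> X n" using jump[of u1 "X n"] u \<sigma>' X(2)[of n] by auto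
    then show False using \<sigma>(2)[of s] X(2)[of n] \<sigma>' by (auto simp: T_def)
  next
    case False
    then have "\<beta>2 < v z" using off z by auto
    obtain \<sigma> where \<sigma>: "\<sigma> \<in> T" "\<And>s. s \<in> T \<Longrightarrow> s \<le> \<sigma>" using compact_attains_sup[OF T] by auto
    have "\<beta>2 < v \<sigma>" using oscT[OF \<sigma>(1)] off[of \<sigma>] \<sigma>(1) \<open>\<beta>2 < v z\<close> \<beta> by (auto simp: T_def abs_if split: if_splits)
    then have "u2 \<noteq> \<sigma>" using u \<beta> by auto
    then have \<sigma>': "u1 \<le> \<sigma>" "\<sigma> < u2" "a < \<sigma>" "\<sigma> < b" using \<sigma> u x lr by (auto simp: T_def)
    obtain X where X: "X \<longlonglongrightarrow> \<sigma>" "\<And>n. \<sigma> < X n" "(\<lambda>n. v (X n)) \<longlonglongrightarrow> v \<sigma>"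
      using right_seq[OF \<sigma>'(3,4)] by metis
    have "\<forall>\<^sub>F n in sequentially. X n < u2 \<and> \<beta>2 < v (X n)"
      using order_tendstoD(2)[OF X(1) \<sigma>'(2)] order_tendstoD(1)[OF X(3) \<open>\<beta>2 < v \<sigma>\<close>] by eventually_elim auto
    then obtain n where "X n < u2" "\<beta>2 < v (X n)" by (auto simp: eventually_sequentially)
    then obtain s where "s \<in> S" "X n \<le> s" "s \<le> u2" using jump[of "X n" u2] u \<sigma>' X(2)[of n] by auto
    then show False using \<sigma>(2)[of s] X(2)[of n] \<sigma>' by (auto simp: T_def)
  qed
qed

text \<open>\<Gamma> compares the two velocities in
  \<open>M (x, y x, \<cdot>) - p x * \<cdot>\<close>. It is at most 0 at \<open>s\<close>, where
  \<open>w\<close> is a minimiser, and at least 0 at \<open>t\<close>, where \<open>w'\<close> is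
  one, so its derivative is nonnegative somewhere between. For \<open>s = t\<close> the slope
  relation gives equality.\<close>

lemma Ct_gap:
  assumes "Ct s w" "Ct t w'" "a < s" "s \<le> t" "t < b"
  obtains \<xi> where "s \<le> \<xi>" "\<xi> \<le> t" "s < t \<Longrightarrow> s < \<xi> \<and> \<xi> < t"
    "p' \<xi> * (w - w') \<le> Mx (\<xi>, y \<xi>, w) - Mx (\<xi>, y \<xi>, w')
       + v \<xi> * (My (\<xi>, y \<xi>, w) - My (\<xi>, y \<xi>, w'))"
proof (cases "s = t")
  case True
  then show ?thesis using that[of s] tau_diff[of s w w'] assms by auto
next
  case False
  define \<Gamma> where "\<Gamma> x = M (x, y x, w) - M (x, y x, w') - p x * (w - w')" for x
  have "s < t" using False assms by simp
  then have "\<exists>\<xi>>s. \<xi> < t \<and> \<Gamma> t - \<Gamma> s = (t - s) * ((Mx (\<xi>, y \<xi>, w) + My (\<xi>, y \<xi>, w) * v \<xi>)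
      - (Mx (\<xi>, y \<xi>, w') + My (\<xi>, y \<xi>, w') * v \<xi>) - p' \<xi> * (w - w'))"
    unfolding \<Gamma>_def using assms
    by (intro MVT2) (auto intro!: derivative_eq_intros phi_deriv p_deriv)
  then obtain \<xi> where \<xi>: "s < \<xi>" "\<xi> < t" "\<Gamma> t - \<Gamma> s = (t - s) * ((Mx (\<xi>, y \<xi>, w) + My (\<xi>, y \<xi>, w) * v \<xi>)
      - (Mx (\<xi>, y \<xi>, w') + My (\<xi>, y \<xi>, w') * v \<xi>) - p' \<xi> * (w - w'))" by blast
  have "\<Gamma> s \<le> 0" using assms(1) unfolding Ct_def \<Gamma>_def by (auto simp: algebra_simps dest!: spec[of _ w'])
  moreover have "0 \<le> \<Gamma> t" using assms(2) unfolding Ct_def \<Gamma>_def by (auto simp: algebra_simps dest!: spec[of _ w])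
  ultimately have "0 \<le> (t - s) * ((Mx (\<xi>, y \<xi>, w) + My (\<xi>, y \<xi>, w) * v \<xi>)
      - (Mx (\<xi>, y \<xi>, w') + My (\<xi>, y \<xi>, w') * v \<xi>) - p' \<xi> * (w - w'))" using \<xi>(3) by linarith
  then have "0 \<le> (Mx (\<xi>, y \<xi>, w) + My (\<xi>, y \<xi>, w) * v \<xi>)
      - (Mx (\<xi>, y \<xi>, w') + My (\<xi>, y \<xi>, w') * v \<xi>) - p' \<xi> * (w - w')"
    using \<open>s < t\<close> by (simp add: zero_le_mult_iff)
  then show ?thesis using \<xi>(1,2) that[of \<xi>] by (simp add: algebra_simps)
qed

text \<open>The last inequality is the common content of the slope relation at a single point (\<open>s = t\<close>) and of the
  mean value theorem between two points with different contact values.\<close>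

definition gap :: "real \<Rightarrow> real \<Rightarrow> real \<Rightarrow> real \<Rightarrow> real \<Rightarrow> real \<Rightarrow> real \<Rightarrow> bool" where
  "gap c s t \<xi> w w' D \<longleftrightarrow> s \<le> \<xi> \<and> \<xi> \<le> t \<and> a < s \<and> t < b \<and> Ct s w \<and> Ct t w' \<and> c/2 \<le> w - w' \<and> d \<xi> \<le> D \<and>
    p' \<xi> * (w - w') \<le> Mx (\<xi>, y \<xi>, w) - Mx (\<xi>, y \<xi>, w')
       + v \<xi> * (My (\<xi>, y \<xi>, w) - My (\<xi>, y \<xi>, w'))"

text \<open>A small defect at \<xi> means a large \<open>p' \<xi>\<close>. If gaps accumulated at
  \<open>e\<close>, compactness would give limit velocities \<open>w0\<close>, \<open>w0'\<close>
  that are contact values at \<open>e\<close>; then \<open>tau_diff\<close> fixes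
  \<open>p' e\<close>, and the limit of the gap inequality puts the defect at \<open>e\<close> below
  \<open>D\<close>.\<close>

lemma no_gap_near:
  assumes e: "a < e" "e < b" and D: "D > 0" "D \<le> d e" and "c > 0"
    and c: "\<And>w. \<bar>w - v e\<bar> \<le> c \<Longrightarrow> \<bar>My (e, y e, w) - My (e, y e, v e)\<bar> \<le> D/100"
  obtains \<delta> where "\<delta> > 0" "\<And>s t \<xi> w w'. \<bar>s - e\<bar> < \<delta> \<Longrightarrow> \<bar>t - e\<bar> < \<delta> \<Longrightarrow>
    \<bar>w - v e\<bar> \<le> c \<Longrightarrow> \<bar>w' - v e\<bar> \<le> c \<Longrightarrow> \<bar>v \<xi> - v e\<bar> \<le> c \<Longrightarrow> \<not> gap c s t \<xi> w w' (D/2)"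
proof (rule ccontr)
  define Q where "Q n s t \<xi> w w' \<longleftrightarrow> \<bar>s - e\<bar> < inverse (real (Suc n)) \<and> \<bar>t - e\<bar> < inverse (real (Suc n)) \<and>
    \<bar>w - v e\<bar> \<le> c \<and> \<bar>w' - v e\<bar> \<le> c \<and> \<bar>v \<xi> - v e\<bar> \<le> c \<and> gap c s t \<xi> w w' (D/2)" for n s t \<xi> w w'
  assume neg: "\<not> thesis"
  have "\<exists>s t \<xi> w w'. Q n s t \<xi> w w'" for n
  proof (rule ccontr)
    assume "\<not> ?thesis"
    then show False using neg that[of "inverse (real (Suc n))"] unfolding Q_def by auto
  qed
  then obtain s t \<xi> w w' where Q: "\<And>n. Q n (s n) (t n) (\<xi> n) (w n) (w' n)" by metis
  have small: "\<And>n. \<bar>s n - e\<bar> < inverse (real (Suc n))" "\<And>n. \<bar>t n - e\<bar> < inverse (real (Suc n))"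
    and wc: "\<And>n. \<bar>w n - v e\<bar> \<le> c" "\<And>n. \<bar>w' n - v e\<bar> \<le> c" "\<And>n. c/2 \<le> w n - w' n"
    and vc: "\<And>n. \<bar>v (\<xi> n) - v e\<bar> \<le> c" and g: "\<And>n. gap c (s n) (t n) (\<xi> n) (w n) (w' n) (D/2)"
    using Q unfolding Q_def gap_def by blast+
  have st: "\<And>n. s n \<le> \<xi> n" "\<And>n. \<xi> n \<le> t n" and ct: "\<And>n. Ct (s n) (w n)" "\<And>n. Ct (t n) (w' n)"
    and dD: "\<And>n. d (\<xi> n) \<le> D/2"
    and ineq: "\<And>n. p' (\<xi> n) * (w n - w' n) \<le> Mx (\<xi> n, y (\<xi> n), w n) - Mx (\<xi> n, y (\<xi> n), w' n)
       + v (\<xi> n) * (My (\<xi> n, y (\<xi> n), w n) - My (\<xi> n, y (\<xi> n), w' n))"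
    using g unfolding gap_def by blast+
  have lims: "s \<longlonglongrightarrow> e" "t \<longlonglongrightarrow> e"
    by (rule LIM_zero_cancel, rule Lim_null_comparison[OF _ LIMSEQ_inverse_real_of_nat],
      use small in \<open>simp add: less_imp_le\<close>)+
  have lim\<xi>: "\<xi> \<longlonglongrightarrow> e" by (rule tendsto_sandwich[OF _ _ lims]) (use st in auto)
  let ?K = "{v e - c..v e + c}"
  have "compact (?K \<times> ?K \<times> ?K)" by (intro compact_Times) auto
  moreover have "(w n, w' n, v (\<xi> n)) \<in> ?K \<times> ?K \<times> ?K" for n
    using wc(1,2)[of n] vc[of n] by (auto simp: abs_le_iff)
  ultimately obtain k r where k: "k \<in> ?K \<times> ?K \<times> ?K" "strict_mono (r :: nat \<Rightarrow> nat)"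
    "((\<lambda>n. (w n, w' n, v (\<xi> n))) \<circ> r) \<longlonglongrightarrow> k"
    by (auto dest!: compact_imp_seq_compact elim!: seq_compactE)
  obtain w0 w0' u where k_eq: "k = (w0, w0', u)" by (cases k)
  have lw: "(\<lambda>n. w (r n)) \<longlonglongrightarrow> w0" "(\<lambda>n. w' (r n)) \<longlonglongrightarrow> w0'" "(\<lambda>n. v (\<xi> (r n))) \<longlonglongrightarrow> u"
    using tendsto_fst[OF k(3)] tendsto_fst[OF tendsto_snd[OF k(3)]] tendsto_snd[OF tendsto_snd[OF k(3)]]
    by (simp_all add: o_def k_eq)
  have sub: "(\<lambda>n. s (r n)) \<longlonglongrightarrow> e" "(\<lambda>n. t (r n)) \<longlonglongrightarrow> e" "(\<lambda>n. \<xi> (r n)) \<longlonglongrightarrow> e"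
    using LIMSEQ_subseq_LIMSEQ[OF lims(1) k(2)] LIMSEQ_subseq_LIMSEQ[OF lims(2) k(2)]
      LIMSEQ_subseq_LIMSEQ[OF lim\<xi> k(2)] by (simp_all add: o_def)
  have "Ct e w0" "Ct e w0'" using Ct_closed[OF e sub(1) lw(1)] Ct_closed[OF e sub(2) lw(2)] ct by auto
  then have t1: "p' e * (w0 - w0') = Mx (e, y e, w0) - Mx (e, y e, w0')
     + v e * (My (e, y e, w0) - My (e, y e, w0'))" by (rule tau_diff[OF e])
  define h where "h w = My (e, y e, w)" for w
  have t2: "(h u - D/2) * (w0 - w0') \<le> Mx (e, y e, w0) - Mx (e, y e, w0') + u * (h w0 - h w0')"
  proof (rule LIMSEQ_le)
    show "(\<lambda>n. (My (\<xi> (r n), y (\<xi> (r n)), v (\<xi> (r n))) - D/2) * (w (r n) - w' (r n)))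
      \<longlonglongrightarrow> (h u - D/2) * (w0 - w0')" unfolding h_def
      by (intro tendsto_intros seq_lims y_seq e sub lw)
    show "(\<lambda>n. Mx (\<xi> (r n), y (\<xi> (r n)), w (r n)) - Mx (\<xi> (r n), y (\<xi> (r n)), w' (r n))
       + v (\<xi> (r n)) * (My (\<xi> (r n), y (\<xi> (r n)), w (r n)) - My (\<xi> (r n), y (\<xi> (r n)), w' (r n))))
      \<longlonglongrightarrow> Mx (e, y e, w0) - Mx (e, y e, w0') + u * (h w0 - h w0')" unfolding h_def
      by (intro tendsto_intros seq_lims y_seq e sub lw)
    have "(My (\<xi> n, y (\<xi> n), v (\<xi> n)) - D/2) * (w n - w' n) \<le> p' (\<xi> n) * (w n - w' n)" for n
      using dD[of n] wc(3)[of n] \<open>c > 0\<close> by (intro mult_right_mono) (auto simp: d_def)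
    then show "\<exists>N. \<forall>n\<ge>N. (My (\<xi> (r n), y (\<xi> (r n)), v (\<xi> (r n))) - D/2) * (w (r n) - w' (r n))
      \<le> Mx (\<xi> (r n), y (\<xi> (r n)), w (r n)) - Mx (\<xi> (r n), y (\<xi> (r n)), w' (r n))
       + v (\<xi> (r n)) * (My (\<xi> (r n), y (\<xi> (r n)), w (r n)) - My (\<xi> (r n), y (\<xi> (r n)), w' (r n)))"
      using order.trans[OF _ ineq] by auto
  qed
  have gap: "c/2 \<le> w0 - w0'"
    by (rule LIMSEQ_le_const[OF tendsto_diff[OF lw(1,2)]]) (use wc(3) in auto)
  have kk: "\<bar>w0 - v e\<bar> \<le> c" "\<bar>w0' - v e\<bar> \<le> c" "\<bar>u - v e\<bar> \<le> c" using k(1) k_eq by auto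
  have hh: "\<bar>h w0 - h (v e)\<bar> \<le> D/100" "\<bar>h w0' - h (v e)\<bar> \<le> D/100" "\<bar>h u - h (v e)\<bar> \<le> D/100"
    using c kk by (auto simp: h_def)
  have hh2: "\<bar>h w0 - h w0'\<bar> \<le> D/50" using hh(1,2) by linarith
  \<comment> \<open>The gap has width at least \<open>c/2\<close>, comparable to the radius
    \<open>c\<close> of the velocities. So the error \<bar>u - v e\<bar> times the oscillation
    \<open>D/50\<close> of \<open>My\<close> is at most \<open>D/25\<close> times the width, while
    the factor on the left exceeds \<open>D/25\<close>.\<close>
  have "(h u - D/2 - p' e) * (w0 - w0') \<le> (u - v e) * (h w0 - h w0')"
    using t1 t2 by (simp add: h_def algebra_simps)
  also have "\<dots> \<le> \<bar>u - v e\<bar> * \<bar>h w0 - h w0'\<bar>" by (simp add: abs_mult[symmetric])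
  also have "\<dots> \<le> c * (D/50)" using kk hh2 \<open>c > 0\<close> by (intro mult_mono) auto
  also have "\<dots> = (c/2) * (D/25)" by simp
  also have "\<dots> \<le> (w0 - w0') * (D/25)" using gap D by (intro mult_right_mono) auto
  finally have "(w0 - w0') * (h u - D/2 - p' e) \<le> (w0 - w0') * (D/25)" by (simp only: mult.commute)
  moreover have "D \<le> h (v e) - p' e" using D(2) by (simp add: d_def h_def)
  then have "D/25 < h u - D/2 - p' e" using hh(3) D(1) by linarith
  ultimately show False using gap \<open>c > 0\<close> by (simp add: mult_le_cancel_left)
qed

end

context contact
begin

text \<open>Two bands of width \<open>c/2\<close>, one above and one below \<open>v e\<close>,
  cannot be crossed downwards near \<open>e\<close>. Since \<open>v\<close> has values close to
  \<open>v e\<close> on both sides of \<open>e\<close> and arbitrarily near it, an excursion past a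
  band on either side would have to cross it downwards.\<close>

lemma velocity_bounded:
  assumes e: "a < e" "e < b" and D: "D > 0" "D \<le> d e" and "c > 0" "\<eta> > 0"
    and c: "\<And>w. \<bar>w - v e\<bar> \<le> c \<Longrightarrow> \<bar>My (e, y e, w) - My (e, y e, v e)\<bar> \<le> D/100"
    and F: "\<And>s. \<bar>s - e\<bar> < \<eta> \<Longrightarrow> s \<in> F \<Longrightarrow> \<bar>v s - v e\<bar> < c/8"
    and off: "\<And>s. \<bar>s - e\<bar> < \<eta> \<Longrightarrow> a < s \<Longrightarrow> s < b \<Longrightarrow> s \<notin> F \<Longrightarrow> \<bar>v s - v e\<bar> \<le> c \<Longrightarrow> d s \<le> D/2"
  shows "\<exists>\<delta>>0. \<exists>B. \<forall>x. \<bar>x - e\<bar> < \<delta> \<longrightarrow> a < x \<and> x < b \<and> \<bar>v x\<bar> \<le> B"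
proof -
  obtain \<delta>0 where \<delta>0: "\<delta>0 > 0" "\<And>s t \<xi> w w'. \<bar>s - e\<bar> < \<delta>0 \<Longrightarrow> \<bar>t - e\<bar> < \<delta>0 \<Longrightarrow>
    \<bar>w - v e\<bar> \<le> c \<Longrightarrow> \<bar>w' - v e\<bar> \<le> c \<Longrightarrow> \<bar>v \<xi> - v e\<bar> \<le> c \<Longrightarrow> \<not> gap c s t \<xi> w w' (D/2)"
    using no_gap_near[OF e D \<open>c > 0\<close> c] by metis
  define \<delta> where "\<delta> = Min {\<delta>0, \<eta>, e - a, b - e}"
  have \<delta>: "\<delta> > 0" "\<delta> \<le> \<delta>0" "\<delta> \<le> \<eta>" "a \<le> e - \<delta>" "e + \<delta> \<le> b"
    using \<delta>0 \<open>\<eta> > 0\<close> e by (auto simp: \<delta>_def)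
  \<comment> \<open>The band stays clear of the velocities within \<open>c/8\<close> of
    \<open>v e\<close>. So a point with velocity in the band lies off \<open>F\<close>, hence has
    defect at most \<open>D/2\<close>, and Darboux crossings of the band produce a forbidden
    gap.\<close>
  have nc: False
    if \<beta>: "v e - c \<le> \<beta>1" "\<beta>1 + c/2 \<le> \<beta>2" "\<beta>2 \<le> v e + c" "v e + c/8 < \<beta>1 \<or> \<beta>2 < v e - c/8"
      and x: "e - \<delta> < x1" "x1 < x2" "x2 < e + \<delta>" "\<beta>2 \<le> v x1" "v x2 \<le> \<beta>1" for \<beta>1 \<beta>2 x1 x2
  proof -
    have step: False if st: "e - \<delta> < s" "s \<le> t" "t < e + \<delta>" "Ct s \<beta>2" "Ct t \<beta>1"
      and band: "\<And>x. s \<le> x \<Longrightarrow> x \<le> t \<Longrightarrow> (s < t \<Longrightarrow> s < x \<and> x < t) \<Longrightarrow> \<beta>1 \<le> v x \<and> v x \<le> \<beta>2" for s t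
    proof -
      have dom: "a < s" "t < b" using st \<delta> by auto
      obtain \<xi> where \<xi>: "s \<le> \<xi>" "\<xi> \<le> t" "s < t \<Longrightarrow> s < \<xi> \<and> \<xi> < t"
        "p' \<xi> * (\<beta>2 - \<beta>1) \<le> Mx (\<xi>, y \<xi>, \<beta>2) - Mx (\<xi>, y \<xi>, \<beta>1)
         + v \<xi> * (My (\<xi>, y \<xi>, \<beta>2) - My (\<xi>, y \<xi>, \<beta>1))"
        using Ct_gap[OF st(4,5) dom(1) st(2) dom(2)] by metis
      have v\<xi>: "\<beta>1 \<le> v \<xi>" "v \<xi> \<le> \<beta>2" using band \<xi> by auto
      then have vc: "\<bar>v \<xi> - v e\<bar> \<le> c" using \<beta> by (auto simp: abs_le_iff)
      have "\<xi> \<notin> F"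
      proof
        assume "\<xi> \<in> F"
        then have "\<bar>v \<xi> - v e\<bar> < c/8" using F[of \<xi>] \<xi>(1,2) st \<delta> by auto
        then show False using v\<xi> \<beta>(4) by (smt (verit))
      qed
      then have "d \<xi> \<le> D/2" using off[of \<xi>] vc \<xi>(1,2) st \<delta> by auto
      then have "gap c s t \<xi> \<beta>2 \<beta>1 (D/2)" unfolding gap_def using \<xi> dom st \<beta> by auto
      moreover have "\<not> gap c s t \<xi> \<beta>2 \<beta>1 (D/2)"
      proof (rule \<delta>0(2))
        show "\<bar>s - e\<bar> < \<delta>0" "\<bar>t - e\<bar> < \<delta>0" using st \<delta> by auto
        show "\<bar>\<beta>2 - v e\<bar> \<le> c" "\<bar>\<beta>1 - v e\<bar> \<le> c" using \<beta> \<open>c > 0\<close> by (auto simp: abs_le_iff)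
      qed (rule vc)
      ultimately show False by blast
    qed
    show False
    proof (rule no_downward_crossing[of "e - \<delta>" "e + \<delta>" \<beta>1 \<beta>2 x1 x2])
      show "\<beta>1 < \<beta>2" using \<beta>(2) \<open>c > 0\<close> by linarith
      fix s assume "e - \<delta> < s" "s < e + \<delta>" "Ct s \<beta>2" "Ct s \<beta>1" "\<beta>1 \<le> v s" "v s \<le> \<beta>2"
      then show False using step[of s s] by force
    next
      fix s t assume "e - \<delta> < s" "s < t" "t < e + \<delta>" "Ct s \<beta>2" "Ct t \<beta>1"
        and "\<And>x. s < x \<Longrightarrow> x < t \<Longrightarrow> \<beta>1 < v x \<and> v x < \<beta>2"
      then show False using step[of s t] by (meson less_imp_le)
    qed (use x \<delta> in auto)
  qed
  obtain X where X: "X \<longlonglongrightarrow> e" "\<And>n. e < X n" "(\<lambda>n. v (X n)) \<longlonglongrightarrow> v e"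
    using right_seq[OF e] by metis
  obtain Y where Y: "Y \<longlonglongrightarrow> e" "\<And>n. Y n < e" "(\<lambda>n. v (Y n)) \<longlonglongrightarrow> v e"
    using left_seq[OF e] by metis
  have right: "\<exists>z. e < z \<and> z < z' \<and> v e - c/4 \<le> v z \<and> v z \<le> v e + c/4" if "e < z'" for z'
  proof -
    have "\<forall>\<^sub>F n in sequentially. X n < z' \<and> v e - c/4 < v (X n) \<and> v (X n) < v e + c/4"
      using order_tendstoD(2)[OF X(1) that] order_tendstoD(1)[OF X(3), of "v e - c/4"]
        order_tendstoD(2)[OF X(3), of "v e + c/4"] \<open>c > 0\<close> by (simp add: eventually_conj)
    then show ?thesis using X(2) by (fastforce simp: eventually_sequentially)
  qed
  have left: "\<exists>z. z < e \<and> z' < z \<and> v e - c/4 \<le> v z \<and> v z \<le> v e + c/4" if "z' < e" for z'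
  proof -
    have "\<forall>\<^sub>F n in sequentially. z' < Y n \<and> v e - c/4 < v (Y n) \<and> v (Y n) < v e + c/4"
      using order_tendstoD(1)[OF Y(1) that] order_tendstoD(1)[OF Y(3), of "v e - c/4"]
        order_tendstoD(2)[OF Y(3), of "v e + c/4"] \<open>c > 0\<close> by (simp add: eventually_conj)
    then show ?thesis using Y(2) by (fastforce simp: eventually_sequentially)
  qed
  have up: False if "e - \<delta> < x1" "x1 < x2" "x2 < e + \<delta>" "v e + 3*c/4 \<le> v x1" "v x2 \<le> v e + c/4" for x1 x2
    using nc[of "v e + c/4" "v e + 3*c/4" x1 x2] that \<open>c > 0\<close> by auto
  have down: False if "e - \<delta> < x1" "x1 < x2" "x2 < e + \<delta>" "v e - c/4 \<le> v x1" "v x2 \<le> v e - 3*c/4" for x1 x2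
    using nc[of "v e - 3*c/4" "v e - c/4" x1 x2] that \<open>c > 0\<close> by auto
  obtain zr where zr: "e < zr" "zr < e + \<delta>" "v zr \<le> v e + c/4" using right[of "e + \<delta>"] \<delta> by auto
  obtain zl where zl: "zl < e" "e - \<delta> < zl" "v e - c/4 \<le> v zl" using left[of "e - \<delta>"] \<delta> by auto
  \<comment> \<open>A high value left of \<open>e\<close> is followed by a moderate one before
    \<open>e\<close>, and a high value right of \<open>e\<close> by the one at \<open>zr\<close>.
    Symmetrically, a low value is preceded by a moderate one, at \<open>zl\<close> or just after
    \<open>e\<close>.\<close>
  have "\<bar>v x - v e\<bar> \<le> c" if "zl < x" "x < zr" for x
  proof -
    have "v x < v e + 3*c/4"
    proof (rule ccontr)
      assume neg: "\<not> ?thesis"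
      show False
      proof (cases "x < e")
        case True
        then obtain z where "z < e" "x < z" "v z \<le> v e + c/4" using left by blast
        then show False using up[of x z] neg that zl zr by auto
      next
        case False
        then show False using up[of x zr] neg that zl zr \<open>c > 0\<close> by auto
      qed
    qed
    moreover have "v e - 3*c/4 < v x"
    proof (rule ccontr)
      assume neg: "\<not> ?thesis"
      show False
      proof (cases "e < x")
        case True
        then obtain z where "e < z" "z < x" "v e - c/4 \<le> v z" using right by blast
        then show False using down[of z x] neg that zl zr by auto
      next
        case False
        then show False using down[of zl x] neg that zl zr \<open>c > 0\<close> by auto
      qed
    qed
    ultimately show ?thesis using \<open>c > 0\<close> by (auto simp: abs_le_iff)
  qed
  then have "\<bar>v x\<bar> \<le> \<bar>v e\<bar> + c" if "zl < x" "x < zr" for x using that by force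
  then show ?thesis using zl zr \<delta>
    by (intro exI[of _ "min (e - zl) (zr - e)"] conjI exI[of _ "\<bar>v e\<bar> + c"] allI impI) auto
qed

section \<open>Contact along half-lines, and limits of the defect where the velocity is unbounded
  below\<close>

definition unb_below :: "real \<Rightarrow> bool" where
  "unb_below s \<longleftrightarrow> (\<forall>\<epsilon>>0. \<forall>B. \<exists>x. a < x \<and> x < b \<and> \<bar>x - s\<bar> < \<epsilon> \<and> v x < B)"

text \<open>\<open>w\<close> lies between \<open>v s\<close> and arbitrarily low values of
  \<open>v\<close> near \<open>s\<close>, so \<open>Ct_between\<close> applies.\<close>

lemma Ct_unb_below:
  assumes s: "a < s" "s < b" "unb_below s" and "w \<le> v s"
  shows "Ct s w"
proof (rule Ct_between[OF s(1,2)])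
  fix \<epsilon> :: real assume "\<epsilon> > 0"
  then obtain x where "a < x" "x < b" "\<bar>x - s\<bar> < \<epsilon>" "v x < w" using s(3) unfolding unb_below_def by blast
  then show "\<exists>x1 x2. a < x1 \<and> x1 < b \<and> \<bar>x1 - s\<bar> < \<epsilon> \<and> v x1 \<le> w
      \<and> a < x2 \<and> x2 < b \<and> \<bar>x2 - s\<bar> < \<epsilon> \<and> w \<le> v x2"
    using assms \<open>\<epsilon> > 0\<close> by (intro exI[of _ x] exI[of _ s]) auto
qed

text \<open>The slope relation at points \<open>S n \<rightarrow> e\<close> near which \<open>v\<close> is unbounded below makes \<open>My\<close> affine in the
  velocity, unless the limit velocity is \<open>v e\<close>.\<close>

lemma unb_below_limit:
  assumes e: "a < e" "e < b" and S: "S \<longlonglongrightarrow> e" "\<And>n. a < S n" "\<And>n. S n < b" "\<And>n. unb_below (S n)"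
    and u: "(\<lambda>n. v (S n)) \<longlonglongrightarrow> u"
  obtains q where "(\<lambda>n. p' (S n)) \<longlonglongrightarrow> q"
    "\<And>w w'. w \<le> u \<Longrightarrow> w' \<le> u \<Longrightarrow>
      (q - p' e) * (w - w') = (u - v e) * (My (e, y e, w) - My (e, y e, w'))"
proof -
  have lim: "(\<lambda>n. p' (S n) * (w - w')) \<longlonglongrightarrow> Mx (e, y e, w) - Mx (e, y e, w')
      + u * (My (e, y e, w) - My (e, y e, w'))" if w: "w \<le> u" "w' \<le> u" for w w'
  proof -
    \<comment> \<open>Shifting by \<open>v (S n) - u\<close> keeps the velocities at or below
      \<open>v (S n)\<close>, hence in the half-line of contact values, although
      \<open>v (S n)\<close> merely converges to \<open>u\<close>.\<close>
    let ?W = "\<lambda>n. v (S n) + (w - u)" and ?W' = "\<lambda>n. v (S n) + (w' - u)"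
    have "p' (S n) * (w - w') = Mx (S n, y (S n), ?W n) - Mx (S n, y (S n), ?W' n)
      + v (S n) * (My (S n, y (S n), ?W n) - My (S n, y (S n), ?W' n))" for n
      using tau_diff[OF S(2,3)[of n] Ct_unb_below[OF S(2-4)] Ct_unb_below[OF S(2-4)], of "?W n" "?W' n"] w
      by simp
    moreover have W: "?W \<longlonglongrightarrow> w" "?W' \<longlonglongrightarrow> w'"
      using tendsto_add[OF u tendsto_const, of "w - u"] tendsto_add[OF u tendsto_const, of "w' - u"] by auto
    have "(\<lambda>n. Mx (S n, y (S n), ?W n) - Mx (S n, y (S n), ?W' n)
      + v (S n) * (My (S n, y (S n), ?W n) - My (S n, y (S n), ?W' n)))
      \<longlonglongrightarrow> Mx (e, y e, w) - Mx (e, y e, w') + u * (My (e, y e, w) - My (e, y e, w'))"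
      by (intro tendsto_intros seq_lims y_seq e S(1) W u)
    ultimately show ?thesis by simp
  qed
  have cte: "Ct e w" if "w \<le> u" for w
  proof (rule Ct_closed[OF e S(1)])
    show "(\<lambda>n. v (S n) + (w - u)) \<longlonglongrightarrow> w"
      using tendsto_add[OF u tendsto_const, of "w - u"] by simp
    show "Ct (S n) (v (S n) + (w - u))" for n using that by (intro Ct_unb_below S) auto
  qed
  \<comment> \<open>The limit just computed, for velocities at distance 1.\<close>
  define q where "q = Mx (e, y e, u) - Mx (e, y e, u - 1) + u * (My (e, y e, u) - My (e, y e, u - 1))"
  have q: "(\<lambda>n. p' (S n)) \<longlonglongrightarrow> q" using lim[of u "u - 1"] by (simp add: q_def)
  show ?thesis
  proof (rule that[OF q])
    fix w w' assume w: "w \<le> u" "w' \<le> u"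
    have "q * (w - w') = Mx (e, y e, w) - Mx (e, y e, w') + u * (My (e, y e, w) - My (e, y e, w'))"
      using LIMSEQ_unique[OF tendsto_mult_right[OF q] lim[OF w]] .
    moreover have "p' e * (w - w') = Mx (e, y e, w) - Mx (e, y e, w') + v e * (My (e, y e, w) - My (e, y e, w'))"
      by (rule tau_diff[OF e cte[OF w(1)] cte[OF w(2)]])
    ultimately show "(q - p' e) * (w - w') = (u - v e) * (My (e, y e, w) - My (e, y e, w'))"
      by (simp add: algebra_simps)
  qed
qed

definition lim_defect :: "real \<Rightarrow> real \<Rightarrow> bool" where
  "lim_defect e l \<longleftrightarrow> (\<exists>S u. S \<longlonglongrightarrow> e \<and> (\<forall>n. a < S n \<and> S n < b \<and> unb_below (S n)) \<and>
     (\<lambda>n. v (S n)) \<longlonglongrightarrow> u \<and> (\<lambda>n. d (S n)) \<longlonglongrightarrow> l)"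

text \<open>For \<open>u = v e\<close> the slope relation would give \<open>q = p' e\<close> and
  thus \<open>l = d e\<close>. Otherwise dividing it by \<open>u - v e\<close> makes
  \<open>My\<close> affine with slope \<kappa> up to \<open>u\<close>, and \<open>l + p' e\<close>
  is the value at \<open>v e\<close> of the extended affine function.\<close>

lemma lim_defectD:
  assumes e: "a < e" "e < b" and l: "lim_defect e l" "l \<noteq> d e"
  obtains u \<kappa> where "l = My (e, y e, u) - p' e - \<kappa> * (u - v e)"
    "\<And>w. w \<le> u \<Longrightarrow> My (e, y e, w) = My (e, y e, u) + \<kappa> * (w - u)"
proof -
  obtain S u where S: "S \<longlonglongrightarrow> e" "\<And>n. a < S n" "\<And>n. S n < b" "\<And>n. unb_below (S n)"
    and u: "(\<lambda>n. v (S n)) \<longlonglongrightarrow> u" and dl: "(\<lambda>n. d (S n)) \<longlonglongrightarrow> l"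
    using l(1) unfolding lim_defect_def by auto
  obtain q where q: "(\<lambda>n. p' (S n)) \<longlonglongrightarrow> q"
    and rel: "\<And>w w'. w \<le> u \<Longrightarrow> w' \<le> u \<Longrightarrow>
      (q - p' e) * (w - w') = (u - v e) * (My (e, y e, w) - My (e, y e, w'))"
    using unb_below_limit[OF e S u] by metis
  have "(\<lambda>n. d (S n)) \<longlonglongrightarrow> My (e, y e, u) - q"
    unfolding d_def by (intro tendsto_intros seq_lims y_seq e S(1) u q)
  then have lq: "l = My (e, y e, u) - q" using dl LIMSEQ_unique by blast
  have "u \<noteq> v e"
  proof
    assume "u = v e"
    then have "q = p' e" using rel[of u "u - 1"] by simp
    then show False using lq \<open>u = v e\<close> l(2) by (simp add: d_def)
  qed
  define \<kappa> where "\<kappa> = (q - p' e) / (u - v e)"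
  have k: "q - p' e = \<kappa> * (u - v e)" using \<open>u \<noteq> v e\<close> by (simp add: \<kappa>_def)
  show ?thesis
  proof (rule that[of u \<kappa>])
    show "l = My (e, y e, u) - p' e - \<kappa> * (u - v e)" using lq k by simp
    fix w assume "w \<le> u"
    then have "(u - v e) * (\<kappa> * (w - u)) = (u - v e) * (My (e, y e, w) - My (e, y e, u))"
      using rel[of w u] k by (simp add: mult_ac)
    then show "My (e, y e, w) = My (e, y e, u) + \<kappa> * (w - u)" using \<open>u \<noteq> v e\<close> by simp
  qed
qed

text \<open>Apart from \<open>d e\<close>, the only possible limit is the value at \<open>v e\<close> of the affine function
  with which \<open>My\<close> agrees for velocities near minus infinity.\<close>

lemma lim_defect_unique:
  assumes e: "a < e" "e < b" and l: "lim_defect e l1" "l1 \<noteq> d e" "lim_defect e l2" "l2 \<noteq> d e"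
  shows "l1 = l2"
proof -
  define h where "h w = My (e, y e, w)" for w
  obtain u1 k1 where 1: "l1 = h u1 - p' e - k1 * (u1 - v e)" "\<And>w. w \<le> u1 \<Longrightarrow> h w = h u1 + k1 * (w - u1)"
    using lim_defectD[OF e l(1,2)] unfolding h_def by metis
  obtain u2 k2 where 2: "l2 = h u2 - p' e - k2 * (u2 - v e)" "\<And>w. w \<le> u2 \<Longrightarrow> h w = h u2 + k2 * (w - u2)"
    using lim_defectD[OF e l(3,4)] unfolding h_def by metis
  \<comment> \<open>Below \<open>m\<close> both affine formulas represent \<open>h\<close>, so their
    slopes and values can be compared at \<open>m\<close> and \<open>m - 1\<close>.\<close>
  define m where "m = min u1 u2"
  have m: "m \<le> u1" "m \<le> u2" by (auto simp: m_def)
  have "h m = h u1 + k1 * (m - u1)" "h (m - 1) = h u1 + k1 * (m - 1 - u1)"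
    "h m = h u2 + k2 * (m - u2)" "h (m - 1) = h u2 + k2 * (m - 1 - u2)"
    using m by (auto intro: 1(2) 2(2))
  note eqs = this
  have "k1 = h m - h (m - 1)" unfolding eqs(1,2) by (simp add: algebra_simps)
  moreover have "k2 = h m - h (m - 1)" unfolding eqs(3,4) by (simp add: algebra_simps)
  ultimately have k: "k1 = k2" by simp
  have "l1 = h m - p' e - k1 * (m - v e)" unfolding 1(1) eqs(1) by (simp add: algebra_simps)
  moreover have "l2 = h m - p' e - k2 * (m - v e)" unfolding 2(1) eqs(3) by (simp add: algebra_simps)
  ultimately show ?thesis using k by simp
qed

lemma defect_near_unb_below:
  assumes e: "a < e" "e < b"
  shows "\<exists>\<alpha>. \<forall>\<epsilon>>0. \<exists>\<delta>>0. \<forall>s. a < s \<longrightarrow> s < b \<longrightarrow> \<bar>s - e\<bar> < \<delta> \<longrightarrow> unb_below s \<longrightarrow> \<bar>v s\<bar> \<le> R \<longrightarrow>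
    \<bar>d s - \<alpha>\<bar> < \<epsilon> \<or> \<bar>d s - d e\<bar> < \<epsilon>"
proof -
  \<comment> \<open>If there is no limit other than \<open>d e\<close>, the choice is an arbitrary
    number, and the statement still holds because \<open>d e\<close> is then the only limit. The
    bound \<open>R\<close> on the velocities supplies convergent subsequences.\<close>
  define \<alpha> where "\<alpha> = (SOME l. lim_defect e l \<and> l \<noteq> d e)"
  have uniq: "l = \<alpha>" if "lim_defect e l" "l \<noteq> d e" for l
  proof -
    have "\<exists>l. lim_defect e l \<and> l \<noteq> d e" using that by blast
    then have "lim_defect e \<alpha> \<and> \<alpha> \<noteq> d e" unfolding \<alpha>_def by (rule someI_ex)
    then show ?thesis using lim_defect_unique[OF e that] by blast
  qed
  have "\<exists>\<delta>>0. \<forall>s. a < s \<longrightarrow> s < b \<longrightarrow> \<bar>s - e\<bar> < \<delta> \<longrightarrow> unb_below s \<longrightarrow> \<bar>v s\<bar> \<le> R \<longrightarrow>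
    \<bar>d s - \<alpha>\<bar> < \<epsilon> \<or> \<bar>d s - d e\<bar> < \<epsilon>" if "\<epsilon> > 0" for \<epsilon>
  proof (rule ccontr)
    define Q where "Q n s \<longleftrightarrow> a < s \<and> s < b \<and> \<bar>s - e\<bar> < inverse (real (Suc n)) \<and> unb_below s \<and> \<bar>v s\<bar> \<le> R \<and>
      \<epsilon> \<le> \<bar>d s - \<alpha>\<bar> \<and> \<epsilon> \<le> \<bar>d s - d e\<bar>" for n s
    assume neg: "\<not> ?thesis"
    have "\<exists>s. Q n s" for n
    proof (rule ccontr)
      assume "\<not> ?thesis"
      then have "\<forall>s. a < s \<longrightarrow> s < b \<longrightarrow> \<bar>s - e\<bar> < inverse (real (Suc n)) \<longrightarrow> unb_below s \<longrightarrow> \<bar>v s\<bar> \<le> R \<longrightarrow>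
        \<bar>d s - \<alpha>\<bar> < \<epsilon> \<or> \<bar>d s - d e\<bar> < \<epsilon>" unfolding Q_def by force
      then show False using neg by (metis inverse_positive_iff_positive of_nat_0_less_iff zero_less_Suc)
    qed
    then obtain S where "\<And>n. Q n (S n)" by metis
    then have S: "\<And>n. a < S n" "\<And>n. S n < b" "\<And>n. \<bar>S n - e\<bar> < inverse (real (Suc n))" "\<And>n. unb_below (S n)"
      "\<And>n. \<bar>v (S n)\<bar> \<le> R" "\<And>n. \<epsilon> \<le> \<bar>d (S n) - \<alpha>\<bar>" "\<And>n. \<epsilon> \<le> \<bar>d (S n) - d e\<bar>"
      unfolding Q_def by auto
    have limS: "S \<longlonglongrightarrow> e"
      by (rule LIM_zero_cancel, rule Lim_null_comparison[OF _ LIMSEQ_inverse_real_of_nat],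
        use S(3) in \<open>simp add: less_imp_le\<close>)
    have "v (S n) \<in> {-R..R}" for n using S(5)[of n] by (auto simp: abs_le_iff)
    moreover have "compact {-R..R}" by simp
    ultimately obtain u r where r: "strict_mono (r :: nat \<Rightarrow> nat)" "((\<lambda>n. v (S n)) \<circ> r) \<longlonglongrightarrow> u"
      using compact_imp_seq_compact[of "{-R..R}"] by (auto elim!: seq_compactE)
    define T where "T = S \<circ> r"
    have T: "T \<longlonglongrightarrow> e" "\<And>n. a < T n" "\<And>n. T n < b" "\<And>n. unb_below (T n)" "(\<lambda>n. v (T n)) \<longlonglongrightarrow> u"
      using LIMSEQ_subseq_LIMSEQ[OF limS r(1)] S r(2) by (auto simp: T_def o_def)
    obtain q where q: "(\<lambda>n. p' (T n)) \<longlonglongrightarrow> q" using unb_below_limit[OF e T] by metis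
    have lim: "(\<lambda>n. d (T n)) \<longlonglongrightarrow> My (e, y e, u) - q" (is "_ \<longlonglongrightarrow> ?l")
      unfolding d_def by (intro tendsto_intros seq_lims y_seq e T(1,5) q)
    have "\<epsilon> \<le> \<bar>?l - d e\<bar>" "\<epsilon> \<le> \<bar>?l - \<alpha>\<bar>"
      by (rule LIMSEQ_le_const[OF tendsto_rabs[OF tendsto_diff[OF lim tendsto_const]]],
        use S(6,7) in \<open>auto simp: T_def\<close>)+
    moreover have "lim_defect e ?l" unfolding lim_defect_def using T lim by blast
    ultimately show False using uniq[of ?l] \<open>\<epsilon> > 0\<close> by force
  qed
  then show ?thesis by blast
qed

text \<open>Changing the signs of \<open>y\<close> and \<open>v\<close> changes the sign of the
  defect and exchanges unboundedness above and below. Hence one sign and one direction suffice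
  elsewhere.\<close>

lemma reflect:
  "contact a b (\<lambda>(x, z, w). M (x, - z, - w)) (\<lambda>(x, z, w). Mx (x, - z, - w))
     (\<lambda>(x, z, w). - My (x, - z, - w)) (\<lambda>(x, z, w). - Mw (x, - z, - w))
     (\<lambda>x. - y x) (\<lambda>x. - v x) (\<lambda>x. - p x) (\<lambda>x. - p' x)"
proof -
  let ?R = "\<lambda>q :: real \<times> real \<times> real. (fst q, - fst (snd q), - snd (snd q))"
  have contR: "continuous_on ({a<..<b} \<times> UNIV) (\<lambda>q. f (?R q))"
    if "continuous_on ({a<..<b} \<times> UNIV) f" for f :: "real \<times> real \<times> real \<Rightarrow> real"
    by (rule continuous_on_compose2[OF that]) (auto intro!: continuous_intros)
  interpret L: lagrange a b "\<lambda>(x, z, w). M (x, - z, - w)" "\<lambda>(x, z, w). Mx (x, - z, - w)"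
     "\<lambda>(x, z, w). - My (x, - z, - w)" "\<lambda>(x, z, w). - Mw (x, - z, - w)"
     "\<lambda>x. - y x" "\<lambda>x. - v x" "\<lambda>x. - p x" "\<lambda>x. - p' x"
  proof
    fix q :: "real \<times> real \<times> real" assume q: "q \<in> {a<..<b} \<times> UNIV"
    have "(?R has_derivative ?R) (at q)"
      by (auto intro!: derivative_eq_intros)
    from has_derivative_compose[OF this M_deriv[of "?R q"]] q
    show "((\<lambda>(x, z, w). M (x, - z, - w)) has_derivative
       (\<lambda>h. (case q of (x, z, w) \<Rightarrow> Mx (x, - z, - w)) * fst h +
            (case q of (x, z, w) \<Rightarrow> - My (x, - z, - w)) * fst (snd h) +
            (case q of (x, z, w) \<Rightarrow> - Mw (x, - z, - w)) * snd (snd h))) (at q)"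
      by (auto simp: case_prod_unfold)
  next
    show "continuous_on ({a<..<b} \<times> UNIV) (\<lambda>(x, z, w). Mx (x, - z, - w))"
      using contR[OF cont_Mx] by (simp add: case_prod_beta)
    show "continuous_on ({a<..<b} \<times> UNIV) (\<lambda>(x, z, w). - My (x, - z, - w))"
      using continuous_on_minus[OF contR[OF cont_My]] by (simp add: case_prod_beta)
    show "continuous_on ({a<..<b} \<times> UNIV) (\<lambda>(x, z, w). - Mw (x, - z, - w))"
      using continuous_on_minus[OF contR[OF cont_Mw]] by (simp add: case_prod_beta)
  next
    fix x assume "a < x" "x < b"
    then show "((\<lambda>x. - y x) has_real_derivative - v x) (at x)" "((\<lambda>x. - p x) has_real_derivative - p' x) (at x)"
      "- p x = (case (x, - y x, - v x) of (x, z, w) \<Rightarrow> - Mw (x, - z, - w))"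
      using p_eq by (auto intro!: DERIV_minus y_deriv p_deriv)
  qed
  show ?thesis
  proof
    fix x assume x: "a < x" "x < b"
    show "L.Ct x (- v x)" unfolding L.Ct_def
    proof
      fix w'
      show "(case (x, - y x, - v x) of (x, z, w) \<Rightarrow> M (x, - z, - w)) + - p x * (w' - - v x)
         \<le> (case (x, - y x, w') of (x, z, w) \<Rightarrow> M (x, - z, - w))"
        using contact[OF x] unfolding Ct_def by (auto simp: algebra_simps dest!: spec[of _ "- w'"])
    qed
  qed
qed

end

section \<open>Comparison with broken lines\<close>

context lagrange
begin

lemma cont_M: "continuous_on ({a<..<b} \<times> UNIV) M"
  using isCont_M by (intro continuous_at_imp_continuous_on) auto

lemma bounded_on_box:
  fixes G :: "real \<times> real \<times> real \<Rightarrow> real"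
  assumes G: "continuous_on ({a<..<b} \<times> UNIV) G" and k: "a < k1" "k2 < b"
  obtains B where "\<And>x z w. k1 \<le> x \<Longrightarrow> x \<le> k2 \<Longrightarrow> \<bar>z\<bar> \<le> Z \<Longrightarrow> \<bar>w\<bar> \<le> W \<Longrightarrow> \<bar>G (x, z, w)\<bar> \<le> B"
proof -
  have "compact (G ` ({k1..k2} \<times> {-Z..Z} \<times> {-W..W}))"
    using k by (intro compact_continuous_image continuous_on_subset[OF G] compact_Times) auto
  from compact_imp_bounded[OF this] obtain B
    where "\<And>q. q \<in> {k1..k2} \<times> {-Z..Z} \<times> {-W..W} \<Longrightarrow> norm (G q) \<le> B"
    unfolding bounded_iff by blast
  then show ?thesis by (intro that[of B]) (auto simp: abs_le_iff)
qed

lemma continuous_along: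
  fixes G :: "real \<times> real \<times> real \<Rightarrow> real" and f g :: "real \<Rightarrow> real"
  assumes "continuous_on ({a<..<b} \<times> UNIV) G" "S \<subseteq> {a<..<b}"
    and "continuous_on S f" "continuous_on S g"
  shows "continuous_on S (\<lambda>x. G (x, f x, g x))"
  by (rule continuous_on_compose2[OF assms(1)]) (use assms in \<open>auto intro!: continuous_intros\<close>)

lemma y_bounded:
  assumes "a < k1" "k2 < b"
  obtains Y where "\<And>x. k1 \<le> x \<Longrightarrow> x \<le> k2 \<Longrightarrow> \<bar>y x\<bar> \<le> Y"
proof -
  have "compact (y ` {k1..k2})"
    using assms by (intro compact_continuous_image continuous_at_imp_continuous_on ballI isCont_y) auto
  from compact_imp_bounded[OF this] obtain Y where "\<And>x. x \<in> {k1..k2} \<Longrightarrow> norm (y x) \<le> Y"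
    unfolding bounded_iff by blast
  then show ?thesis by (intro that[of Y]) auto
qed

text \<open>The continuous approximants of \<open>v\<close> are truncated at its bound
  \<open>B\<close>, which does not affect their limit and makes dominated convergence
  applicable.\<close>

lemma integrable_along:
  fixes G :: "real \<times> real \<times> real \<Rightarrow> real" and f g :: "real \<Rightarrow> real"
  assumes k: "a < k1" "k2 < b" and G: "continuous_on ({a<..<b} \<times> UNIV) G"
    and v: "\<And>x. k1 \<le> x \<Longrightarrow> x \<le> k2 \<Longrightarrow> \<bar>v x\<bar> \<le> B"
    and f: "continuous_on {k1..k2} f" and g: "continuous_on {k1..k2} g"
  shows "(\<lambda>x. G (x, f x, v x + g x)) integrable_on {k1..k2}"
proof -
  obtain u :: "nat \<Rightarrow> real \<Rightarrow> real" where u: "\<And>n. continuous_on {k1..k2} (u n)"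
    "\<And>x. x \<in> {k1..k2} \<Longrightarrow> (\<lambda>n. u n x) \<longlonglongrightarrow> v x"
    using derivative_limit_of_continuous[OF y_deriv k] by blast
  define c where "c n x = max (- B) (min B (u n x))" for n x
  have cc: "continuous_on {k1..k2} (c n)" for n unfolding c_def by (intro continuous_intros u)
  have cB: "\<bar>c n x\<bar> \<le> \<bar>B\<bar>" for n x by (auto simp: c_def)
  have cl: "(\<lambda>n. c n x) \<longlonglongrightarrow> v x" if x: "x \<in> {k1..k2}" for x
  proof -
    have "(\<lambda>n. c n x) \<longlonglongrightarrow> max (- B) (min B (v x))" unfolding c_def by (intro tendsto_intros u x)
    moreover have "max (- B) (min B (v x)) = v x" using v[of x] x by auto
    ultimately show ?thesis by simp
  qed
  have "bounded (f ` {k1..k2})" "bounded (g ` {k1..k2})"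
    using f g by (auto intro!: compact_imp_bounded compact_continuous_image)
  then obtain Z W where Z: "\<And>x. x \<in> {k1..k2} \<Longrightarrow> \<bar>f x\<bar> \<le> Z" and W: "\<And>x. x \<in> {k1..k2} \<Longrightarrow> \<bar>g x\<bar> \<le> W"
    unfolding bounded_iff real_norm_def by blast
  obtain C where C: "\<And>x z w. k1 \<le> x \<Longrightarrow> x \<le> k2 \<Longrightarrow> \<bar>z\<bar> \<le> Z \<Longrightarrow> \<bar>w\<bar> \<le> \<bar>B\<bar> + W \<Longrightarrow> \<bar>G (x, z, w)\<bar> \<le> C"
    using bounded_on_box[OF G k] by metis
  show ?thesis
  proof (rule dominated_convergence(1))
    show "(\<lambda>x. G (x, f x, c n x + g x)) integrable_on {k1..k2}" for n
      using k by (intro integrable_continuous_interval continuous_along[OF G] f continuous_intros cc g) auto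
    show "(\<lambda>x. C) integrable_on {k1..k2}" by (rule integrable_const_ivl)
    fix n x assume x: "x \<in> {k1..k2}"
    show "norm (G (x, f x, c n x + g x)) \<le> C"
      using x Z[OF x] W[OF x] cB[of n x] by (auto intro!: C)
  next
    fix x assume x: "x \<in> {k1..k2}"
    then have "isCont G (x, f x, v x + g x)"
      using G open_dom k by (auto simp: continuous_on_eq_continuous_at)
    then show "(\<lambda>n. G (x, f x, c n x + g x)) \<longlonglongrightarrow> G (x, f x, v x + g x)"
      by (rule isCont_tendsto_compose) (intro tendsto_intros cl x)
  qed
qed

end

text \<open>Competitors agree with \<open>y\<close> to first order at both ends, so that extending
  them by \<open>y\<close> gives a differentiable function on the whole interval, equal to
  \<open>y\<close> near \<open>a\<close> and \<open>b\<close>. Their integrability is part of being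
  admissible.\<close>

locale minimal = lagrange +
  assumes integrable_M: "\<And>k1 k2. a < k1 \<Longrightarrow> k1 < k2 \<Longrightarrow> k2 < b \<Longrightarrow>
      (\<lambda>x. M (x, y x, v x)) integrable_on {k1..k2}"
    and minimality: "\<And>k1 k2 z z'. a < k1 \<Longrightarrow> k1 < k2 \<Longrightarrow> k2 < b \<Longrightarrow>
      (\<And>x. k1 \<le> x \<Longrightarrow> x \<le> k2 \<Longrightarrow> (z has_real_derivative z' x) (at x)) \<Longrightarrow>
      z k1 = y k1 \<Longrightarrow> z k2 = y k2 \<Longrightarrow> z' k1 = v k1 \<Longrightarrow> z' k2 = v k2 \<Longrightarrow>
      (\<lambda>x. M (x, z x, z' x)) integrable_on {k1..k2} \<Longrightarrow>
      integral {k1..k2} (\<lambda>x. M (x, y x, v x)) \<le> integral {k1..k2} (\<lambda>x. M (x, z x, z' x))"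
begin

text \<open>The corner of the broken line is rounded off, and its slopes at the ends are corrected to those of
  \<open>y\<close>, on intervals of length tending to zero and with bounded slopes.\<close>

lemma broken_line:
  assumes k: "a < k1" "k1 < m" "m < k2" "k2 < b"
    and s: "y k2 = y k1 + s1 * (m - k1) + s2 * (k2 - m)"
  shows "integral {k1..k2} (\<lambda>x. M (x, y x, v x)) \<le>
    integral {k1..m} (\<lambda>x. M (x, y k1 + s1 * (x - k1), s1)) +
    integral {m..k2} (\<lambda>x. M (x, y k2 + s2 * (x - k2), s2))"
proof -
  define P :: "real \<Rightarrow> real" where "P x = (max 0 x)\<^sup>2" for x
  have DP: "(P has_real_derivative 2 * max 0 x) (at x)" for x
    unfolding P_def by (rule DERIV_max_0_power2)
  note DP' = DERIV_chain2[OF DP]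
  define H where "H = min (m - k1) (k2 - m)"
  define h where "h n = H / real (Suc n)" for n
  have H: "H > 0" "H \<le> m - k1" "H \<le> k2 - m" using k by (auto simp: H_def)
  have h: "h n > 0" "h n \<le> H" for n
    using H by (auto simp: h_def divide_le_eq mult_le_cancel_left1)
  have h0: "h \<longlonglongrightarrow> 0" unfolding h_def
    using LIMSEQ_Suc[OF lim_const_over_n[of H]] by simp
  have hc: "\<forall>\<^sub>F n in sequentially. h n < c" if "c > 0" for c
    using order_tendstoD(2)[OF h0 that] .
  define \<beta>1 where "\<beta>1 = v k1 - s1"
  define \<beta>2 where "\<beta>2 = s2 - v k2"
  \<comment> \<open>The difference of the two \<open>P\<close> terms integrates a ramp from 0 to 2
    on \<open>[m - h n, m + h n]\<close> and so rounds the corner.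
    \<open>(x - k1) * P (1 - (x - k1)/h n)\<close> vanishes at \<open>k1\<close> with slope 1 there
    and is zero beyond \<open>k1 + h n\<close>; it corrects the slope by \<beta>1, and its mirror
    image does so at \<open>k2\<close>. The bound \<open>h n \<le> H\<close> keeps the rounding away
    from both end values.\<close>
  define z where "z n x = y k1 + s1 * (x - k1)
      + (s2 - s1)/2 * (h n/2 * (P (1 + (x - m)/h n) - P ((x - m)/h n - 1)))
      + \<beta>1 * ((x - k1) * P (1 - (x - k1)/h n)) + \<beta>2 * ((k2 - x) * P (1 - (k2 - x)/h n))" for n x
  define z' where "z' n x = s1 + (s2 - s1)/2 * (max 0 (1 + (x - m)/h n) - max 0 ((x - m)/h n - 1))
      + \<beta>1 * (P (1 - (x - k1)/h n) - 2 * ((x - k1)/h n) * max 0 (1 - (x - k1)/h n))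
      - \<beta>2 * (P (1 - (k2 - x)/h n) - 2 * ((k2 - x)/h n) * max 0 (1 - (k2 - x)/h n))" for n x
  have dz: "(z n has_real_derivative z' n x) (at x)" for n x
    unfolding z_def[abs_def] z'_def using h(1)[of n]
    by (auto intro!: derivative_eq_intros DP' simp: field_simps)
  have cz': "continuous_on S (z' n)" for n S unfolding z'_def P_def
    using h(1)[of n] by (intro continuous_intros) auto
  have cz: "continuous_on S (z n)" for n S
    using dz DERIV_isCont by (intro continuous_at_imp_continuous_on) blast
  have q: "(k1 - m)/h n \<le> - 1" "1 \<le> (k2 - m)/h n" "1 \<le> (k2 - k1)/h n" for n
    using h[of n] H by (auto simp: field_simps)
  have ends: "z n k1 = y k1" "z n k2 = y k2" "z' n k1 = v k1" "z' n k2 = v k2" for n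
  proof -
    have 1: "max 0 (1 + (k1 - m)/h n) = 0" "max 0 ((k1 - m)/h n - 1) = 0" "max 0 (1 - (k2 - k1)/h n) = 0"
      "max 0 (1 + (k2 - m)/h n) = 1 + (k2 - m)/h n" "max 0 ((k2 - m)/h n - 1) = (k2 - m)/h n - 1"
      using q[of n] by auto
    show "z n k1 = y k1" "z' n k1 = v k1"
      by (simp_all add: z_def z'_def P_def 1 \<beta>1_def)
    have "(s2 - s1)/2 * (max 0 (1 + (k2 - m)/h n) - max 0 ((k2 - m)/h n - 1)) = s2 - s1"
      unfolding 1 by simp
    then show "z' n k2 = v k2"
      unfolding z'_def by (simp only:) (simp add: P_def 1(3) \<beta>2_def)
    have "h n/2 * (P (1 + (k2 - m)/h n) - P ((k2 - m)/h n - 1)) = 2 * (k2 - m)"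
      unfolding P_def 1 using h(1)[of n] by (simp add: power2_eq_square field_simps)
    then show "z n k2 = y k2"
      unfolding z_def by (simp only:) (simp add: P_def 1(3) s field_simps)
  qed
  have aux1: "\<bar>max 0 (1 + t) - max 0 (t - 1)\<bar> \<le> 2" for t :: real by (auto simp: max_def)
  have aux2: "\<bar>P (1 - u) - 2 * u * max 0 (1 - u)\<bar> \<le> 3" if "u \<ge> 0" for u
  proof (cases "u \<le> 1")
    case True
    then have "P (1 - u) - 2 * u * max 0 (1 - u) = (1 - u) * (1 - 3 * u)"
      by (simp add: P_def power2_eq_square algebra_simps)
    moreover have "\<bar>(1 - u) * (1 - 3 * u)\<bar> \<le> 1 * 3"
      unfolding abs_mult using True that by (intro mult_mono) auto
    ultimately show ?thesis by simp
  qed (simp add: P_def)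
  define C where "C = \<bar>s1\<bar> + \<bar>s2 - s1\<bar> + \<bar>\<beta>1\<bar> * 3 + \<bar>\<beta>2\<bar> * 3"
  have z'C: "\<bar>z' n x\<bar> \<le> C" if "k1 \<le> x" "x \<le> k2" for n x
  proof -
    have "\<bar>(s2 - s1)/2 * (max 0 (1 + (x - m)/h n) - max 0 ((x - m)/h n - 1))\<bar> \<le> \<bar>s2 - s1\<bar>/2 * 2"
      unfolding abs_mult using aux1[of "(x - m)/h n"] by (intro mult_mono) auto
    moreover have "\<bar>\<beta>1 * (P (1 - (x - k1)/h n) - 2 * ((x - k1)/h n) * max 0 (1 - (x - k1)/h n))\<bar> \<le> \<bar>\<beta>1\<bar> * 3"
      unfolding abs_mult using aux2[of "(x - k1)/h n"] that h(1)[of n] by (intro mult_left_mono) auto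
    moreover have "\<bar>\<beta>2 * (P (1 - (k2 - x)/h n) - 2 * ((k2 - x)/h n) * max 0 (1 - (k2 - x)/h n))\<bar> \<le> \<bar>\<beta>2\<bar> * 3"
      unfolding abs_mult using aux2[of "(k2 - x)/h n"] that h(1)[of n] by (intro mult_left_mono) auto
    moreover have "\<bar>A + B + C1 - D\<bar> \<le> \<bar>A\<bar> + \<bar>B\<bar> + \<bar>C1\<bar> + \<bar>D\<bar>" for A B C1 D :: real by linarith
    then have "\<bar>z' n x\<bar> \<le> \<bar>s1\<bar> + \<bar>(s2 - s1)/2 * (max 0 (1 + (x - m)/h n) - max 0 ((x - m)/h n - 1))\<bar>
      + \<bar>\<beta>1 * (P (1 - (x - k1)/h n) - 2 * ((x - k1)/h n) * max 0 (1 - (x - k1)/h n))\<bar>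
      + \<bar>\<beta>2 * (P (1 - (k2 - x)/h n) - 2 * ((k2 - x)/h n) * max 0 (1 - (k2 - x)/h n))\<bar>"
      unfolding z'_def .
    ultimately show ?thesis unfolding C_def by simp
  qed
  define zl where "zl x = y k1 + s1 * (x - k1) + (s2 - s1) * max 0 (x - m)" for x
  have near: "\<bar>z n x - zl x\<bar> \<le> (\<bar>s2 - s1\<bar> + \<bar>\<beta>1\<bar> + \<bar>\<beta>2\<bar>) * h n" if x: "k1 \<le> x" "x \<le> k2" for n x
  proof -
    have T1: "\<bar>\<eta>/2 * (P (1 + t/\<eta>) - P (t/\<eta> - 1)) - 2 * max 0 t\<bar> \<le> 2 * \<eta>" if "\<eta> > 0" for \<eta> t
    proof -
      consider "t \<le> - \<eta>" | "t \<ge> \<eta>" | "- \<eta> < t" "t < \<eta>" by linarith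
      then show ?thesis
      proof cases
        case 1
        then have "t/\<eta> \<le> - 1" using that by (simp add: field_simps)
        then show ?thesis using 1 that by (simp add: P_def)
      next
        case 2
        then have "1 \<le> t/\<eta>" using that by (simp add: field_simps)
        then have "\<eta>/2 * (P (1 + t/\<eta>) - P (t/\<eta> - 1)) = 2 * t"
          using that by (simp add: P_def power2_eq_square field_simps)
        then show ?thesis using 2 that by simp
      next
        case 3
        then have t: "-1 < t/\<eta>" "t/\<eta> < 1" using that by (auto simp: field_simps)
        then have "P (1 + t/\<eta>) - P (t/\<eta> - 1) = (1 + t/\<eta>)\<^sup>2" by (simp add: P_def)
        moreover have "(1 + t/\<eta>)\<^sup>2 \<le> 2\<^sup>2" using t by (intro power_mono) auto
        ultimately have "0 \<le> \<eta>/2 * (P (1 + t/\<eta>) - P (t/\<eta> - 1))"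
          "\<eta>/2 * (P (1 + t/\<eta>) - P (t/\<eta> - 1)) \<le> \<eta>/2 * 2\<^sup>2"
          using that by (auto intro!: mult_left_mono)
        moreover have "0 \<le> 2 * max 0 t" "2 * max 0 t \<le> 2 * \<eta>" using 3 that by auto
        moreover have "\<eta>/2 * 2\<^sup>2 = 2 * \<eta>" by simp
        ultimately show ?thesis by linarith
      qed
    qed
    have T2: "\<bar>t * P (1 - t/\<eta>)\<bar> \<le> \<eta>" if "\<eta> > 0" "t \<ge> 0" for \<eta> t
    proof (cases "t \<le> \<eta>")
      case True
      then have "0 \<le> 1 - t/\<eta>" "1 - t/\<eta> \<le> 1" using that by auto
      then have "P (1 - t/\<eta>) \<le> 1" "0 \<le> P (1 - t/\<eta>)" by (auto simp: P_def power_le_one)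
      then have "t * P (1 - t/\<eta>) \<le> \<eta> * 1" using that True by (intro mult_mono) auto
      then show ?thesis using that \<open>0 \<le> P (1 - t/\<eta>)\<close> by simp
    next
      case False
      then have "P (1 - t/\<eta>) = 0" using that by (simp add: P_def)
      then show ?thesis using that by simp
    qed
    have zeq: "z n x - zl x = (s2 - s1)/2 * (h n/2 * (P (1 + (x - m)/h n) - P ((x - m)/h n - 1)) - 2 * max 0 (x - m))
      + \<beta>1 * ((x - k1) * P (1 - (x - k1)/h n)) + \<beta>2 * ((k2 - x) * P (1 - (k2 - x)/h n))"
      unfolding z_def zl_def by (simp add: field_simps)
    have b1: "\<bar>(s2 - s1)/2 * (h n/2 * (P (1 + (x - m)/h n) - P ((x - m)/h n - 1)) - 2 * max 0 (x - m))\<bar>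
      \<le> \<bar>s2 - s1\<bar>/2 * (2 * h n)"
      unfolding abs_mult using T1[OF h(1)[of n], of "x - m"] by (intro mult_mono) auto
    have b2: "\<bar>\<beta>1 * ((x - k1) * P (1 - (x - k1)/h n))\<bar> \<le> \<bar>\<beta>1\<bar> * h n"
      using T2[OF h(1)[of n], of "x - k1"] x by (subst abs_mult) (intro mult_left_mono, auto)
    have b3: "\<bar>\<beta>2 * ((k2 - x) * P (1 - (k2 - x)/h n))\<bar> \<le> \<bar>\<beta>2\<bar> * h n"
      using T2[OF h(1)[of n], of "k2 - x"] x by (subst abs_mult) (intro mult_left_mono, auto)
    have "\<bar>z n x - zl x\<bar> \<le> \<bar>s2 - s1\<bar>/2 * (2 * h n) + \<bar>\<beta>1\<bar> * h n + \<bar>\<beta>2\<bar> * h n"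
      unfolding zeq by (intro order_trans[OF abs_triangle_ineq] add_mono b1 b2 b3)
    then show ?thesis by (simp add: algebra_simps)
  qed
  have zlim: "(\<lambda>n. z n x) \<longlonglongrightarrow> zl x" if "k1 \<le> x" "x \<le> k2" for x
  proof (rule LIM_zero_cancel, rule Lim_null_comparison)
    show "\<forall>\<^sub>F n in sequentially. norm (z n x - zl x) \<le> (\<bar>s2 - s1\<bar> + \<bar>\<beta>1\<bar> + \<bar>\<beta>2\<bar>) * h n"
      using near[OF that] by simp
    show "(\<lambda>n. (\<bar>s2 - s1\<bar> + \<bar>\<beta>1\<bar> + \<bar>\<beta>2\<bar>) * h n) \<longlonglongrightarrow> 0"
      using tendsto_mult_right_zero[OF h0] by simp
  qed
  \<comment> \<open>The exact pointwise limit of the slopes, including the exceptional values at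
    \<open>k1\<close>, \<open>m\<close> and \<open>k2\<close>; these three points disappear from the
    integrals later.\<close>
  define \<sigma> where "\<sigma> x = s1 + (s2 - s1)/2 * (if x < m then 0 else if x = m then 1 else 2)
    + \<beta>1 * (if x = k1 then 1 else 0) - \<beta>2 * (if x = k2 then 1 else 0)" for x
  have z'lim: "(\<lambda>n. z' n x) \<longlonglongrightarrow> \<sigma> x" if x: "k1 \<le> x" "x \<le> k2" for x
  proof -
    have "(\<lambda>n. max 0 (1 + (x - m)/h n) - max 0 ((x - m)/h n - 1)) \<longlonglongrightarrow> (if x < m then 0 else if x = m then 1 else 2)"
    proof (cases "x = m")
      case False
      have pos: "0 < \<bar>x - m\<bar>" using False by simp
      have "\<forall>\<^sub>F n in sequentially. max 0 (1 + (x - m)/h n) - max 0 ((x - m)/h n - 1) = (if x < m then 0 else 2)"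
        using hc[OF pos]
      proof eventually_elim
        case (elim n)
        have hn: "h n > 0" by (rule h)
        show ?case
        proof (cases "x < m")
          case True
          then have "(x - m)/h n \<le> - 1" using elim hn by (simp add: field_simps)
          then show ?thesis using True by simp
        next
          case False
          then have "1 \<le> (x - m)/h n" using elim hn \<open>x \<noteq> m\<close> by (simp add: field_simps)
          then show ?thesis using False by simp
        qed
      qed
      from tendsto_eventually[OF this] show ?thesis using False by (cases "x < m") simp_all
    qed simp
    moreover have end_lim: "(\<lambda>n. P (1 - t/h n) - 2 * (t/h n) * max 0 (1 - t/h n)) \<longlonglongrightarrow> (if t = 0 then 1 else 0)"
      if "t \<ge> 0" for t
    proof (cases "t = 0")
      case False
      have pos: "0 < t" using False that by simp
      have "\<forall>\<^sub>F n in sequentially. P (1 - t/h n) - 2 * (t/h n) * max 0 (1 - t/h n) = 0"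
        using hc[OF pos]
      proof eventually_elim
        case (elim n)
        then have "1 \<le> t/h n" using h(1)[of n] by simp
        then show ?case by (simp add: P_def)
      qed
      from tendsto_eventually[OF this] show ?thesis using False by simp
    qed (simp add: P_def)
    ultimately have "(\<lambda>n. z' n x) \<longlonglongrightarrow> s1 + (s2 - s1)/2 * (if x < m then 0 else if x = m then 1 else 2)
      + \<beta>1 * (if x - k1 = 0 then 1 else 0) - \<beta>2 * (if k2 - x = 0 then 1 else 0)"
      unfolding z'_def using x by (intro tendsto_intros end_lim) auto
    moreover have "k2 - x = 0 \<longleftrightarrow> x = k2" by auto
    ultimately show ?thesis unfolding \<sigma>_def by simp
  qed
  define Z where "Z = \<bar>y k1\<bar> + C * (k2 - k1)"
  have zZ: "\<bar>z n x\<bar> \<le> Z" if "k1 \<le> x" "x \<le> k2" for n x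
  proof -
    have "norm (z n x - z n k1) \<le> C * norm (x - k1)"
    proof (rule field_differentiable_bound[of "{k1..k2}"])
      show "(z n has_field_derivative z' n t) (at t within {k1..k2})" for t
        using dz by (rule has_field_derivative_at_within)
      show "norm (z' n t) \<le> C" if "t \<in> {k1..k2}" for t using z'C that by auto
    qed (use that in auto)
    also have "\<dots> \<le> C * (k2 - k1)"
      using that by (intro mult_left_mono) (auto simp: C_def)
    finally show ?thesis using ends(1)[of n] by (auto simp: Z_def)
  qed
  obtain B where B: "\<And>x u w. k1 \<le> x \<Longrightarrow> x \<le> k2 \<Longrightarrow> \<bar>u\<bar> \<le> Z \<Longrightarrow> \<bar>w\<bar> \<le> C \<Longrightarrow> \<bar>M (x, u, w)\<bar> \<le> B"
    using bounded_on_box[OF cont_M k(1,4)] by metis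
  have int: "(\<lambda>x. M (x, z n x, z' n x)) integrable_on {k1..k2}" for n
    using k by (intro integrable_continuous_interval continuous_along[OF cont_M] cz cz') auto
  let ?g = "\<lambda>x. M (x, zl x, \<sigma> x)"
  have bd: "norm (M (x, z n x, z' n x)) \<le> B" if "x \<in> {k1..k2}" for n x
    using that by (auto intro!: B zZ z'C)
  have cv: "(\<lambda>n. M (x, z n x, z' n x)) \<longlonglongrightarrow> ?g x" if "x \<in> {k1..k2}" for x
    using that k by (intro seq_lims zlim z'lim tendsto_const) auto
  note g = dominated_convergence[OF int integrable_const_ivl bd cv]
  have "integral {k1..k2} (\<lambda>x. M (x, y x, v x)) \<le> integral {k1..k2} ?g"
  proof (rule LIMSEQ_le_const[OF g(2)])
    show "\<exists>N. \<forall>n\<ge>N. integral {k1..k2} (\<lambda>x. M (x, y x, v x)) \<le> integral {k1..k2} (\<lambda>x. M (x, z n x, z' n x))"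
      using minimality[OF k(1) _ k(4) dz ends int] k by auto
  qed
  also have "\<dots> = integral {k1..m} ?g + integral {m..k2} ?g"
    using Henstock_Kurzweil_Integration.integral_combine[OF _ _ g(1), of m] k by simp
  also have "integral {k1..m} ?g = integral {k1..m} (\<lambda>x. M (x, y k1 + s1 * (x - k1), s1))"
    by (rule integral_spike[of "{k1, m}"]) (use k in \<open>auto simp: zl_def \<sigma>_def\<close>)
  also have "integral {m..k2} ?g = integral {m..k2} (\<lambda>x. M (x, y k2 + s2 * (x - k2), s2))"
    by (rule integral_spike[of "{m, k2}"]) (use k in \<open>auto simp: zl_def \<sigma>_def s field_simps\<close>)
  finally show ?thesis by simp
qed

end

section \<open>Null sets of velocities\<close>

text \<open>At a tag in \<open>S\<close> every short interval has an error \<bar>f x * length -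
  integral\<bar> of at least \<delta> times its length. Henstock's lemma makes the sum of these
  errors small, so the Riemann sums of the indicator of \<open>S\<close> tend to 0. This works for
  Henstock-Kurzweil integrable \<open>f\<close>.\<close>

lemma negligible_by_Henstock:
  fixes f :: "real \<Rightarrow> real"
  assumes f: "f integrable_on {c..d}" and S: "S \<subseteq> {c..d}" and "\<delta> > 0"
    and loc: "\<And>x. x \<in> S \<Longrightarrow> \<exists>\<gamma>>0. \<forall>k1 k2. c \<le> k1 \<longrightarrow> k1 < k2 \<longrightarrow> k2 \<le> d \<longrightarrow> k1 \<le> x \<longrightarrow> x \<le> k2 \<longrightarrow>
        k2 - k1 < \<gamma> \<longrightarrow> integral {k1..k2} f \<le> (f x - \<delta>) * (k2 - k1)"
  shows "negligible S"
proof -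
  obtain g where g: "\<And>x. x \<in> S \<Longrightarrow> g x > 0" "\<And>x k1 k2. x \<in> S \<Longrightarrow> c \<le> k1 \<Longrightarrow> k1 < k2 \<Longrightarrow> k2 \<le> d \<Longrightarrow>
      k1 \<le> x \<Longrightarrow> x \<le> k2 \<Longrightarrow> k2 - k1 < g x \<Longrightarrow> integral {k1..k2} f \<le> (f x - \<delta>) * (k2 - k1)"
    using loc by metis
  have "(indicat_real S has_integral 0) (cbox c d)"
    unfolding has_integral
  proof (intro allI impI)
    fix e :: real assume "e > 0"
    then have pos: "e * \<delta> > 0" using \<open>\<delta> > 0\<close> by simp
    have fint: "f integrable_on cbox c d" using f by simp
    obtain \<gamma> where \<gamma>: "gauge \<gamma>" "\<And>p. \<lbrakk>p tagged_partial_division_of (cbox c d); \<gamma> fine p\<rbrakk> \<Longrightarrow>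
             sum (\<lambda>(x,k). norm (measure lborel k *\<^sub>R f x - integral k f)) p < e * \<delta>"
      by (rule Henstock_lemma[OF fint pos]) (rule that)
    define \<gamma>' where "\<gamma>' x = (if x \<in> S then \<gamma> x \<inter> ball x (g x / 2) else \<gamma> x)" for x
    have "gauge \<gamma>'" using \<gamma>(1) g(1) unfolding gauge_def \<gamma>'_def by auto
    moreover have "norm ((\<Sum>(x, k)\<in>\<D>. measure lborel k *\<^sub>R indicat_real S x) - 0) < e"
      if D: "\<D> tagged_division_of cbox c d" and fine: "\<gamma>' fine \<D>" for \<D>
    proof -
      define p where "p = {(x, k) \<in> \<D>. x \<in> S}"
      have pD: "p \<subseteq> \<D>" by (auto simp: p_def)
      have "\<gamma> fine p"
      proof (rule fineI)
        fix x k assume "(x, k) \<in> p"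
        then have "k \<subseteq> \<gamma>' x" using fineD[OF fine, of x k] pD by blast
        then show "k \<subseteq> \<gamma> x" by (auto simp: \<gamma>'_def split: if_splits)
      qed
      moreover have "p tagged_partial_division_of (cbox c d)"
        using D pD tagged_partial_division_subset unfolding tagged_division_of_def by blast
      ultimately have H: "sum (\<lambda>(x,k). norm (measure lborel k *\<^sub>R f x - integral k f)) p < e * \<delta>"
        by (rule \<gamma>(2)[rotated])
      have fin: "finite \<D>" using D by (rule tagged_division_of_finite)
      have "(\<Sum>(x, k)\<in>\<D>. measure lborel k *\<^sub>R indicat_real S x) = (\<Sum>(x, k)\<in>p. measure lborel k)"
      proof (rule sum.mono_neutral_cong_right[OF fin pD])
        show "\<forall>i\<in>\<D> - p. (case i of (x, k) \<Rightarrow> measure lborel k *\<^sub>R indicat_real S x) = 0"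
          by (auto simp: p_def indicator_def split: if_splits)
      qed (auto simp: p_def indicator_def split: if_splits)
      also have "\<dots> \<le> (\<Sum>(x, k)\<in>p. norm (measure lborel k *\<^sub>R f x - integral k f) / \<delta>)"
      proof (rule sum_mono, clarify)
        fix x k assume xk: "(x, k) \<in> p"
        then have "(x, k) \<in> \<D>" and xS: "x \<in> S" by (auto simp: p_def)
        then obtain k1 k2 where k: "k = cbox k1 k2" "x \<in> k" "k \<subseteq> cbox c d"
          using tagged_division_ofD(2-4)[OF D] by metis
        show "measure lborel k \<le> norm (measure lborel k *\<^sub>R f x - integral k f) / \<delta>"
        proof (cases "k1 < k2")
          case True
          have "k \<subseteq> ball x (g x / 2)" using fineD[OF fine \<open>(x, k) \<in> \<D>\<close>] xS by (auto simp: \<gamma>'_def)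
          moreover have "k1 \<in> k" "k2 \<in> k" using k(1) True by auto
          ultimately have "k1 \<in> ball x (g x / 2)" "k2 \<in> ball x (g x / 2)" by blast+
          then have "\<bar>x - k1\<bar> < g x / 2" "\<bar>x - k2\<bar> < g x / 2" by (simp_all add: dist_real_def)
          then have "k2 - k1 < g x" by linarith
          moreover have "c \<le> k1" "k2 \<le> d" "k1 \<le> x" "x \<le> k2" using k True by auto
          ultimately have "integral {k1..k2} f \<le> (f x - \<delta>) * (k2 - k1)" using g(2)[OF xS] True by blast
          then have "\<delta> * (k2 - k1) \<le> \<bar>(k2 - k1) * f x - integral {k1..k2} f\<bar>" by (simp add: algebra_simps)
          then show ?thesis using k(1) True \<open>\<delta> > 0\<close> by (simp add: pos_le_divide_eq mult.commute)
        next
          case False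
          then have "measure lborel k = 0" using k by auto
          then show ?thesis using \<open>\<delta> > 0\<close> by simp
        qed
      qed
      also have "\<dots> = (\<Sum>(x, k)\<in>p. norm (measure lborel k *\<^sub>R f x - integral k f)) / \<delta>"
        by (simp add: sum_divide_distrib case_prod_unfold)
      also have "\<dots> < e" using H \<open>\<delta> > 0\<close> by (simp add: pos_divide_less_eq)
      finally have "(\<Sum>(x, k)\<in>\<D>. measure lborel k *\<^sub>R indicat_real S x) < e" .
      moreover have "0 \<le> (\<Sum>(x, k)\<in>\<D>. measure lborel k *\<^sub>R indicat_real S x)"
        by (rule sum_nonneg) auto
      ultimately show ?thesis by simp
    qed
    ultimately show "\<exists>\<gamma>. gauge \<gamma> \<and> (\<forall>\<D>. \<D> tagged_division_of cbox c d \<and> \<gamma> fine \<D> \<longrightarrow>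
        norm ((\<Sum>(x, k)\<in>\<D>. measure lborel k *\<^sub>R indicat_real S x) - 0) < e)"
      by (intro exI[of _ \<gamma>'] conjI allI impI) simp_all
  qed
  then have "(indicat_real S has_integral 0) UNIV"
    by (rule has_integral_on_superset) (use S in \<open>auto simp: indicator_def\<close>)
  then show ?thesis by (simp add: negligible_UNIV)
qed

text \<open>A bound off a null set can be integrated, since a derivative is Henstock-Kurzweil
  integrable with its increment as integral.\<close>

lemma increment_ge:
  fixes y v :: "real \<Rightarrow> real"
  assumes "\<alpha> < \<beta>" and der: "\<And>x. \<alpha> \<le> x \<Longrightarrow> x \<le> \<beta> \<Longrightarrow> (y has_real_derivative v x) (at x)"
    and N: "negligible N" and v: "\<And>x. \<alpha> < x \<Longrightarrow> x < \<beta> \<Longrightarrow> x \<notin> N \<Longrightarrow> c \<le> \<tau> * (v x - v0)"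
  shows "c * (\<beta> - \<alpha>) \<le> \<tau> * (y \<beta> - y \<alpha> - v0 * (\<beta> - \<alpha>))"
proof -
  have "(v has_integral (y \<beta> - y \<alpha>)) {\<alpha>..\<beta>}"
  proof (rule fundamental_theorem_of_calculus)
    show "(y has_vector_derivative v x) (at x within {\<alpha>..\<beta>})" if "x \<in> {\<alpha>..\<beta>}" for x
      using has_field_derivative_at_within[OF der[of x]] that
      by (simp add: has_real_derivative_iff_has_vector_derivative)
  qed (use \<open>\<alpha> < \<beta>\<close> in simp)
  then have "((\<lambda>x. \<tau> * (v x - v0)) has_integral \<tau> * (y \<beta> - y \<alpha> - v0 * (\<beta> - \<alpha>))) {\<alpha>..\<beta>}"
    using \<open>\<alpha> < \<beta>\<close> has_integral_const_real[of v0 \<alpha> \<beta>]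
    by (intro has_integral_mult_right has_integral_diff) (auto simp: mult.commute)
  moreover have "negligible (N \<union> {\<alpha>, \<beta>})" using N by simp
  ultimately have int: "((\<lambda>x. if x \<in> N \<union> {\<alpha>, \<beta>} then c else \<tau> * (v x - v0)) has_integral
      \<tau> * (y \<beta> - y \<alpha> - v0 * (\<beta> - \<alpha>))) {\<alpha>..\<beta>}"
    by (rule has_integral_spike[rotated 2]) auto
  have "((\<lambda>x. c) has_integral c * (\<beta> - \<alpha>)) {\<alpha>..\<beta>}"
    using has_integral_const_real[of c \<alpha> \<beta>] \<open>\<alpha> < \<beta>\<close> by (simp add: mult.commute)
  then show ?thesis
    by (rule has_integral_le[OF _ int]) (use v in force)
qed

text \<open>The almost everywhere bound passes to all difference quotients of \<open>y\<close> at
  \<open>l\<close> towards \<xi>, hence to their limit \<open>v l\<close>. The segment form covers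
  both directions.\<close>

lemma one_sided_velocity_ge:
  fixes y v :: "real \<Rightarrow> real"
  assumes "l \<noteq> \<xi>" and der: "\<And>x. x \<in> closed_segment l \<xi> \<Longrightarrow> (y has_real_derivative v x) (at x)"
    and N: "negligible N" and v: "\<And>x. x \<in> open_segment l \<xi> \<Longrightarrow> x \<notin> N \<Longrightarrow> c \<le> \<tau> * (v x - v0)"
  shows "c \<le> \<tau> * (v l - v0)"
proof -
  let ?q = "\<lambda>x. (y x - y l) / (x - l)"
  have "(?q \<longlongrightarrow> v l) (at l)" using der[of l] by (simp add: has_field_derivative_iff)
  then have lim: "((\<lambda>x. \<tau> * (?q x - v0)) \<longlongrightarrow> \<tau> * (v l - v0)) (at l)" by (intro tendsto_intros)
  have ge: "c \<le> \<tau> * (?q x - v0)" if x: "x \<in> open_segment l \<xi>" for x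
  proof (cases "l < \<xi>")
    case True
    then have x': "l < x" "x < \<xi>" using x by (auto simp: open_segment_eq_real_ivl)
    have "c * (x - l) \<le> \<tau> * (y x - y l - v0 * (x - l))"
    proof (rule increment_ge[OF x'(1) _ N])
      show "(y has_real_derivative v t) (at t)" if "l \<le> t" "t \<le> x" for t
        using that x' by (intro der) (auto simp: closed_segment_eq_real_ivl)
      show "c \<le> \<tau> * (v t - v0)" if "l < t" "t < x" "t \<notin> N" for t
        using that x' by (intro v) (auto simp: open_segment_eq_real_ivl)
    qed
    also have "\<dots> = \<tau> * (?q x - v0) * (x - l)" using x' by (simp add: field_simps)
    finally show ?thesis using x' by simp
  next
    case False
    then have x': "x < l" "\<xi> < x" using x by (auto simp: open_segment_eq_real_ivl split: if_splits)
    have "c * (l - x) \<le> \<tau> * (y l - y x - v0 * (l - x))"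
    proof (rule increment_ge[OF x'(1) _ N])
      show "(y has_real_derivative v t) (at t)" if "x \<le> t" "t \<le> l" for t
        using that x' by (intro der) (auto simp: closed_segment_eq_real_ivl)
      show "c \<le> \<tau> * (v t - v0)" if "x < t" "t < l" "t \<notin> N" for t
        using that x' by (intro v) (auto simp: open_segment_eq_real_ivl)
    qed
    also have "\<dots> = \<tau> * (?q x - v0) * (l - x)"
    proof -
      have "?q x = (y l - y x) / (l - x)" using x' by (simp add: divide_simps) (simp add: algebra_simps)
      then show ?thesis using x' by (simp add: field_simps)
    qed
    finally show ?thesis using x' by simp
  qed
  show ?thesis
  proof (cases "l < \<xi>")
    case True
    have "((\<lambda>x. \<tau> * (?q x - v0)) \<longlongrightarrow> \<tau> * (v l - v0)) (at_right l)"
      using lim by (rule filterlim_mono) (auto simp: at_within_le_nhds at_le)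
    moreover have "\<forall>\<^sub>F x in at_right l. c \<le> \<tau> * (?q x - v0)"
      using eventually_at_right_less[of l] eventually_at_rightI[of l \<xi> "\<lambda>x. c \<le> \<tau> * (?q x - v0)"] True ge
      by (auto simp: open_segment_eq_real_ivl)
    ultimately show ?thesis by (rule tendsto_lowerbound) simp
  next
    case False
    have "((\<lambda>x. \<tau> * (?q x - v0)) \<longlongrightarrow> \<tau> * (v l - v0)) (at_left l)"
      using lim by (rule filterlim_mono) (auto simp: at_within_le_nhds at_le)
    moreover have "\<forall>\<^sub>F x in at_left l. c \<le> \<tau> * (?q x - v0)"
      using eventually_at_leftI[of \<xi> l "\<lambda>x. c \<le> \<tau> * (?q x - v0)"] False \<open>l \<noteq> \<xi>\<close> ge
      by (auto simp: open_segment_eq_real_ivl)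
    ultimately show ?thesis by (rule tendsto_lowerbound) simp
  qed
qed

text \<open>Near a point of small oscillation of \<open>v\<close> on \<open>F\<close>, the closure
  of the set where \<bar>v - v0\<bar> < \<rho>/2, all of \<open>F\<close> has velocities within
  \<rho> of \<open>v0\<close>; so \<open>F\<close> is null there and misses some \<xi>. Between
  \<xi> and the nearest point \<open>l\<close> of \<open>F\<close> the difference
  \<open>v - v0\<close> keeps its sign by Darboux and is at least \<rho> in size almost everywhere.
  Then it is so at \<open>l\<close> too, although \<open>l\<close> belongs to
  \<open>F\<close>.\<close>

lemma denjoy_clarkson:
  fixes y v :: "real \<Rightarrow> real"
  assumes der: "\<And>x. a < x \<Longrightarrow> x < b \<Longrightarrow> (y has_real_derivative v x) (at x)"
    and cd: "a < c" "c < d" "d < b" and \<rho>: "\<rho> > 0" and N: "negligible {x \<in> {c..d}. \<bar>v x - v0\<bar> < \<rho>}"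
    and x0: "c \<le> x0" "x0 \<le> d" "v x0 = v0"
  shows False
proof -
  define N where "N = {x \<in> {c..d}. \<bar>v x - v0\<bar> < \<rho>}"
  define A where "A = {x \<in> {c..d}. \<bar>v x - v0\<bar> < \<rho>/2}"
  define F where "F = closure A"
  have "A \<subseteq> {c..d}" "x0 \<in> A" using x0 \<rho> by (auto simp: A_def)
  then have F: "closed F" "F \<subseteq> {c..d}" "F \<noteq> {}" "A \<subseteq> F"
    unfolding F_def using closure_subset[of A] by (simp_all add: closure_minimal) blast
  have "\<exists>x\<in>F. \<exists>\<delta>>0. \<forall>s\<in>F. \<bar>s - x\<bar> < \<delta> \<longrightarrow> \<bar>v s - v x\<bar> \<le> \<rho>/4"
    by (rule derivative_small_oscillation[OF der F(1-3)]) (use cd \<rho> in auto)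
  then obtain z \<delta> where z: "z \<in> F" "\<delta> > 0" "\<And>s. s \<in> F \<Longrightarrow> \<bar>s - z\<bar> < \<delta> \<Longrightarrow> \<bar>v s - v z\<bar> \<le> \<rho>/4" by blast
  obtain q where q: "q \<in> A" "\<bar>q - z\<bar> < \<delta>"
    using z(1,2) unfolding F_def closure_approachable dist_real_def by auto
  \<comment> \<open>Through the point \<open>q\<close> of \<open>A\<close>: two oscillations of
    \<rho>/4 and the distance below \<rho>/2 at \<open>q\<close> itself.\<close>
  have near: "\<bar>v s - v0\<bar> < \<rho>" if "s \<in> F" "\<bar>s - z\<bar> < \<delta>" for s
  proof -
    have "q \<in> F" "\<bar>v q - v0\<bar> < \<rho>/2" using q F(4) by (auto simp: A_def)
    then have "\<bar>v s - v z\<bar> \<le> \<rho>/4" "\<bar>v q - v z\<bar> \<le> \<rho>/4" "\<bar>v q - v0\<bar> < \<rho>/2"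
      using z(3)[OF that] z(3)[OF _ q(2)] by auto
    then show ?thesis by linarith
  qed
  have zcd: "c \<le> z" "z \<le> d" using z F by auto
  have "\<exists>\<xi>. \<xi> \<in> {c..d} \<and> \<bar>\<xi> - z\<bar> < \<delta> \<and> \<xi> \<notin> F"
  proof (rule ccontr)
    assume "\<not> ?thesis"
    then have sub: "s \<in> F" if "s \<in> {c..d}" "\<bar>s - z\<bar> < \<delta>" for s using that by blast
    define k1 k2 where "k1 = max c (z - \<delta>/2)" and "k2 = min d (z + \<delta>/2)"
    have "k1 < k2" using zcd cd \<open>\<delta> > 0\<close> by (auto simp: k1_def k2_def)
    have "{k1..k2} \<subseteq> N"
    proof
      fix s assume "s \<in> {k1..k2}"
      then have "s \<in> {c..d}" "\<bar>s - z\<bar> < \<delta>" using \<open>\<delta> > 0\<close> by (auto simp: k1_def k2_def)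
      then show "s \<in> N" using sub near by (auto simp: N_def)
    qed
    then have "negligible {k1..k2}" using N unfolding N_def by (rule negligible_subset[rotated])
    then show False using \<open>k1 < k2\<close> negligible_interval(1)[of k1 k2] by (auto simp: box_real)
  qed
  then obtain \<xi> where \<xi>: "\<xi> \<in> {c..d}" "\<bar>\<xi> - z\<bar> < \<delta>" "\<xi> \<notin> F" by blast
  define T where "T = F \<inter> closed_segment q \<xi>"
  have T: "compact T" "T \<noteq> {}" "continuous_on T (dist \<xi>)"
    unfolding T_def using F q by (auto intro!: closed_Int_compact continuous_intros)
  obtain l where l: "l \<in> T" "\<And>s. s \<in> T \<Longrightarrow> dist \<xi> l \<le> dist \<xi> s"
    using continuous_attains_inf[OF T] by blast
  have lq: "l \<in> F" "l \<in> closed_segment q \<xi>" using l by (auto simp: T_def)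
  have "l \<noteq> \<xi>" using lq \<xi> by auto
  have qcd: "q \<in> {c..d}" using q by (auto simp: A_def)
  have seg: "closed_segment l \<xi> \<subseteq> {c..d}" "\<bar>l - z\<bar> < \<delta>"
    using lq qcd \<xi> q by (auto simp: closed_segment_eq_real_ivl split: if_splits)
  have out: "x \<notin> F" if x: "x \<in> open_segment l \<xi> \<or> x = \<xi>" for x
  proof
    assume "x \<in> F"
    moreover have "x \<in> closed_segment q \<xi>" "dist \<xi> x < dist \<xi> l"
      using x lq \<open>l \<noteq> \<xi>\<close>
      by (auto simp: closed_segment_eq_real_ivl open_segment_eq_real_ivl dist_real_def split: if_splits)
    ultimately show False using l(2)[of x] by (auto simp: T_def)
  qed
  have big: "\<rho>/2 \<le> \<bar>v x - v0\<bar>" if "x \<in> open_segment l \<xi> \<or> x = \<xi>" for x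
  proof -
    have "x \<in> {c..d}" using that seg \<xi> open_closed_segment by blast
    then show ?thesis using out[OF that] F(4) by (force simp: A_def)
  qed
  define \<tau> where "\<tau> = sgn (v \<xi> - v0)"
  have \<tau>: "\<tau> = 1 \<or> \<tau> = - 1" using big[of \<xi>] \<rho> unfolding \<tau>_def sgn_if by auto
  have pos: "\<tau> * (v x - v0) > 0" if x: "x \<in> open_segment l \<xi>" for x
  proof (rule ccontr)
    assume neg: "\<not> ?thesis"
    have sub: "t \<in> open_segment l \<xi>" if "t \<in> open_segment x \<xi>" for t
      using that x by (auto simp: open_segment_eq_real_ivl split: if_splits)
    have "t \<in> {c..d}" if "t \<in> closed_segment x \<xi>" for t
      using that x seg \<xi> by (auto simp: open_segment_eq_real_ivl closed_segment_eq_real_ivl split: if_splits)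
    then have dery: "(y has_real_derivative v t) (at t)" if "t \<in> closed_segment x \<xi>" for t
      using that cd by (intro der) force+
    have xx: "\<tau> * v x < \<tau> * v0" using neg big[of x] x \<tau> \<rho> by auto
    have \<xi>\<xi>: "\<tau> * v0 < \<tau> * v \<xi>" using big[of \<xi>] \<rho> unfolding \<tau>_def sgn_if by auto
    have "\<exists>t\<in>open_segment x \<xi>. \<tau> * v t = \<tau> * v0"
      by (rule darboux_derivative[of x \<xi> "\<lambda>x. \<tau> * y x"]) (use xx \<xi>\<xi> in \<open>auto intro!: DERIV_cmult dery\<close>)
    then obtain t where "t \<in> open_segment x \<xi>" "v t = v0" using \<tau> by auto
    then show False using big[of t] sub \<rho> by auto
  qed
  have "\<rho> \<le> \<tau> * (v l - v0)"
  proof (rule one_sided_velocity_ge[OF \<open>l \<noteq> \<xi>\<close> _ N[folded N_def]])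
    show "(y has_real_derivative v x) (at x)" if "x \<in> closed_segment l \<xi>" for x
      using that seg(1) cd by (intro der) force+
    show "\<rho> \<le> \<tau> * (v x - v0)" if x: "x \<in> open_segment l \<xi>" "x \<notin> N" for x
    proof -
      have "x \<in> {c..d}" using x seg open_closed_segment by blast
      then have "\<rho> \<le> \<bar>v x - v0\<bar>" using x by (auto simp: N_def)
      then show ?thesis using pos[OF x(1)] \<tau> by auto
    qed
  qed
  moreover have "\<tau> * (v l - v0) \<le> \<bar>v l - v0\<bar>" using \<tau> by auto
  ultimately show False using near[OF lq(1) seg(2)] by simp
qed

section \<open>The Weierstrass condition\<close>

context minimal
begin

text \<open>With \<open>v\<close> bounded, varying by \<epsilon> * \<zeta> gives integrable
  competitors and dominated difference quotients. The bump \<zeta> vanishes at the ends together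
  with its derivative, as \<open>minimality\<close> requires; \<epsilon> of both signs gives
  equality.\<close>

lemma first_variation:
  assumes r: "r > 0" "a < e - r" "e + r < b" and v: "\<And>x. e - r \<le> x \<Longrightarrow> x \<le> e + r \<Longrightarrow> \<bar>v x\<bar> \<le> B"
  defines "\<zeta> \<equiv> \<lambda>x. (r\<^sup>2 - (x - e)\<^sup>2)\<^sup>2" and "\<zeta>' \<equiv> \<lambda>x. - 4 * (x - e) * (r\<^sup>2 - (x - e)\<^sup>2)"
  shows "((\<lambda>x. My (x, y x, v x) * \<zeta> x + p x * \<zeta>' x) has_integral 0) {e - r..e + r}"
proof -
  let ?I = "{e - r..e + r}"
  let ?g = "\<lambda>x. My (x, y x, v x) * \<zeta> x + p x * \<zeta>' x"
  have d\<zeta>: "(\<zeta> has_real_derivative \<zeta>' x) (at x)" for x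
    unfolding \<zeta>_def \<zeta>'_def by (auto intro!: derivative_eq_intros)
  have c\<zeta>: "continuous_on S \<zeta>" "continuous_on S \<zeta>'" for S
    unfolding \<zeta>_def \<zeta>'_def by (intro continuous_intros)+
  have cy: "continuous_on ?I y"
    using r by (intro continuous_at_imp_continuous_on ballI isCont_y) auto
  obtain Y where Y: "\<And>x. e - r \<le> x \<Longrightarrow> x \<le> e + r \<Longrightarrow> \<bar>y x\<bar> \<le> Y" using y_bounded[OF r(2,3)] by metis
  have "bounded (\<zeta> ` ?I)" "bounded (\<zeta>' ` ?I)"
    using c\<zeta> by (auto intro!: compact_imp_bounded compact_continuous_image)
  then obtain Z W where Z: "\<And>x. x \<in> ?I \<Longrightarrow> \<bar>\<zeta> x\<bar> \<le> Z" and W: "\<And>x. x \<in> ?I \<Longrightarrow> \<bar>\<zeta>' x\<bar> \<le> W"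
    unfolding bounded_iff real_norm_def by blast
  have ZW: "0 \<le> Z" "0 \<le> W"
  proof -
    have "e \<in> ?I" using r by simp
    then show "0 \<le> Z" "0 \<le> W" using Z[of e] W[of e] by auto
  qed
  obtain Cy where Cy: "\<And>x z w. e - r \<le> x \<Longrightarrow> x \<le> e + r \<Longrightarrow> \<bar>z\<bar> \<le> Y + Z \<Longrightarrow> \<bar>w\<bar> \<le> B + W \<Longrightarrow> \<bar>My (x, z, w)\<bar> \<le> Cy"
    using bounded_on_box[OF cont_My r(2,3)] by metis
  obtain Cw where Cw: "\<And>x z w. e - r \<le> x \<Longrightarrow> x \<le> e + r \<Longrightarrow> \<bar>z\<bar> \<le> Y + Z \<Longrightarrow> \<bar>w\<bar> \<le> B + W \<Longrightarrow> \<bar>Mw (x, z, w)\<bar> \<le> Cw"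
    using bounded_on_box[OF cont_Mw r(2,3)] by metis
  define G where "G \<epsilon> x = M (x, y x + \<epsilon> * \<zeta> x, v x + \<epsilon> * \<zeta>' x)" for \<epsilon> x
  have intG: "G \<epsilon> integrable_on ?I" for \<epsilon>
    unfolding G_def[abs_def]
    by (rule integrable_along[OF r(2,3) cont_M v]) (auto intro!: continuous_intros cy c\<zeta>)
  have minG: "integral ?I (G 0) \<le> integral ?I (G \<epsilon>)" for \<epsilon>
  proof -
    have "integral ?I (\<lambda>x. M (x, y x, v x)) \<le> integral ?I (\<lambda>x. M (x, y x + \<epsilon> * \<zeta> x, v x + \<epsilon> * \<zeta>' x))"
    proof (rule minimality)
      show "((\<lambda>x. y x + \<epsilon> * \<zeta> x) has_real_derivative v x + \<epsilon> * \<zeta>' x) (at x)" if "e - r \<le> x" "x \<le> e + r" for x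
        using that r by (auto intro!: derivative_eq_intros y_deriv d\<zeta>)
    qed (use r intG[unfolded G_def] in \<open>auto simp: \<zeta>_def \<zeta>'_def\<close>)
    then show ?thesis by (simp add: G_def[abs_def])
  qed
  have key: "?g integrable_on ?I \<and> 0 \<le> \<sigma> * integral ?I ?g" if \<sigma>: "\<sigma> = 1 \<or> \<sigma> = - 1" for \<sigma> :: real
  proof -
    define \<epsilon> where "\<epsilon> n = \<sigma> / real (Suc n)" for n
    have \<epsilon>: "\<epsilon> n \<noteq> 0" "\<bar>\<epsilon> n\<bar> \<le> 1" "\<epsilon> n = \<sigma> * \<bar>\<epsilon> n\<bar>" for n using \<sigma> by (auto simp: \<epsilon>_def)
    have "\<epsilon> \<longlonglongrightarrow> 0" unfolding \<epsilon>_def using LIMSEQ_Suc[OF lim_const_over_n[of \<sigma>]] by simp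
    then have \<epsilon>0: "filterlim \<epsilon> (at 0) sequentially" using \<epsilon> by (auto simp: filterlim_at)
    define Q where "Q n x = (G (\<epsilon> n) x - G 0 x) / \<epsilon> n" for n x
    have intQ: "Q n integrable_on ?I" for n
      unfolding Q_def[abs_def] by (intro integrable_on_divide integrable_diff intG)
    have bd: "norm (Q n x) \<le> Cy * Z + Cw * W" if x: "x \<in> ?I" for n x
    proof -
      have x': "e - r \<le> x" "x \<le> e + r" "a < x" "x < b" using x r by auto
      obtain t where t: "0 < t" "t < 1" "M (x, y x + \<epsilon> n * \<zeta> x, v x + \<epsilon> n * \<zeta>' x) - M (x, y x, v x) =
         Mx (x + t * (x - x), y x + t * (y x + \<epsilon> n * \<zeta> x - y x), v x + t * (v x + \<epsilon> n * \<zeta>' x - v x)) * (x - x) +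
         My (x + t * (x - x), y x + t * (y x + \<epsilon> n * \<zeta> x - y x), v x + t * (v x + \<epsilon> n * \<zeta>' x - v x)) * (y x + \<epsilon> n * \<zeta> x - y x) +
         Mw (x + t * (x - x), y x + t * (y x + \<epsilon> n * \<zeta> x - y x), v x + t * (v x + \<epsilon> n * \<zeta>' x - v x)) * (v x + \<epsilon> n * \<zeta>' x - v x)"
        using M_mvt[OF x'(3,4,3,4), of "y x + \<epsilon> n * \<zeta> x" "v x + \<epsilon> n * \<zeta>' x" "y x" "v x"] by metis
      let ?q = "(x, y x + t * (\<epsilon> n * \<zeta> x), v x + t * (\<epsilon> n * \<zeta>' x))"
      have Qeq: "Q n x = My ?q * \<zeta> x + Mw ?q * \<zeta>' x"
        using t(3) \<epsilon>(1)[of n] by (simp add: Q_def G_def field_simps)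
      have te: "\<bar>t * \<epsilon> n\<bar> \<le> 1" unfolding abs_mult using t \<epsilon>(2)[of n] by (intro mult_le_one) auto
      have "\<bar>t * \<epsilon> n * \<zeta> x\<bar> \<le> 1 * Z"
        unfolding abs_mult[of "t * \<epsilon> n"] using te Z[OF x] by (intro mult_mono) auto
      moreover have "\<bar>t * \<epsilon> n * \<zeta>' x\<bar> \<le> 1 * W"
        unfolding abs_mult[of "t * \<epsilon> n"] using te W[OF x] by (intro mult_mono) auto
      ultimately have "\<bar>y x + t * (\<epsilon> n * \<zeta> x)\<bar> \<le> Y + Z" "\<bar>v x + t * (\<epsilon> n * \<zeta>' x)\<bar> \<le> B + W"
        using Y[OF x'(1,2)] v[OF x'(1,2)] by (simp_all add: mult.assoc)
      then have "\<bar>My ?q\<bar> \<le> Cy" "\<bar>Mw ?q\<bar> \<le> Cw" using Cy Cw x' by blast+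
      then have "\<bar>My ?q * \<zeta> x\<bar> \<le> Cy * Z" "\<bar>Mw ?q * \<zeta>' x\<bar> \<le> Cw * W"
        unfolding abs_mult using Z[OF x] W[OF x] by (auto intro!: mult_mono)
      then show ?thesis unfolding Qeq real_norm_def using abs_triangle_ineq add_mono order_trans by blast
    qed
    have cv: "(\<lambda>n. Q n x) \<longlonglongrightarrow> ?g x" if x: "x \<in> ?I" for x
    proof -
      have x': "a < x" "x < b" using x r by auto
      have "((\<lambda>\<epsilon>. y x + \<epsilon> * \<zeta> x) has_real_derivative \<zeta> x) (at 0)"
        "((\<lambda>\<epsilon>. v x + \<epsilon> * \<zeta>' x) has_real_derivative \<zeta>' x) (at 0)"
        by (auto intro!: derivative_eq_intros)
      then have "((\<lambda>\<epsilon>. G \<epsilon> x) has_real_derivative ?g x) (at 0)"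
        unfolding G_def using M_chain[of "\<lambda>_. x" 0 0 "\<lambda>\<epsilon>. y x + \<epsilon> * \<zeta> x" "\<zeta> x" "\<lambda>\<epsilon>. v x + \<epsilon> * \<zeta>' x" "\<zeta>' x"] x' p_eq[OF x']
        by simp
      then have "((\<lambda>h. (G (0 + h) x - G 0 x) / h) \<longlongrightarrow> ?g x) (at 0)" by (simp only: DERIV_def)
      from filterlim_compose[OF this \<epsilon>0] show ?thesis by (simp add: Q_def)
    qed
    note dc = dominated_convergence[OF intQ integrable_const_ivl bd cv]
    have "0 \<le> \<sigma> * integral ?I (Q n)" for n
    proof -
      have "integral ?I (Q n) = (integral ?I (G (\<epsilon> n)) - integral ?I (G 0)) / \<epsilon> n"
        unfolding Q_def[abs_def] by (simp add: integral_divide integral_diff intG)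
      then have "\<sigma> * integral ?I (Q n) = (integral ?I (G (\<epsilon> n)) - integral ?I (G 0)) / \<bar>\<epsilon> n\<bar>"
        using \<epsilon>(1,3)[of n] \<sigma> by (auto simp: field_simps abs_if split: if_splits)
      then show ?thesis using minG[of "\<epsilon> n"] by simp
    qed
    then have "0 \<le> \<sigma> * integral ?I ?g"
      by (intro LIMSEQ_le_const[OF tendsto_mult[OF tendsto_const dc(2)]]) auto
    then show ?thesis using dc(1) by simp
  qed
  have "integral ?I ?g = 0" using key[of 1] key[of "-1"] by simp
  then show ?thesis using key[of 1] by (metis has_integral_integral)
qed

text \<open>If \<open>w\<close> violates contact at \<open>x0\<close>, some chord over
  \<open>w\<close> and a velocity \<open>u\<close> beyond \<open>v0\<close> passes below
  \<open>M (x0, y0, v0)\<close>. Broken lines with slopes near \<open>w\<close> and \<open>u\<close>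
  then beat \<open>y\<close> by a fixed rate on all short intervals around any point near
  \<open>x0\<close> with velocity near \<open>v0\<close>. Such points form a null set by Henstock's
  lemma, yet \<open>x0\<close> is one of them, against \<open>denjoy_clarkson\<close>.\<close>

lemma contact_everywhere:
  assumes x0: "a < x0" "x0 < b"
  shows "Ct x0 (v x0)"
proof (rule ccontr)
  define y0 v0 where "y0 = y x0" and "v0 = v x0"
  assume "\<not> ?thesis"
  then obtain w where w: "M (x0, y0, w) < M (x0, y0, v0) + p x0 * (w - v0)"
    unfolding Ct_def y0_def v0_def by (auto simp: not_le)
  \<comment> \<open>At 0 the derivative of \<phi> is \<open>- p x0 * (w - v0)\<close>, which the
    violation places below \<open>M (x0, y0, v0) - M (x0, y0, w)\<close>. So for small
    \<open>k > 0\<close> the chord from \<open>w\<close> to \<open>v0 - k * (w - v0)\<close> lies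
    below the graph at \<open>v0\<close>.\<close>
  define \<phi> where "\<phi> k = M (x0, y0, v0 - k * (w - v0))" for k
  have "((\<lambda>k. v0 - k * (w - v0)) has_real_derivative - (w - v0)) (at 0)"
    by (auto intro!: derivative_eq_intros)
  then have "(\<phi> has_real_derivative - (p x0 * (w - v0))) (at 0)"
    unfolding \<phi>_def using M_chain[of "\<lambda>_. x0" 0 0 "\<lambda>_. y0" 0 "\<lambda>k. v0 - k * (w - v0)" "- (w - v0)"] x0 p_eq[OF x0]
    by (simp add: y0_def v0_def algebra_simps)
  then have "((\<lambda>k. (\<phi> k - \<phi> 0) / k) \<longlongrightarrow> - (p x0 * (w - v0))) (at_right 0)"
    unfolding DERIV_def by (simp add: filterlim_at_split)
  moreover have "- (p x0 * (w - v0)) < M (x0, y0, v0) - M (x0, y0, w)" using w by simp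
  ultimately have "\<forall>\<^sub>F k in at_right 0. (\<phi> k - \<phi> 0) / k < M (x0, y0, v0) - M (x0, y0, w)"
    by (rule order_tendstoD(2))
  then have "\<forall>\<^sub>F k in at_right 0. 0 < k \<and> (\<phi> k - \<phi> 0) / k < M (x0, y0, v0) - M (x0, y0, w)"
    using eventually_at_right_less by eventually_elim auto
  then obtain k where k: "0 < k" "(\<phi> k - \<phi> 0) / k < M (x0, y0, v0) - M (x0, y0, w)"
    using eventually_happens trivial_limit_at_right_real by (metis (mono_tags, lifting))
  define u where "u = v0 - k * (w - v0)"
  define \<delta> where "\<delta> = (1 + k) * M (x0, y0, v0) - k * M (x0, y0, w) - M (x0, y0, u)"
  have "\<phi> k - \<phi> 0 < (M (x0, y0, v0) - M (x0, y0, w)) * k" using k by (simp add: pos_divide_less_eq)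
  then have "\<delta> > 0" by (simp add: \<delta>_def \<phi>_def u_def algebra_simps)
  \<comment> \<open>The depth of the chord below the graph at \<open>v0\<close> is \<delta> / (1 +
    k) = 4 * \<eta>. One \<eta> pays for the variation of \<open>M\<close> along the broken line,
    one for that between \<open>x0\<close> and \<open>x\<close>; more than the required margin
    \<eta> remains.\<close>
  define \<eta> where "\<eta> = \<delta> / (4 * (1 + k))"
  have "\<eta> > 0" using \<open>\<delta> > 0\<close> k by (simp add: \<eta>_def)
  have loc: "\<exists>\<rho>>0. \<forall>x z t. \<bar>x - x0\<bar> \<le> \<rho> \<longrightarrow> \<bar>z - y0\<bar> \<le> \<rho> \<longrightarrow> \<bar>t\<bar> \<le> \<rho> \<longrightarrow> \<bar>M (x, z, c + t) - M (x0, y0, c)\<bar> \<le> \<eta>" for c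
  proof -
    have "isCont M (x0, y0, c)" by (rule isCont_M[OF x0])
    then obtain s where s: "s > 0" "\<And>q. dist q (x0, y0, c) < s \<Longrightarrow> dist (M q) (M (x0, y0, c)) < \<eta>"
      using \<open>\<eta> > 0\<close> unfolding continuous_at_eps_delta by metis
    show ?thesis
    proof (intro exI[of _ "s/4"] conjI allI impI)
      fix x z t assume h: "\<bar>x - x0\<bar> \<le> s/4" "\<bar>z - y0\<bar> \<le> s/4" "\<bar>t\<bar> \<le> s/4"
      have "dist (x, z, c + t) (x0, y0, c) \<le> \<bar>x - x0\<bar> + (\<bar>z - y0\<bar> + \<bar>t\<bar>)"
        unfolding dist_Pair_Pair dist_real_def
        by (intro order_trans[OF sqrt_sum_squares_le_sum] add_mono) (auto simp: intro!: order_trans[OF sqrt_sum_squares_le_sum])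
      also have "\<dots> < s" using h s(1) by linarith
      finally show "\<bar>M (x, z, c + t) - M (x0, y0, c)\<bar> \<le> \<eta>" using s(2) by (auto simp: dist_real_def less_imp_le)
    qed (use s in auto)
  qed
  obtain \<rho>1 where \<rho>1: "\<rho>1 > 0" "\<And>x z t. \<bar>x - x0\<bar> \<le> \<rho>1 \<Longrightarrow> \<bar>z - y0\<bar> \<le> \<rho>1 \<Longrightarrow> \<bar>t\<bar> \<le> \<rho>1 \<Longrightarrow> \<bar>M (x, z, w + t) - M (x0, y0, w)\<bar> \<le> \<eta>"
    using loc[of w] by blast
  obtain \<rho>2 where \<rho>2: "\<rho>2 > 0" "\<And>x z t. \<bar>x - x0\<bar> \<le> \<rho>2 \<Longrightarrow> \<bar>z - y0\<bar> \<le> \<rho>2 \<Longrightarrow> \<bar>t\<bar> \<le> \<rho>2 \<Longrightarrow> \<bar>M (x, z, u + t) - M (x0, y0, u)\<bar> \<le> \<eta>"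
    using loc[of u] by blast
  obtain \<rho>3 where \<rho>3: "\<rho>3 > 0" "\<And>x z t. \<bar>x - x0\<bar> \<le> \<rho>3 \<Longrightarrow> \<bar>z - y0\<bar> \<le> \<rho>3 \<Longrightarrow> \<bar>t\<bar> \<le> \<rho>3 \<Longrightarrow> \<bar>M (x, z, v0 + t) - M (x0, y0, v0)\<bar> \<le> \<eta>"
    using loc[of v0] by blast
  define \<rho> where "\<rho> = Min {\<rho>1, \<rho>2, \<rho>3}"
  have \<rho>: "\<rho> > 0" "\<rho> \<le> \<rho>1" "\<rho> \<le> \<rho>2" "\<rho> \<le> \<rho>3" using \<rho>1 \<rho>2 \<rho>3 by (auto simp: \<rho>_def)
  obtain s where s: "s > 0" "\<And>x. \<bar>x - x0\<bar> < s \<Longrightarrow> \<bar>y x - y0\<bar> < \<rho>/2"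
    using isCont_y[OF x0] \<open>\<rho> > 0\<close> unfolding continuous_at_eps_delta dist_real_def y0_def
    by (metis half_gt_zero)
  define L where "L = \<bar>w\<bar> + \<bar>u\<bar> + \<rho>"
  have "L > 0" using \<rho> by (simp add: L_def add_nonneg_pos)
  define h where "h = Min {s/2, \<rho>, (x0 - a)/2, (b - x0)/2, \<rho>/(4 * L)}"
  have h: "h > 0" "h < s" "h \<le> \<rho>" "a < x0 - h" "x0 + h < b" "h \<le> \<rho>/(4 * L)"
  proof -
    show "h > 0" using s(1) \<rho>(1) x0 \<open>L > 0\<close> by (auto simp: h_def)
    have "h \<le> s/2" "h \<le> (x0 - a)/2" "h \<le> (b - x0)/2" unfolding h_def by (rule Min_le; simp)+
    then show "h < s" "a < x0 - h" "x0 + h < b" using s(1) x0 by (simp_all add: field_simps)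
    show "h \<le> \<rho>" "h \<le> \<rho>/(4 * L)" by (auto simp: h_def)
  qed
  then have hL: "L * (2 * h) \<le> \<rho>/2" using \<open>L > 0\<close> by (simp add: field_simps)
  define c d where "c = x0 - h" and "d = x0 + h"
  have yI: "\<bar>y x - y0\<bar> < \<rho>/2" if "c \<le> x" "x \<le> d" for x using that h by (intro s(2)) (auto simp: c_def d_def)
  define S where "S = {x \<in> {c..d}. \<bar>v x - v0\<bar> < \<rho>/2}"
  have "negligible S"
  proof (rule negligible_by_Henstock[of "\<lambda>x. M (x, y x, v x)" c d S \<eta>])
    show "(\<lambda>x. M (x, y x, v x)) integrable_on {c..d}"
      using integrable_M[of c d] h by (simp add: c_def d_def)
    fix x assume "x \<in> S"
    then have x: "c \<le> x" "x \<le> d" "\<bar>v x - v0\<bar> < \<rho>/2" by (auto simp: S_def)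
    have "a < x" "x < b" using x h by (auto simp: c_def d_def)
    then have "((\<lambda>t. (y t - y x) / (t - x)) \<longlongrightarrow> v x) (at x)"
      using y_deriv by (simp add: has_field_derivative_iff)
    then obtain \<gamma> where \<gamma>: "\<gamma> > 0" "\<And>t. t \<noteq> x \<Longrightarrow> \<bar>t - x\<bar> < \<gamma> \<Longrightarrow> \<bar>(y t - y x) / (t - x) - v x\<bar> < \<rho>/2"
      using \<rho>(1) unfolding LIM_eq by (metis half_gt_zero real_norm_def)
    have lin: "\<bar>y t - y x - v x * (t - x)\<bar> \<le> \<rho>/2 * \<bar>t - x\<bar>" if "\<bar>t - x\<bar> < \<gamma>" for t
    proof (cases "t = x")
      case False
      have "y t - y x - v x * (t - x) = ((y t - y x) / (t - x) - v x) * (t - x)"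
        using False by (simp add: field_simps)
      moreover have "\<bar>(y t - y x) / (t - x) - v x\<bar> * \<bar>t - x\<bar> \<le> \<rho>/2 * \<bar>t - x\<bar>"
        using \<gamma>(2)[OF False that] by (intro mult_right_mono) auto
      ultimately show ?thesis by (simp only: abs_mult)
    qed simp
    show "\<exists>\<gamma>>0. \<forall>k1 k2. c \<le> k1 \<longrightarrow> k1 < k2 \<longrightarrow> k2 \<le> d \<longrightarrow> k1 \<le> x \<longrightarrow> x \<le> k2 \<longrightarrow> k2 - k1 < \<gamma> \<longrightarrow>
        integral {k1..k2} (\<lambda>x. M (x, y x, v x)) \<le> (M (x, y x, v x) - \<eta>) * (k2 - k1)"
    proof (intro exI[of _ \<gamma>] conjI allI impI)
      fix k1 k2 assume kk: "c \<le> k1" "k1 < k2" "k2 \<le> d" "k1 \<le> x" "x \<le> k2" "k2 - k1 < \<gamma>"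
      define \<sigma> where "\<sigma> = (y k2 - y k1) / (k2 - k1)"
      have "\<bar>A - C\<bar> \<le> \<bar>A\<bar> + \<bar>C\<bar>" for A C :: real by linarith
      from this[of "y k2 - y x - v x * (k2 - x)" "y k1 - y x - v x * (k1 - x)"]
      have "\<bar>y k2 - y k1 - v x * (k2 - k1)\<bar> \<le> \<bar>y k2 - y x - v x * (k2 - x)\<bar> + \<bar>y k1 - y x - v x * (k1 - x)\<bar>"
        by (simp add: algebra_simps)
      also have "\<bar>y k2 - y x - v x * (k2 - x)\<bar> \<le> \<rho>/2 * (k2 - x)" using lin[of k2] kk by auto
      also have "\<bar>y k1 - y x - v x * (k1 - x)\<bar> \<le> \<rho>/2 * (x - k1)" using lin[of k1] kk by auto
      also have "\<rho>/2 * (k2 - x) + \<rho>/2 * (x - k1) = \<rho>/2 * (k2 - k1)" by (simp add: field_simps)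
      finally have "\<bar>y k2 - y k1 - v x * (k2 - k1)\<bar> \<le> \<rho>/2 * (k2 - k1)" by simp
      moreover have "y k2 - y k1 - v x * (k2 - k1) = (\<sigma> - v x) * (k2 - k1)" using kk by (simp add: \<sigma>_def field_simps)
      ultimately have "\<bar>\<sigma> - v x\<bar> \<le> \<rho>/2" using kk by (simp add: abs_mult)
      then have \<sigma>: "\<bar>\<sigma> - v0\<bar> \<le> \<rho>" using x(3) by linarith
      \<comment> \<open>The ratio \<open>k : 1\<close> of the two pieces makes the mean of the
        slopes \<open>w\<close> and \<open>u\<close> equal to \<open>v0\<close>. Shifting both by
        \<open>\<sigma> - v0\<close> makes it the mean slope \<sigma> of \<open>y\<close>, so the
        ends match.\<close>
      define m where "m = k1 + k / (1 + k) * (k2 - k1)"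
      have mk: "m - k1 = k / (1 + k) * (k2 - k1)" "k2 - m = 1 / (1 + k) * (k2 - k1)"
        using k(1) by (auto simp: m_def field_simps)
      have m: "k1 < m" "m < k2"
      proof -
        have "0 < k / (1 + k) * (k2 - k1)" "0 < 1 / (1 + k) * (k2 - k1)" using k(1) kk by simp_all
        then show "k1 < m" "m < k2" using mk by linarith+
      qed
      define s1 s2 where "s1 = w + (\<sigma> - v0)" and "s2 = u + (\<sigma> - v0)"
      have ends: "y k2 = y k1 + s1 * (m - k1) + s2 * (k2 - m)"
      proof -
        have "s1 * (m - k1) + s2 * (k2 - m) = (k * s1 + s2) / (1 + k) * (k2 - k1)"
          unfolding mk by (simp add: add_divide_distrib distrib_left distrib_right mult_ac)
        also have "(k * s1 + s2) / (1 + k) = \<sigma>" using k(1) by (simp add: s1_def s2_def u_def field_simps)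
        finally show ?thesis using kk by (simp add: \<sigma>_def)
      qed
      have sL: "\<bar>s1\<bar> \<le> L" "\<bar>s2\<bar> \<le> L" using \<sigma> by (auto simp: s1_def s2_def L_def)
      have len: "k2 - k1 \<le> 2 * h" using kk by (auto simp: c_def d_def)
      have dev: "\<bar>s * t\<bar> \<le> \<rho>/2" if "\<bar>s\<bar> \<le> L" "\<bar>t\<bar> \<le> k2 - k1" for s t
      proof -
        have "\<bar>s * t\<bar> \<le> L * (2 * h)" unfolding abs_mult using that len \<open>L > 0\<close> by (intro mult_mono) auto
        then show ?thesis using hL by linarith
      qed
      have b1: "M (t, y k1 + s1 * (t - k1), s1) \<le> M (x0, y0, w) + \<eta>" if "t \<in> {k1..m}" for t
      proof -
        have "\<bar>s1 * (t - k1)\<bar> \<le> \<rho>/2" "\<bar>y k1 - y0\<bar> < \<rho>/2"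
          using that m kk dev[OF sL(1), of "t - k1"] yI[of k1] by simp_all
        then have "\<bar>y k1 + s1 * (t - k1) - y0\<bar> \<le> \<rho>" by linarith
        moreover have "\<bar>t - x0\<bar> \<le> \<rho>" using that m kk h by (auto simp: c_def d_def)
        ultimately have "\<bar>M (t, y k1 + s1 * (t - k1), w + (\<sigma> - v0)) - M (x0, y0, w)\<bar> \<le> \<eta>"
          using \<sigma> \<rho> by (intro \<rho>1) auto
        then show ?thesis by (simp add: s1_def abs_le_iff)
      qed
      have b2: "M (t, y k2 + s2 * (t - k2), s2) \<le> M (x0, y0, u) + \<eta>" if "t \<in> {m..k2}" for t
      proof -
        have "\<bar>s2 * (t - k2)\<bar> \<le> \<rho>/2" "\<bar>y k2 - y0\<bar> < \<rho>/2"
          using that m kk dev[OF sL(2), of "t - k2"] yI[of k2] by simp_all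
        then have "\<bar>y k2 + s2 * (t - k2) - y0\<bar> \<le> \<rho>" by linarith
        moreover have "\<bar>t - x0\<bar> \<le> \<rho>" using that m kk h by (auto simp: c_def d_def)
        ultimately have "\<bar>M (t, y k2 + s2 * (t - k2), u + (\<sigma> - v0)) - M (x0, y0, u)\<bar> \<le> \<eta>"
          using \<sigma> \<rho> by (intro \<rho>2) auto
        then show ?thesis by (simp add: s2_def abs_le_iff)
      qed
      have dom: "a < k1" "k2 < b" using kk h by (auto simp: c_def d_def)
      have int: "(\<lambda>t. M (t, y k1 + s1 * (t - k1), s1)) integrable_on {k1..m}"
        "(\<lambda>t. M (t, y k2 + s2 * (t - k2), s2)) integrable_on {m..k2}"
        using dom m by (auto intro!: integrable_continuous_interval continuous_along[OF cont_M] continuous_intros)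
      have "integral {k1..m} (\<lambda>t. M (t, y k1 + s1 * (t - k1), s1)) \<le> integral {k1..m} (\<lambda>t. M (x0, y0, w) + \<eta>)"
        by (rule integral_le[OF int(1) integrable_const_ivl b1])
      moreover have "integral {m..k2} (\<lambda>t. M (t, y k2 + s2 * (t - k2), s2)) \<le> integral {m..k2} (\<lambda>t. M (x0, y0, u) + \<eta>)"
        by (rule integral_le[OF int(2) integrable_const_ivl b2])
      moreover note broken_line[OF dom(1) m dom(2) ends]
      ultimately have "integral {k1..k2} (\<lambda>x. M (x, y x, v x)) \<le> (m - k1) * (M (x0, y0, w) + \<eta>) + (k2 - m) * (M (x0, y0, u) + \<eta>)"
        using m by simp
      also have "\<dots> = (k * M (x0, y0, w) + M (x0, y0, u)) / (1 + k) * (k2 - k1) + \<eta> * (k2 - k1)"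
      proof -
        have "(m - k1) * (A + \<eta>) + (k2 - m) * (C + \<eta>) = (m - k1) * A + (k2 - m) * C + \<eta> * (k2 - k1)" for A C
          by (simp add: algebra_simps)
        moreover have "(m - k1) * A + (k2 - m) * C = (k * A + C) / (1 + k) * (k2 - k1)" for A C
          unfolding mk by (simp add: add_divide_distrib distrib_left distrib_right mult_ac)
        ultimately show ?thesis by simp
      qed
      also have "(k * M (x0, y0, w) + M (x0, y0, u)) / (1 + k) = M (x0, y0, v0) - 4 * \<eta>"
        using k(1) by (simp add: \<eta>_def \<delta>_def field_simps)
      also have "(M (x0, y0, v0) - 4 * \<eta>) * (k2 - k1) + \<eta> * (k2 - k1) = (M (x0, y0, v0) - 3 * \<eta>) * (k2 - k1)"
        by (simp add: algebra_simps)
      also have "\<dots> \<le> (M (x, y x, v x) - \<eta>) * (k2 - k1)"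
      proof (rule mult_right_mono)
        have "\<bar>M (x, y x, v0 + (v x - v0)) - M (x0, y0, v0)\<bar> \<le> \<eta>"
          using x yI[of x] \<rho> h by (intro \<rho>3) (auto simp: c_def d_def)
        then show "M (x0, y0, v0) - 3 * \<eta> \<le> M (x, y x, v x) - \<eta>" using \<open>\<eta> > 0\<close> by (simp add: abs_le_iff)
      qed (use kk in simp)
      finally show "integral {k1..k2} (\<lambda>x. M (x, y x, v x)) \<le> (M (x, y x, v x) - \<eta>) * (k2 - k1)" .
    qed (rule \<gamma>)
  qed (use \<open>\<eta> > 0\<close> in \<open>auto simp: S_def\<close>)
  show False
  proof (rule denjoy_clarkson[OF y_deriv])
    show "negligible {x \<in> {c..d}. \<bar>v x - v0\<bar> < \<rho>/2}" using \<open>negligible S\<close> by (simp add: S_def)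
    show "v x0 = v0" by (simp add: v0_def)
  qed (use h \<rho>(1) in \<open>auto simp: c_def d_def\<close>)
qed

end

sublocale minimal \<subseteq> contact
  by unfold_locales (rule contact_everywhere)

section \<open>Locally bounded velocities\<close>

lemma FTC_real:
  fixes f :: "real \<Rightarrow> real"
  assumes "s \<le> t" "\<And>x. s \<le> x \<Longrightarrow> x \<le> t \<Longrightarrow> (f has_real_derivative f' x) (at x)"
  shows "(f' has_integral f t - f s) {s..t}"
proof (rule fundamental_theorem_of_calculus[OF assms(1)])
  show "(f has_vector_derivative f' x) (at x within {s..t})" if "x \<in> {s..t}" for x
    using has_field_derivative_at_within[OF assms(2)[of x]] that
    by (simp add: has_real_derivative_iff_has_vector_derivative)
qed

context lagrange
begin

text \<open>First order in \<open>x\<close> and \<open>z\<close> only, uniformly for bounded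
  \<open>w\<close>: near \<open>e\<close> the velocity may oscillate and cannot be expanded about
  \<open>v e\<close>. The constant \<kappa> / (1 + C) in the proof balances the two errors
  \<open>r\<close> and \<open>C * r\<close>.\<close>

lemma M_expansion:
  assumes e: "a < e" "e < b" and "\<kappa> > 0" and "C \<ge> 0"
  obtains \<delta> where "\<delta> > 0" "\<delta> < e - a" "\<delta> < b - e" "\<And>x z w r. \<bar>x - e\<bar> \<le> r \<Longrightarrow> r < \<delta> \<Longrightarrow> \<bar>z - y e\<bar> \<le> C * r \<Longrightarrow> \<bar>w\<bar> \<le> W \<Longrightarrow>
    \<bar>M (x, z, w) - M (e, y e, w) - (x - e) * Mx (e, y e, w) - (z - y e) * My (e, y e, w)\<bar> \<le> \<kappa> * r"
proof -
  define \<eta> where "\<eta> = min (e - a) (b - e) / 2"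
  have \<eta>: "\<eta> > 0" "a < e - \<eta>" "e + \<eta> < b" using e by (auto simp: \<eta>_def min_def field_simps)
  define K where "K = {e - \<eta>..e + \<eta>} \<times> {y e - 1..y e + 1} \<times> {- W..W}"
  have K: "compact K" unfolding K_def by (intro compact_Times) auto
  have sub: "K \<subseteq> {a<..<b} \<times> UNIV" using \<eta> by (auto simp: K_def)
  define k where "k = \<kappa> / (1 + C)"
  have k: "k > 0" using assms by (simp add: k_def)
  have "uniformly_continuous_on K Mx" "uniformly_continuous_on K My"
    by (intro compact_uniformly_continuous K continuous_on_subset[OF cont_Mx sub] continuous_on_subset[OF cont_My sub])+
  then obtain s1 s2 where s1: "s1 > 0" "\<And>q q'. q \<in> K \<Longrightarrow> q' \<in> K \<Longrightarrow> dist q q' < s1 \<Longrightarrow> dist (Mx q) (Mx q') < k"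
    and s2: "s2 > 0" "\<And>q q'. q \<in> K \<Longrightarrow> q' \<in> K \<Longrightarrow> dist q q' < s2 \<Longrightarrow> dist (My q) (My q') < k"
    using k unfolding uniformly_continuous_on_def by metis
  define \<delta> where "\<delta> = min \<eta> (min (1 / (1 + C)) (min s1 s2 / (2 * (1 + C))))"
  have \<delta>: "\<delta> > 0" "\<delta> \<le> \<eta>" using \<eta> s1(1) s2(1) \<open>C \<ge> 0\<close> by (auto simp: \<delta>_def)
  have \<delta>1: "\<delta> * (1 + C) \<le> 1"
  proof -
    have "\<delta> \<le> 1 / (1 + C)" by (simp add: \<delta>_def)
    then show ?thesis using \<open>C \<ge> 0\<close> by (simp add: pos_le_divide_eq)
  qed
  have \<delta>2: "\<delta> * (1 + C) < s1" "\<delta> * (1 + C) < s2"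
  proof -
    have "\<delta> \<le> min s1 s2 / (2 * (1 + C))" by (simp add: \<delta>_def)
    then have "\<delta> * (1 + C) \<le> min s1 s2 / 2" using \<open>C \<ge> 0\<close> by (simp add: field_simps)
    then show "\<delta> * (1 + C) < s1" "\<delta> * (1 + C) < s2" using s1(1) s2(1) by (auto simp: min_def split: if_splits)
  qed
  show ?thesis
  proof (rule that[OF \<delta>(1)])
    show "\<delta> < e - a" "\<delta> < b - e" using \<delta> \<eta> by auto
    fix x z w r assume h: "\<bar>x - e\<bar> \<le> r" "r < \<delta>" "\<bar>z - y e\<bar> \<le> C * r" "\<bar>w\<bar> \<le> W"
    have r: "0 \<le> r" using h(1) by simp
    have dom: "a < x" "x < b" using h \<delta> \<eta> by auto
    obtain t where t: "0 < t" "t < 1" "M (x, z, w) - M (e, y e, w) =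
       Mx (e + t * (x - e), y e + t * (z - y e), w + t * (w - w)) * (x - e) +
       My (e + t * (x - e), y e + t * (z - y e), w + t * (w - w)) * (z - y e) +
       Mw (e + t * (x - e), y e + t * (z - y e), w + t * (w - w)) * (w - w)"
      using M_mvt[OF e dom, of z w "y e" w] by metis
    define q where "q = (e + t * (x - e), y e + t * (z - y e), w)"
    let ?q0 = "(e, y e, w)"
    have eq: "M (x, z, w) - M (e, y e, w) - (x - e) * Mx ?q0 - (z - y e) * My ?q0
      = (Mx q - Mx ?q0) * (x - e) + (My q - My ?q0) * (z - y e)"
      using t(3) by (simp add: q_def algebra_simps)
    have tx: "\<bar>t * (x - e)\<bar> \<le> r" "\<bar>t * (z - y e)\<bar> \<le> C * r"
      using t(1,2) h(1,3) mult_left_le_one_le[of "\<bar>x - e\<bar>" t] mult_left_le_one_le[of "\<bar>z - y e\<bar>" t]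
      by (auto simp: abs_mult)
    have rC: "r + C * r \<le> \<delta> * (1 + C)"
      using mult_right_mono[of r \<delta> "1 + C"] h(2) \<open>C \<ge> 0\<close> by (simp add: algebra_simps)
    then have Cr1: "C * r \<le> 1" using \<delta>1 r by linarith
    have "r \<le> \<eta>" using h(2) \<delta>(2) by simp
    then have qK: "q \<in> K" "?q0 \<in> K"
      using tx h(4) \<eta>(1) Cr1 by (auto simp: q_def K_def abs_le_iff)
    have "dist q ?q0 \<le> \<bar>t * (x - e)\<bar> + \<bar>t * (z - y e)\<bar>"
      unfolding q_def dist_Pair_Pair dist_real_def
      by (rule order_trans[OF sqrt_sum_squares_le_sum]) auto
    also have "\<dots> \<le> \<delta> * (1 + C)" using tx rC by linarith
    finally have "dist q ?q0 < s1" "dist q ?q0 < s2" using \<delta>2 by linarith+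
    then have "\<bar>Mx q - Mx ?q0\<bar> \<le> k" "\<bar>My q - My ?q0\<bar> \<le> k"
      using s1(2)[OF qK] s2(2)[OF qK] by (auto simp: dist_real_def)
    then have "\<bar>(Mx q - Mx ?q0) * (x - e)\<bar> \<le> k * r" "\<bar>(My q - My ?q0) * (z - y e)\<bar> \<le> k * (C * r)"
      unfolding abs_mult using h k by (auto intro!: mult_mono)
    then have "\<bar>(Mx q - Mx ?q0) * (x - e) + (My q - My ?q0) * (z - y e)\<bar> \<le> k * r + k * (C * r)"
      by (intro order_trans[OF abs_triangle_ineq] add_mono)
    also have "\<dots> = k * (1 + C) * r" by (simp add: algebra_simps)
    also have "k * (1 + C) = \<kappa>" using \<open>C \<ge> 0\<close> by (simp add: k_def)
    finally show "\<bar>M (x, z, w) - M (e, y e, w) - (x - e) * Mx (e, y e, w) - (z - y e) * My (e, y e, w)\<bar> \<le> \<kappa> * r"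
      unfolding eq .
  qed
qed

lemma linear_approx:
  fixes f :: "real \<Rightarrow> real"
  assumes "(f has_real_derivative f') (at e)" "\<kappa> > 0"
  obtains \<delta> where "\<delta> > 0" "\<And>x. \<bar>x - e\<bar> < \<delta> \<Longrightarrow> \<bar>f x - f e - f' * (x - e)\<bar> \<le> \<kappa> * \<bar>x - e\<bar>"
proof -
  have "((\<lambda>x. (f x - f e) / (x - e)) \<longlongrightarrow> f') (at e)" using assms(1) by (simp add: has_field_derivative_iff)
  then obtain \<delta> where \<delta>: "\<delta> > 0" "\<And>x. x \<noteq> e \<Longrightarrow> \<bar>x - e\<bar> < \<delta> \<Longrightarrow> \<bar>(f x - f e) / (x - e) - f'\<bar> < \<kappa>"
    using assms(2) unfolding LIM_eq real_norm_def by metis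
  have "\<bar>f x - f e - f' * (x - e)\<bar> \<le> \<kappa> * \<bar>x - e\<bar>" if "\<bar>x - e\<bar> < \<delta>" for x
  proof (cases "x = e")
    case False
    then have "f x - f e - f' * (x - e) = ((f x - f e) / (x - e) - f') * (x - e)" by (simp add: field_simps)
    moreover have "\<bar>(f x - f e) / (x - e) - f'\<bar> * \<bar>x - e\<bar> \<le> \<kappa> * \<bar>x - e\<bar>"
      using \<delta>(2)[OF False that] by (intro mult_right_mono) auto
    ultimately show ?thesis by (simp only: abs_mult)
  qed simp
  then show ?thesis using that \<delta>(1) by blast
qed

end

context minimal
begin

text \<open>One-sidedness gives \<bar>v x - v e\<bar> \<le> \<tau> * (v x - v e) + 2 * c, and the
  right side can be integrated through \<open>y\<close>. So \<open>v\<close> is close to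
  \<open>v e\<close> in the mean, which suffices to replace \<open>My\<close> by its value at
  \<open>e\<close> in the first variation.\<close>

lemma defect_zero_one_sided:
  assumes e: "a < e" "e < b" and \<tau>: "\<tau> = 1 \<or> \<tau> = - 1"
    and bd: "\<delta>0 > 0" "\<And>x. \<bar>x - e\<bar> < \<delta>0 \<Longrightarrow> a < x \<and> x < b \<and> \<bar>v x\<bar> \<le> B"
    and one: "\<And>c. c > 0 \<Longrightarrow> \<exists>\<delta>>0. \<forall>x. \<bar>x - e\<bar> < \<delta> \<longrightarrow> - c \<le> \<tau> * (v x - v e)"
  shows "d e = 0"
proof (rule ccontr)
  assume "d e \<noteq> 0"
  define D \<sigma> where "D = \<bar>d e\<bar>" and "\<sigma> = sgn (d e)"
  have D: "D > 0" "\<sigma> * d e = D" "\<bar>\<sigma>\<bar> = 1" using \<open>d e \<noteq> 0\<close> by (auto simp: D_def \<sigma>_def sgn_if)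
  define h0 where "h0 = My (e, y e, v e)"
  \<comment> \<open>With this \<kappa> and 6 * C * c \<le> D/2, the final balance
    \<open>(16/15) * (D - \<kappa>) - 6 * C * c - 8 * \<kappa>\<close> is still positive.\<close>
  define \<kappa> where "\<kappa> = D/20"
  have "\<kappa> > 0" using D by (simp add: \<kappa>_def)
  obtain s where s: "s > 0" "\<And>q. dist q (e, y e, v e) < s \<Longrightarrow> dist (My q) h0 < \<kappa>"
    using isCont_parts(2)[OF e, of "(y e, v e)"] \<open>\<kappa> > 0\<close> unfolding continuous_at_eps_delta h0_def by metis
  obtain \<delta>1 where \<delta>1: "\<delta>1 > 0" "\<And>x. \<bar>x - e\<bar> < \<delta>1 \<Longrightarrow> \<bar>y x - y e\<bar> < s/3"
    using isCont_y[OF e] s(1) unfolding continuous_at_eps_delta dist_real_def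
    by (metis zero_less_divide_iff zero_less_numeral)
  define \<delta>2 where "\<delta>2 = Min {\<delta>0/2, \<delta>1, s/3}"
  have \<delta>2: "\<delta>2 > 0" "\<delta>2 \<le> \<delta>0/2" "\<delta>2 \<le> \<delta>1" "\<delta>2 \<le> s/3"
    unfolding \<delta>2_def using bd(1) \<delta>1(1) s(1) by auto
  have "a < e - \<delta>2" "e + \<delta>2 < b" using bd(2)[of "e - \<delta>2"] bd(2)[of "e + \<delta>2"] \<delta>2 bd(1) by auto
  then obtain Bd where Bd: "\<And>x z w. e - \<delta>2 \<le> x \<Longrightarrow> x \<le> e + \<delta>2 \<Longrightarrow> \<bar>z\<bar> \<le> \<bar>y e\<bar> + s \<Longrightarrow> \<bar>w\<bar> \<le> B \<Longrightarrow> \<bar>My (x, z, w)\<bar> \<le> Bd"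
    using bounded_on_box[OF cont_My] by metis
  have Bd0: "0 \<le> Bd" "\<bar>h0\<bar> \<le> Bd"
    using Bd[of e "y e" "v e"] bd(2)[of e] bd(1) \<delta>2(1) s(1) by (auto simp: h0_def)
  \<comment> \<open>Where \<open>v\<close> is at least \<open>s/3\<close> away from
    \<open>v e\<close>, the crude bound \<open>2 * Bd\<close> on the change of \<open>My\<close>
    equals \<open>C * (s/3)\<close> and is absorbed in the linear term.\<close>
  define C where "C = 6 * Bd / s"
  have "C \<ge> 0" using Bd0 s by (simp add: C_def)
  have My_near: "\<bar>My (x, y x, v x) - h0\<bar> \<le> \<kappa> + C * \<bar>v x - v e\<bar>" if x: "\<bar>x - e\<bar> < \<delta>2" for x
  proof (cases "\<bar>v x - v e\<bar> < s/3")
    case True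
    have "dist (x, y x, v x) (e, y e, v e) \<le> \<bar>x - e\<bar> + (\<bar>y x - y e\<bar> + \<bar>v x - v e\<bar>)"
      unfolding dist_Pair_Pair dist_real_def
      by (intro order_trans[OF sqrt_sum_squares_le_sum] add_mono) (auto simp: intro!: order_trans[OF sqrt_sum_squares_le_sum])
    also have "\<dots> < s" using True x \<delta>2 \<delta>1(2)[of x] by linarith
    finally have "\<bar>My (x, y x, v x) - h0\<bar> < \<kappa>" using s(2) by (simp add: dist_real_def)
    moreover have "0 \<le> C * \<bar>v x - v e\<bar>" using \<open>C \<ge> 0\<close> by simp
    ultimately show ?thesis by linarith
  next
    case False
    have "\<bar>y x - y e\<bar> < s/3" "\<bar>v x\<bar> \<le> B" using x \<delta>2 \<delta>1(2)[of x] bd(2)[of x] bd(1) by auto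
    moreover from this have "\<bar>y x\<bar> \<le> \<bar>y e\<bar> + s" using s(1) by linarith
    ultimately have "\<bar>My (x, y x, v x)\<bar> \<le> Bd" using x by (intro Bd) auto
    then have "\<bar>My (x, y x, v x) - h0\<bar> \<le> 2 * Bd" using Bd0 by linarith
    also have "2 * Bd = C * (s/3)" using s(1) by (simp add: C_def)
    also have "\<dots> \<le> C * \<bar>v x - v e\<bar>" using False \<open>C \<ge> 0\<close> by (intro mult_left_mono) auto
    finally show ?thesis using \<open>\<kappa> > 0\<close> by linarith
  qed
  define c where "c = D / (12 * (C + 1))"
  have c: "c > 0" "6 * C * c \<le> D/2"
    using D \<open>C \<ge> 0\<close> by (simp_all add: c_def field_simps)
  obtain \<delta>3 where \<delta>3: "\<delta>3 > 0" "\<And>x. \<bar>x - e\<bar> < \<delta>3 \<Longrightarrow> - c \<le> \<tau> * (v x - v e)" using one[OF c(1)] by blast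
  obtain \<delta>4 where \<delta>4: "\<delta>4 > 0" "\<And>x. \<bar>x - e\<bar> < \<delta>4 \<Longrightarrow> \<bar>p x - p e - p' e * (x - e)\<bar> \<le> \<kappa> * \<bar>x - e\<bar>"
    using linear_approx[OF p_deriv[OF e] \<open>\<kappa> > 0\<close>] by metis
  obtain \<delta>5 where \<delta>5: "\<delta>5 > 0" "\<And>x. \<bar>x - e\<bar> < \<delta>5 \<Longrightarrow> \<bar>y x - y e - v e * (x - e)\<bar> \<le> c * \<bar>x - e\<bar>"
    using linear_approx[OF y_deriv[OF e] c(1)] by metis
  define r where "r = Min {\<delta>2, \<delta>3, \<delta>4, \<delta>5} / 2"
  have r: "r > 0" "r < \<delta>2" "r < \<delta>3" "r < \<delta>4" "r < \<delta>5"
  proof -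
    have m: "Min {\<delta>2, \<delta>3, \<delta>4, \<delta>5} > 0" using \<delta>2(1) \<delta>3(1) \<delta>4(1) \<delta>5(1) by simp
    then show "r > 0" by (simp add: r_def)
    have "r < Min {\<delta>2, \<delta>3, \<delta>4, \<delta>5}" using m unfolding r_def by linarith
    then show "r < \<delta>2" "r < \<delta>3" "r < \<delta>4" "r < \<delta>5" by simp_all
  qed
  have near: "\<bar>x - e\<bar> \<le> r" if "x \<in> {e - r..e + r}" for x using that by (auto simp: abs_le_iff)
  define \<zeta> where "\<zeta> x = (r\<^sup>2 - (x - e)\<^sup>2)\<^sup>2" for x
  define \<zeta>' where "\<zeta>' x = - 4 * (x - e) * (r\<^sup>2 - (x - e)\<^sup>2)" for x
  have dom: "a < e - r" "e + r < b" using \<open>a < e - \<delta>2\<close> \<open>e + \<delta>2 < b\<close> r by auto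
  have vB: "\<bar>v x\<bar> \<le> B" if "e - r \<le> x" "x \<le> e + r" for x using bd(2)[of x] that r \<delta>2 bd(1) by auto
  have FV: "((\<lambda>x. \<sigma> * (My (x, y x, v x) * \<zeta> x + p x * \<zeta>' x)) has_integral \<sigma> * 0) {e - r..e + r}"
    unfolding \<zeta>_def \<zeta>'_def using first_variation[OF r(1) dom vB] by (intro has_integral_mult_right) simp
  \<comment> \<open>A primitive of the minorant \<phi>, in which \<open>My\<close> is replaced by
    \<open>h0\<close> and \<open>p\<close> by its linearisation at \<open>e\<close>, minus the
    errors. The fifth-degree polynomial is the primitive of \<zeta> that vanishes at
    \<open>e\<close>.\<close>
  define \<Phi> where "\<Phi> x = (\<sigma> * h0 - \<kappa>) * (r^4 * (x - e) - 2 * r^2 * (x - e)^3 / 3 + (x - e)^5 / 5)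
     - C * r^4 * (\<tau> * (y x - v e * x) + 2 * c * x)
     + \<sigma> * ((p e + p' e * (x - e)) * \<zeta> x - p' e * (r^4 * (x - e) - 2 * r^2 * (x - e)^3 / 3 + (x - e)^5 / 5))
     - 4 * \<kappa> * r^4 * x" for x
  define \<phi> where "\<phi> x = (\<sigma> * h0 - \<kappa>) * \<zeta> x - C * r^4 * (\<tau> * (v x - v e) + 2 * c)
     + \<sigma> * ((p e + p' e * (x - e)) * \<zeta>' x) - 4 * \<kappa> * r^4" for x
  have d\<zeta>: "(\<zeta> has_real_derivative \<zeta>' x) (at x)" for x
    unfolding \<zeta>_def \<zeta>'_def by (auto intro!: derivative_eq_intros)
  have dZ: "((\<lambda>x. r^4 * (x - e) - 2 * r^2 * (x - e)^3 / 3 + (x - e)^5 / 5) has_real_derivative \<zeta> x) (at x)" for x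
  proof -
    have "((\<lambda>t. r^4 * t - 2 * r^2 * t^3 / 3 + t^5 / 5) has_real_derivative (r\<^sup>2 - t\<^sup>2)\<^sup>2) (at t)" for t
      by (auto intro!: derivative_eq_intros simp: power2_eq_square power4_eq_xxxx power3_eq_cube algebra_simps)
    moreover have "((\<lambda>x. x - e) has_real_derivative 1) (at x)" by (auto intro!: derivative_eq_intros)
    ultimately show ?thesis using DERIV_chain2[of _ _ "\<lambda>x. x - e"] by (fastforce simp: \<zeta>_def)
  qed
  have int\<phi>: "(\<phi> has_integral \<Phi> (e + r) - \<Phi> (e - r)) {e - r..e + r}"
  proof (rule FTC_real)
    fix x assume "e - r \<le> x" "x \<le> e + r"
    then have "(y has_real_derivative v x) (at x)" using dom by (intro y_deriv) auto
    then have "(\<Phi> has_real_derivative (\<sigma> * h0 - \<kappa>) * \<zeta> x - C * r^4 * (\<tau> * (v x - v e * 1) + 2 * c * 1)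
     + \<sigma> * ((p' e * 1) * \<zeta> x + (p e + p' e * (x - e)) * \<zeta>' x - p' e * \<zeta> x) - 4 * \<kappa> * r^4 * 1) (at x)"
      unfolding \<Phi>_def[abs_def]
      by (intro DERIV_add DERIV_diff DERIV_cmult dZ) (auto intro!: derivative_eq_intros d\<zeta>)
    then show "(\<Phi> has_real_derivative \<phi> x) (at x)" unfolding \<phi>_def by (simp add: algebra_simps)
  qed (use r in simp)
  have le: "\<phi> x \<le> \<sigma> * (My (x, y x, v x) * \<zeta> x + p x * \<zeta>' x)" if x: "x \<in> {e - r..e + r}" for x
  proof -
    have xr: "\<bar>x - e\<bar> \<le> r" by (rule near[OF x])
    have "(x - e)\<^sup>2 \<le> r\<^sup>2" using power_mono[OF xr, of 2] by simp
    then have rr: "0 \<le> r\<^sup>2 - (x - e)\<^sup>2" "r\<^sup>2 - (x - e)\<^sup>2 \<le> r\<^sup>2" by auto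
    have \<zeta>b: "0 \<le> \<zeta> x" "\<zeta> x \<le> r^4"
      using power_mono[OF rr(2,1), of 2] by (auto simp: \<zeta>_def)
    have "\<bar>\<zeta>' x\<bar> \<le> 4 * r * r\<^sup>2"
      unfolding \<zeta>'_def abs_mult using xr rr r(1) by (intro mult_mono) auto
    then have \<zeta>'b: "\<bar>\<zeta>' x\<bar> \<le> 4 * r^3" by (simp add: power2_eq_square power3_eq_cube)
    have absv: "\<bar>v x - v e\<bar> \<le> \<tau> * (v x - v e) + 2 * c"
      using \<delta>3(2)[of x] xr r \<tau> c(1) by auto
    have "\<bar>\<sigma> * (My (x, y x, v x) - h0) * \<zeta> x\<bar> \<le> (\<kappa> + C * \<bar>v x - v e\<bar>) * \<zeta> x"
      unfolding abs_mult D(3) using My_near[of x] xr r \<zeta>b by (auto intro!: mult_right_mono)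
    also have "\<dots> = \<kappa> * \<zeta> x + C * \<bar>v x - v e\<bar> * \<zeta> x" by (simp add: algebra_simps)
    also have "C * \<bar>v x - v e\<bar> * \<zeta> x \<le> C * (\<tau> * (v x - v e) + 2 * c) * r^4"
      using absv \<zeta>b \<open>C \<ge> 0\<close> by (intro mult_mono mult_nonneg_nonneg) auto
    finally have 1: "\<bar>\<sigma> * (My (x, y x, v x) - h0) * \<zeta> x\<bar> \<le> \<kappa> * \<zeta> x + C * (\<tau> * (v x - v e) + 2 * c) * r^4" by simp
    have "\<bar>p x - p e - p' e * (x - e)\<bar> \<le> \<kappa> * r"
      using \<delta>4(2)[of x] xr r \<open>\<kappa> > 0\<close> by (meson le_less_trans less_imp_le mult_left_mono order_trans)
    then have "\<bar>\<sigma> * (p x - p e - p' e * (x - e)) * \<zeta>' x\<bar> \<le> (\<kappa> * r) * (4 * r^3)"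
      unfolding abs_mult D(3) using \<zeta>'b \<open>\<kappa> > 0\<close> r(1) by (auto intro!: mult_mono)
    also have "\<dots> = 4 * \<kappa> * r^4" by (simp add: power3_eq_cube power4_eq_xxxx)
    finally have 2: "\<bar>\<sigma> * (p x - p e - p' e * (x - e)) * \<zeta>' x\<bar> \<le> 4 * \<kappa> * r^4" .
    have "\<sigma> * (My (x, y x, v x) * \<zeta> x + p x * \<zeta>' x) - \<phi> x
      = (\<sigma> * (My (x, y x, v x) - h0) * \<zeta> x + (\<kappa> * \<zeta> x + C * (\<tau> * (v x - v e) + 2 * c) * r^4))
        + (\<sigma> * (p x - p e - p' e * (x - e)) * \<zeta>' x + 4 * \<kappa> * r^4)"
      unfolding \<phi>_def by (simp add: algebra_simps)
    then show ?thesis using 1 2 by (simp add: abs_le_iff)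
  qed
  have "\<Phi> (e + r) - \<Phi> (e - r) \<le> \<sigma> * 0" by (rule has_integral_le[OF int\<phi> FV le])
  \<comment> \<open>The integral of \<zeta> is 16/15 * r^5. Integrated against \<zeta>', the linear
    part of \<open>p\<close> yields \<open>- p' e\<close> times it, which together with
    \<open>h0\<close> makes up the defect.\<close>
  moreover have "\<Phi> (e + r) - \<Phi> (e - r) = (16/15) * (D - \<kappa>) * r^5
     - C * r^4 * (\<tau> * (y (e + r) - y (e - r) - 2 * r * v e) + 4 * c * r) - 8 * \<kappa> * r^5"
  proof -
    have \<zeta>0: "\<zeta> (e + r) = 0" "\<zeta> (e - r) = 0" by (simp_all add: \<zeta>_def)
    have r5: "r^5 = r^4 * r" by (simp add: eval_nat_numeral)
    have Z: "r^4 * (e + r - e) - 2 * r^2 * (e + r - e)^3 / 3 + (e + r - e)^5 / 5 = 8/15 * (r^4 * r)"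
      "r^4 * (e - r - e) - 2 * r^2 * (e - r - e)^3 / 3 + (e - r - e)^5 / 5 = - (8/15 * (r^4 * r))"
      by (simp_all add: eval_nat_numeral field_simps)
    have h0: "\<sigma> * h0 = D + \<sigma> * p' e" using D(2) by (simp add: d_def h0_def algebra_simps)
    define R where "R = r^4"
    show ?thesis unfolding \<Phi>_def \<zeta>0 Z r5 h0 unfolding R_def[symmetric] by (simp add: field_simps)
  qed
  moreover have "\<tau> * (y (e + r) - y (e - r) - 2 * r * v e) \<le> 2 * c * r"
  proof -
    have "\<bar>y (e + r) - y e - v e * r\<bar> \<le> c * r" "\<bar>y (e - r) - y e + v e * r\<bar> \<le> c * r"
      using \<delta>5(2)[of "e + r"] \<delta>5(2)[of "e - r"] r by auto
    then have "\<bar>y (e + r) - y (e - r) - 2 * r * v e\<bar> \<le> 2 * c * r" by (simp add: abs_le_iff algebra_simps)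
    then show ?thesis using \<tau> by auto
  qed
  then have "C * r^4 * (\<tau> * (y (e + r) - y (e - r) - 2 * r * v e) + 4 * c * r) \<le> C * r^4 * (6 * c * r)"
    using \<open>C \<ge> 0\<close> by (intro mult_left_mono) auto
  ultimately have "(16/15) * (D - \<kappa>) * r^5 - C * r^4 * (6 * c * r) - 8 * \<kappa> * r^5 \<le> 0" by linarith
  also have "C * r^4 * (6 * c * r) = (6 * C * c) * r^5" by (simp add: eval_nat_numeral)
  finally have "((16/15) * (D - \<kappa>) - 6 * C * c - 8 * \<kappa>) * r^5 \<le> 0" by (simp add: algebra_simps)
  then have "(16/15) * (D - \<kappa>) - 6 * C * c - 8 * \<kappa> \<le> 0" using r(1) by (simp add: mult_le_0_iff)
  then show False using c(2) D(1) by (simp add: \<kappa>_def)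
qed

text \<open>If \<open>v\<close> oscillates around \<open>v e\<close>, then the velocities near \<open>v e\<close> are all contact values at \<open>e\<close>. To first
  order, \<open>M\<close> exceeds a null Lagrangian \<open>\<Psi>\<close> by at least zero along \<open>y\<close>, and by \<open>(My - p' e) \<zeta>\<close> along a curve
  at distance \<open>\<zeta>\<close> from the tangent line whose velocities are contact values; so a small tent on the
  appropriate side of the tangent line beats \<open>y\<close> if \<open>d e \<noteq> 0\<close>.\<close>

lemma defect_zero_two_sided:
  assumes e: "a < e" "e < b"
    and bd: "\<delta>0 > 0" "\<And>x. \<bar>x - e\<bar> < \<delta>0 \<Longrightarrow> a < x \<and> x < b \<and> \<bar>v x\<bar> \<le> B"
    and w12: "c0 > 0" "\<And>w. \<bar>w - v e\<bar> \<le> c0 \<Longrightarrow> Ct e w"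
  shows "d e = 0"
proof (rule ccontr)
  assume "d e \<noteq> 0"
  define D \<sigma> where "D = \<bar>d e\<bar>" and "\<sigma> = sgn (d e)"
  have D: "D > 0" "d e = \<sigma> * D" "\<sigma> = 1 \<or> \<sigma> = - 1" "\<bar>\<sigma>\<bar> = 1" using \<open>d e \<noteq> 0\<close> by (auto simp: D_def \<sigma>_def sgn_if)
  define ye ve pe qe where "ye = y e" and "ve = v e" and "pe = p e" and "qe = p' e"
  define h where "h w = My (e, ye, w)" for w
  define W where "W = \<bar>ve\<bar> + B + c0 + 1"
  have ve_B: "\<bar>ve\<bar> \<le> B" using bd(2)[of e] bd(1) by (simp add: ve_def)
  obtain Bh where Bh: "\<And>w. \<bar>w\<bar> \<le> W \<Longrightarrow> \<bar>h w\<bar> \<le> Bh"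
    using bounded_on_box[OF cont_My e, of "\<bar>ye\<bar>" W] unfolding h_def by (metis order_refl)
  define H where "H = Bh + \<bar>qe\<bar>"
  have hH: "\<bar>h w - qe\<bar> \<le> H" if "\<bar>w\<bar> \<le> W" for w using Bh[OF that] unfolding H_def by linarith
  have "H \<ge> 0" using hH[of ve] w12(1) ve_B by (force simp: W_def)
  obtain c1 where c1: "c1 > 0" "\<And>w. \<bar>w - ve\<bar> < c1 \<Longrightarrow> \<bar>h w - h ve\<bar> < D/2"
  proof -
    have "isCont h ve" unfolding h_def
      using isCont_o2[of ve "\<lambda>w. (e, ye, w)" My] isCont_parts(2)[OF e] by (simp add: isCont_Pair)
    then show ?thesis using that D(1) unfolding continuous_at_eps_delta dist_real_def by (metis half_gt_zero)
  qed
  \<comment> \<open>The tent has slopes within \<open>c + \<kappa> \<le> 2 * c\<close> of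
    \<open>ve\<close>: they remain contact values, and \<open>h\<close> changes by less than
    \<open>D/2\<close> between them and \<open>ve\<close>.\<close>
  define c where "c = min (min c0 c1) 1 / 4"
  have c: "c > 0" "2 * c < c0" "2 * c < c1" "c < 1/2" using w12(1) c1(1) by (auto simp: c_def)
  \<comment> \<open>Over an interval of length \<open>2 * r\<close>, the pointwise losses in
    \<open>lower\<close> and \<open>upper\<close> add up to
    \<open>\<kappa> * (2 * H + 6 + 4 * D) * r^2\<close>. This is at most half of the gain
    \<open>(D/2) * c * r^2\<close> of the tent.\<close>
  define \<kappa> where "\<kappa> = min c (D * c / (4 * (2 * H + 6 + 4 * D)))"
  have \<kappa>: "\<kappa> > 0" "\<kappa> \<le> c" "\<kappa> * (2 * H + 6 + 4 * D) \<le> D * c / 4"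
  proof -
    have pos: "2 * H + 6 + 4 * D > 0" using \<open>H \<ge> 0\<close> D(1) by simp
    then show "\<kappa> > 0" using c D(1) by (simp add: \<kappa>_def)
    show "\<kappa> \<le> c" by (simp add: \<kappa>_def)
    have "\<kappa> \<le> D * c / (4 * (2 * H + 6 + 4 * D))" by (simp add: \<kappa>_def)
    then show "\<kappa> * (2 * H + 6 + 4 * D) \<le> D * c / 4" using pos by (simp add: field_simps)
  qed
  \<comment> \<open>The common slope of the lemma \<open>tau\<close>, here as a function of the
    velocity: it takes the same value at all contact values at \<open>e\<close>.\<close>
  define \<tau> where "\<tau> w = Mx (e, ye, w) + h w * ve - qe * w" for w
  have tau_ct: "\<tau> w = \<tau> ve" if "Ct e w" for w
    using tau[OF e that] by (simp add: \<tau>_def h_def ye_def ve_def qe_def)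
  have M_ct: "M (e, ye, w) = M (e, ye, ve) + pe * (w - ve)" if "Ct e w" for w
  proof -
    have "M (e, ye, w) + pe * (ve - w) \<le> M (e, ye, ve)" using that unfolding Ct_def ye_def pe_def by blast
    moreover have "M (e, ye, ve) + pe * (w - ve) \<le> M (e, ye, w)"
      using contact[OF e] unfolding Ct_def ye_def pe_def ve_def by blast
    ultimately show ?thesis by (simp add: algebra_simps)
  qed
  \<comment> \<open>As \<open>x\<close> tends to \<open>e\<close>, the bounded velocities
    \<open>v x\<close> accumulate only at contact values at \<open>e\<close>, where \<tau> equals
    \<open>\<tau> ve\<close>.\<close>
  have tau_near: "\<exists>\<delta>>0. \<forall>x. \<bar>x - e\<bar> < \<delta> \<longrightarrow> \<bar>\<tau> (v x) - \<tau> ve\<bar> \<le> \<kappa>"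
  proof (rule ccontr)
    assume neg: "\<not> ?thesis"
    have "\<exists>x. \<bar>x - e\<bar> < min \<delta>0 (inverse (real (Suc n))) \<and> \<kappa> < \<bar>\<tau> (v x) - \<tau> ve\<bar>" for n
    proof (rule ccontr)
      assume "\<not> ?thesis"
      then have "\<forall>x. \<bar>x - e\<bar> < min \<delta>0 (inverse (real (Suc n))) \<longrightarrow> \<bar>\<tau> (v x) - \<tau> ve\<bar> \<le> \<kappa>" by force
      moreover have "0 < min \<delta>0 (inverse (real (Suc n)))" using bd(1) by simp
      ultimately show False using neg by blast
    qed
    then obtain X where X: "\<And>n. \<bar>X n - e\<bar> < min \<delta>0 (inverse (real (Suc n)))" "\<And>n. \<kappa> < \<bar>\<tau> (v (X n)) - \<tau> ve\<bar>"
      by metis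
    have dX: "a < X n" "X n < b" "v (X n) \<in> {-B..B}" for n
      using bd(2)[of "X n"] X(1)[of n] by (auto simp: abs_le_iff)
    have Xe: "X \<longlonglongrightarrow> e"
      by (rule LIM_zero_cancel, rule Lim_null_comparison[OF _ LIMSEQ_inverse_real_of_nat],
        use X(1) in \<open>simp add: less_imp_le\<close>)
    have "compact {-B..B}" by simp
    then obtain u r where r: "strict_mono (r :: nat \<Rightarrow> nat)" "((\<lambda>n. v (X n)) \<circ> r) \<longlonglongrightarrow> u"
      using compact_imp_seq_compact[of "{-B..B}"] dX(3) by (auto elim!: seq_compactE)
    have sub: "(\<lambda>n. X (r n)) \<longlonglongrightarrow> e" using LIMSEQ_subseq_LIMSEQ[OF Xe r(1)] by (simp add: o_def)
    have "Ct e u" using Ct_closed[OF e sub, of "\<lambda>n. v (X (r n))" u] r(2) contact dX by (simp add: o_def)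
    moreover have lim: "(\<lambda>n. \<tau> (v (X (r n)))) \<longlonglongrightarrow> \<tau> u" unfolding \<tau>_def h_def
      using r(2) by (intro tendsto_intros seq_lims e) (auto simp: o_def)
    have "\<kappa> \<le> \<bar>\<tau> u - \<tau> ve\<bar>"
      by (rule LIMSEQ_le_const[OF tendsto_rabs[OF tendsto_diff[OF lim tendsto_const]]]) (use X(2) in \<open>auto intro: less_imp_le\<close>)
    ultimately show False using tau_ct \<kappa>(1) by simp
  qed
  then obtain \<delta>1 where \<delta>1: "\<delta>1 > 0" "\<And>x. \<bar>x - e\<bar> < \<delta>1 \<Longrightarrow> \<bar>\<tau> (v x) - \<tau> ve\<bar> \<le> \<kappa>" by blast
  obtain \<delta>2 where \<delta>2: "\<delta>2 > 0" "\<delta>2 < e - a" "\<delta>2 < b - e" "\<And>x z w r. \<bar>x - e\<bar> \<le> r \<Longrightarrow> r < \<delta>2 \<Longrightarrow> \<bar>z - y e\<bar> \<le> (\<bar>ve\<bar> + 1) * r \<Longrightarrow> \<bar>w\<bar> \<le> W \<Longrightarrow>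
    \<bar>M (x, z, w) - M (e, y e, w) - (x - e) * Mx (e, y e, w) - (z - y e) * My (e, y e, w)\<bar> \<le> \<kappa> * r"
    using M_expansion[OF e \<kappa>(1), of "\<bar>ve\<bar> + 1" W] by (metis abs_ge_zero add_nonneg_nonneg zero_le_one)
  obtain \<delta>3 where \<delta>3: "\<delta>3 > 0" "\<And>x. \<bar>x - e\<bar> < \<delta>3 \<Longrightarrow> \<bar>y x - y e - v e * (x - e)\<bar> \<le> \<kappa> * \<bar>x - e\<bar>"
    using linear_approx[OF y_deriv[OF e] \<kappa>(1)] by metis
  define r where "r = Min {\<delta>0, \<delta>1, \<delta>2, \<delta>3} / 2"
  have r: "r > 0" "r < \<delta>0" "r < \<delta>1" "r < \<delta>2" "r < \<delta>3"
  proof -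
    have m: "Min {\<delta>0, \<delta>1, \<delta>2, \<delta>3} > 0" using bd(1) \<delta>1(1) \<delta>2(1) \<delta>3(1) by simp
    then show "r > 0" by (simp add: r_def)
    have "r < Min {\<delta>0, \<delta>1, \<delta>2, \<delta>3}" using m unfolding r_def by linarith
    then show "r < \<delta>0" "r < \<delta>1" "r < \<delta>2" "r < \<delta>3" by simp_all
  qed
  have dom: "a < e - r" "e + r < b" using r \<delta>2 by auto
  define \<Delta> where "\<Delta> x z = z - ye - ve * (x - e)" for x z
  define N where "N x z w = M (e, ye, ve) + pe * (w - ve) + (x - e) * (\<tau> ve + qe * w) + qe * \<Delta> x z" for x z w
  \<comment> \<open>\<open>N x z w\<close> is the derivative of \<Psi> in \<open>x\<close> plus
    \<open>w\<close> times its derivative in \<open>z\<close>. Hence the integral of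
    \<open>N\<close> along a curve depends only on its end points and cancels in the
    comparison.\<close>
  define \<Psi> where "\<Psi> x z = M (e, ye, ve) * x + pe * (z - ve * x) + (\<tau> ve - qe * ve) * ((x - e)^2 / 2) + qe * ((x - e) * (z - ye))" for x z
  have d\<Psi>: "((\<lambda>x. \<Psi> x (f x)) has_real_derivative N x (f x) f') (at x)"
    if "(f has_real_derivative f') (at x)" for f f' x
    unfolding \<Psi>_def N_def \<Delta>_def using that
    by (auto intro!: derivative_eq_intros simp: field_simps)
  have expand: "\<bar>M (x, z, w) - (M (e, ye, w) + (x - e) * (\<tau> w + qe * w) + \<Delta> x z * h w)\<bar> \<le> \<kappa> * r"
    if "\<bar>x - e\<bar> \<le> r" "\<bar>\<Delta> x z\<bar> \<le> r" "\<bar>w\<bar> \<le> W" for x z w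
  proof -
    have "\<bar>ve * (x - e)\<bar> \<le> \<bar>ve\<bar> * r" unfolding abs_mult using that by (intro mult_left_mono) auto
    then have "\<bar>z - ye\<bar> \<le> (\<bar>ve\<bar> + 1) * r" using that(2) unfolding \<Delta>_def by (simp add: algebra_simps abs_le_iff)
    then have "\<bar>M (x, z, w) - M (e, ye, w) - (x - e) * Mx (e, ye, w) - (z - ye) * h w\<bar> \<le> \<kappa> * r"
      using \<delta>2(4)[OF that(1) r(4) _ that(3), of z] unfolding ye_def h_def by blast
    moreover have "(x - e) * Mx (e, ye, w) + (z - ye) * h w = (x - e) * (\<tau> w + qe * w) + \<Delta> x z * h w"
      unfolding \<tau>_def \<Delta>_def by (simp add: algebra_simps)
    ultimately show ?thesis by (simp add: algebra_simps)
  qed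
  have lower: "N x (y x) (v x) - \<kappa> * (H + 2) * r \<le> M (x, y x, v x)" if x: "x \<in> {e - r..e + r}" for x
  proof -
    have xr: "\<bar>x - e\<bar> \<le> r" using x by (auto simp: abs_le_iff)
    have "\<bar>\<Delta> x (y x)\<bar> \<le> \<kappa> * \<bar>x - e\<bar>" using \<delta>3(2)[of x] xr r unfolding \<Delta>_def ye_def ve_def by auto
    also have "\<dots> \<le> \<kappa> * r" using xr \<kappa>(1) by (intro mult_left_mono) auto
    finally have \<Delta>: "\<bar>\<Delta> x (y x)\<bar> \<le> \<kappa> * r" .
    also have "\<dots> \<le> 1 * r" using \<kappa> c r(1) by (intro mult_right_mono) auto
    finally have \<Delta>1: "\<bar>\<Delta> x (y x)\<bar> \<le> r" by simp
    have vW: "\<bar>v x\<bar> \<le> W" using bd(2)[of x] xr r w12(1) by (auto simp: W_def)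
    have 1: "M (e, ye, v x) + (x - e) * (\<tau> (v x) + qe * v x) + \<Delta> x (y x) * h (v x) - \<kappa> * r \<le> M (x, y x, v x)"
      using expand[OF xr \<Delta>1 vW] by (simp add: abs_le_iff)
    have 2: "M (e, ye, ve) + pe * (v x - ve) \<le> M (e, ye, v x)"
      using contact[OF e] unfolding Ct_def ye_def pe_def ve_def by blast
    have "\<bar>(x - e) * (\<tau> (v x) - \<tau> ve)\<bar> \<le> r * \<kappa>"
      unfolding abs_mult using xr \<delta>1(2)[of x] r by (intro mult_mono) auto
    then have 3: "(x - e) * \<tau> ve - \<kappa> * r \<le> (x - e) * \<tau> (v x)" by (simp add: algebra_simps abs_le_iff)
    have "\<bar>\<Delta> x (y x) * (h (v x) - qe)\<bar> \<le> (\<kappa> * r) * H"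
      unfolding abs_mult using \<Delta> hH[OF vW] by (intro mult_mono) auto
    then have 4: "\<Delta> x (y x) * qe - \<kappa> * r * H \<le> \<Delta> x (y x) * h (v x)" by (simp add: algebra_simps abs_le_iff)
    show ?thesis unfolding N_def using 1 2 3 4 by (simp add: algebra_simps)
  qed
  \<comment> \<open>\<zeta>0 is the small offset of \<open>y\<close> from the tangent line at the
    end of the interval, and the other part of \<Delta> is the tent, of height \<open>c * r\<close>
    on the side opposite to the sign of \<open>d e\<close>. On that side the first-order change in
    \<open>z\<close> lowers \<open>M\<close> below \<open>N\<close>.\<close>
  have upper: "M (x, z, w) \<le> N x z w + \<kappa> * (1 + 2 * D) * r - (D/2) * c * (r - \<bar>x - e\<bar>)"
    if x: "\<bar>x - e\<bar> \<le> r" and z: "\<Delta> x z = (\<bar>x - e\<bar> / r) * \<zeta>0 - (1 - \<bar>x - e\<bar> / r) * \<sigma> * c * r" and \<zeta>0: "\<bar>\<zeta>0\<bar> \<le> \<kappa> * r"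
      and w: "\<bar>w - ve\<bar> \<le> c + \<kappa>" for x z w \<zeta>0
  proof -
    have wc: "\<bar>w - ve\<bar> \<le> c0" "\<bar>w - ve\<bar> < c1" using w \<kappa> c by linarith+
    have ct: "Ct e w" using w12(2)[of w] wc by (simp add: ve_def)
    have wW: "\<bar>w\<bar> \<le> W" using wc ve_B unfolding W_def by linarith
    define \<theta> where "\<theta> = \<bar>x - e\<bar> / r"
    have \<theta>: "0 \<le> \<theta>" "\<theta> \<le> 1" using x r(1) by (auto simp: \<theta>_def)
    define A where "A = \<theta> * \<zeta>0 * \<sigma>"
    define E where "E = (1 - \<theta>) * (c * r)"
    have \<zeta>0r: "\<bar>\<theta> * \<zeta>0\<bar> \<le> \<kappa> * r"
      unfolding abs_mult using \<theta> \<zeta>0 mult_left_le_one_le[of "\<bar>\<zeta>0\<bar>" \<theta>] by simp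
    then have A: "\<bar>A\<bar> \<le> \<kappa> * r" unfolding A_def abs_mult using D(4) by simp
    have E: "0 \<le> E" "E \<le> c * r" using \<theta> c(1) r(1) mult_right_mono[of "1 - \<theta>" 1 "c * r"] by (auto simp: E_def)
    have \<Delta>: "\<Delta> x z = \<sigma> * (A - E)" using D(3) unfolding z \<theta>_def[symmetric] A_def E_def by (auto simp: algebra_simps)
    have "\<bar>\<Delta> x z\<bar> \<le> \<kappa> * r + c * r" unfolding \<Delta> abs_mult D(4) mult_1 using A E by linarith
    also have "\<dots> = (\<kappa> + c) * r" by (simp add: algebra_simps)
    also have "\<dots> \<le> 1 * r" using \<kappa> c r(1) by (intro mult_right_mono) auto
    finally have "\<bar>\<Delta> x z\<bar> \<le> r" by simp
    then have 1: "M (x, z, w) \<le> M (e, ye, w) + (x - e) * (\<tau> w + qe * w) + \<Delta> x z * h w + \<kappa> * r"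
      using expand[OF x _ wW, of z] by (simp add: abs_le_iff)
    have "d e = h ve - qe" by (simp add: d_def h_def ye_def ve_def qe_def)
    moreover have "\<sigma> * d e = D" using D(2,3) by auto
    ultimately have "\<sigma> * (h ve - qe) = D" by simp
    then have eqD: "\<sigma> * (h w - qe) = D + \<sigma> * (h w - h ve)" by (simp add: algebra_simps)
    have "\<bar>\<sigma> * (h w - h ve)\<bar> < D/2" unfolding abs_mult D(4) mult_1 by (rule c1(2)[OF wc(2)])
    then have hD: "D/2 \<le> \<sigma> * (h w - qe)" "\<sigma> * (h w - qe) \<le> 2 * D" unfolding eqD using D(1) by linarith+
    have "\<Delta> x z * (h w - qe) = A * (\<sigma> * (h w - qe)) - E * (\<sigma> * (h w - qe))" unfolding \<Delta> by (simp add: algebra_simps)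
    moreover have "A * (\<sigma> * (h w - qe)) \<le> (\<kappa> * r) * (2 * D)"
      by (rule order_trans[OF abs_ge_self], unfold abs_mult[of A], rule mult_mono) (use A hD D(1) in auto)
    moreover have "E * (D/2) \<le> E * (\<sigma> * (h w - qe))" using hD(1) E(1) by (intro mult_left_mono) auto
    ultimately have 2: "\<Delta> x z * (h w - qe) \<le> \<kappa> * r * (2 * D) - E * (D/2)" by linarith
    have "E = c * (r - \<bar>x - e\<bar>)" using r(1) by (simp add: E_def \<theta>_def field_simps)
    then have "E * (D/2) = (D/2) * c * (r - \<bar>x - e\<bar>)" by simp
    moreover have "\<Delta> x z * (h w - qe) = \<Delta> x z * h w - qe * \<Delta> x z" by (simp add: algebra_simps)
    moreover have "\<kappa> * (1 + 2 * D) * r = \<kappa> * r + \<kappa> * r * (2 * D)" by (simp add: algebra_simps)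
    moreover note 1[unfolded M_ct[OF ct] tau_ct[OF ct]] 2
    ultimately show ?thesis unfolding N_def by linarith
  qed
  \<comment> \<open>The apex of the tent over \<open>e\<close>; \<open>s1\<close> and
    \<open>s2\<close> are the slopes of the lines that join it to the end points of
    \<open>y\<close>.\<close>
  define m where "m = ye - \<sigma> * c * r"
  define \<zeta>l where "\<zeta>l = \<Delta> (e - r) (y (e - r))"
  define \<zeta>r where "\<zeta>r = \<Delta> (e + r) (y (e + r))"
  have \<zeta>lr: "\<bar>\<zeta>l\<bar> \<le> \<kappa> * r" "\<bar>\<zeta>r\<bar> \<le> \<kappa> * r"
    using \<delta>3(2)[of "e - r"] \<delta>3(2)[of "e + r"] r by (auto simp: \<zeta>l_def \<zeta>r_def \<Delta>_def ye_def ve_def)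
  define s1 where "s1 = ve - \<sigma> * c - \<zeta>l / r"
  define s2 where "s2 = ve + \<sigma> * c + \<zeta>r / r"
  have \<sigma>c: "\<bar>\<sigma> * c\<bar> = c" using D(4) c(1) by (simp add: abs_mult)
  have "\<bar>\<zeta>l / r\<bar> \<le> \<kappa>" "\<bar>\<zeta>r / r\<bar> \<le> \<kappa>" using \<zeta>lr r(1) by (simp_all add: abs_divide divide_le_eq)
  then have s12: "\<bar>s1 - ve\<bar> \<le> c + \<kappa>" "\<bar>s2 - ve\<bar> \<le> c + \<kappa>" using \<sigma>c unfolding s1_def s2_def by linarith+
  have yl: "y (e - r) = ye - ve * r + \<zeta>l" and yr: "y (e + r) = ye + ve * r + \<zeta>r"
    by (simp_all add: \<zeta>l_def \<zeta>r_def \<Delta>_def)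
  have s1r: "s1 * r = ve * r - \<sigma> * c * r - \<zeta>l" and s2r: "s2 * r = ve * r + \<sigma> * c * r + \<zeta>r"
    using r(1) by (simp_all add: s1_def s2_def field_simps)
  define zl where "zl x = y (e - r) + s1 * (x - (e - r))" for x
  define zr where "zr x = y (e + r) + s2 * (x - (e + r))" for x
  have "y (e + r) = y (e - r) + s1 * (e - (e - r)) + s2 * (e + r - e)"
    using s1r s2r yl yr by simp
  then have comp: "integral {e - r..e + r} (\<lambda>x. M (x, y x, v x)) \<le>
    integral {e - r..e} (\<lambda>x. M (x, zl x, s1)) + integral {e..e + r} (\<lambda>x. M (x, zr x, s2))"
    unfolding zl_def zr_def using broken_line[of "e - r" e "e + r" s1 s2] dom r(1) by simp
  have zle: "zl e = m" "zr e = m" "zl (e - r) = y (e - r)" "zr (e + r) = y (e + r)"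
    using s1r s2r yl yr by (simp_all add: zl_def zr_def m_def)
  define k where "k = \<kappa> * (1 + 2 * D) * r"
  have intl: "((\<lambda>x. N x (zl x) s1 + k - (D/2) * c * (r - (e - x))) has_integral
     (\<Psi> e (zl e) + k * e - (D/2) * c * ((e - (e - r))^2 / 2))
     - (\<Psi> (e - r) (zl (e - r)) + k * (e - r) - (D/2) * c * ((e - r - (e - r))^2 / 2))) {e - r..e}"
  proof (rule FTC_real)
    fix x
    have "(zl has_real_derivative s1) (at x)" unfolding zl_def[abs_def] by (auto intro!: derivative_eq_intros)
    then have "((\<lambda>x. \<Psi> x (zl x) + k * x - (D/2) * c * ((x - (e - r))^2 / 2)) has_real_derivative
      N x (zl x) s1 + k * 1 - (D/2) * c * (x - (e - r))) (at x)"
      by (intro DERIV_add DERIV_diff DERIV_cmult d\<Psi> DERIV_ident) (auto intro!: derivative_eq_intros)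
    then show "((\<lambda>x. \<Psi> x (zl x) + k * x - (D/2) * c * ((x - (e - r))^2 / 2)) has_real_derivative
      N x (zl x) s1 + k - (D/2) * c * (r - (e - x))) (at x)"
      by (rule DERIV_cong) (simp add: field_simps)
  qed (use r in simp)
  have intr: "((\<lambda>x. N x (zr x) s2 + k - (D/2) * c * (r - (x - e))) has_integral
     (\<Psi> (e + r) (zr (e + r)) + k * (e + r) + (D/2) * c * ((e + r - (e + r))^2 / 2))
     - (\<Psi> e (zr e) + k * e + (D/2) * c * ((e - (e + r))^2 / 2))) {e..e + r}"
  proof (rule FTC_real)
    fix x
    have "(zr has_real_derivative s2) (at x)" unfolding zr_def[abs_def] by (auto intro!: derivative_eq_intros)
    then have "((\<lambda>x. \<Psi> x (zr x) + k * x + (D/2) * c * ((x - (e + r))^2 / 2)) has_real_derivative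
      N x (zr x) s2 + k * 1 + (D/2) * c * (x - (e + r))) (at x)"
      by (intro DERIV_add DERIV_diff DERIV_cmult d\<Psi> DERIV_ident) (auto intro!: derivative_eq_intros)
    then show "((\<lambda>x. \<Psi> x (zr x) + k * x + (D/2) * c * ((x - (e + r))^2 / 2)) has_real_derivative
      N x (zr x) s2 + k - (D/2) * c * (r - (x - e))) (at x)"
      by (rule DERIV_cong) (simp add: field_simps)
  qed (use r in simp)
  have Ml: "(\<lambda>x. M (x, zl x, s1)) integrable_on {e - r..e}" and Mr: "(\<lambda>x. M (x, zr x, s2)) integrable_on {e..e + r}"
    unfolding zl_def zr_def using dom r(1)
    by (auto intro!: integrable_continuous_interval continuous_along[OF cont_M] continuous_intros)
  have lel: "M (x, zl x, s1) \<le> N x (zl x) s1 + k - (D/2) * c * (r - (e - x))" if x: "x \<in> {e - r..e}" for x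
  proof -
    have ax: "\<bar>x - e\<bar> = e - x" using x by auto
    define \<theta> where "\<theta> = (e - x) / r"
    have xe: "x - e = - (\<theta> * r)" using r(1) by (simp add: \<theta>_def)
    have "x - (e - r) = (1 - \<theta>) * r" using r(1) by (simp add: \<theta>_def field_simps)
    then have "s1 * (x - (e - r)) = (1 - \<theta>) * (s1 * r)" by simp
    then have "zl x = y (e - r) + (1 - \<theta>) * (ve * r - \<sigma> * c * r - \<zeta>l)" unfolding zl_def s1r by simp
    then have "\<Delta> x (zl x) = \<theta> * \<zeta>l - (1 - \<theta>) * \<sigma> * c * r"
      unfolding \<Delta>_def xe yl by (simp add: algebra_simps)
    then have "\<Delta> x (zl x) = (\<bar>x - e\<bar> / r) * \<zeta>l - (1 - \<bar>x - e\<bar> / r) * \<sigma> * c * r"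
      unfolding ax \<theta>_def .
    then show ?thesis using upper[of x "zl x" \<zeta>l s1] x s12(1) \<zeta>lr(1) ax unfolding k_def by simp
  qed
  have ler: "M (x, zr x, s2) \<le> N x (zr x) s2 + k - (D/2) * c * (r - (x - e))" if x: "x \<in> {e..e + r}" for x
  proof -
    have ax: "\<bar>x - e\<bar> = x - e" using x by auto
    define \<theta> where "\<theta> = (x - e) / r"
    have xe: "x - e = \<theta> * r" using r(1) by (simp add: \<theta>_def)
    have "x - (e + r) = (\<theta> - 1) * r" using r(1) by (simp add: \<theta>_def field_simps)
    then have "s2 * (x - (e + r)) = (\<theta> - 1) * (s2 * r)" by simp
    then have "zr x = y (e + r) + (\<theta> - 1) * (ve * r + \<sigma> * c * r + \<zeta>r)" unfolding zr_def s2r by simp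
    then have "\<Delta> x (zr x) = \<theta> * \<zeta>r - (1 - \<theta>) * \<sigma> * c * r"
      unfolding \<Delta>_def xe yr by (simp add: algebra_simps)
    then have "\<Delta> x (zr x) = (\<bar>x - e\<bar> / r) * \<zeta>r - (1 - \<bar>x - e\<bar> / r) * \<sigma> * c * r"
      unfolding ax \<theta>_def .
    then show ?thesis using upper[of x "zr x" \<zeta>r s2] x s12(2) \<zeta>lr(2) ax unfolding k_def by simp
  qed
  define l where "l = \<kappa> * (H + 2) * r"
  have inty: "((\<lambda>x. N x (y x) (v x) - l) has_integral
      (\<Psi> (e + r) (y (e + r)) - l * (e + r)) - (\<Psi> (e - r) (y (e - r)) - l * (e - r))) {e - r..e + r}"
  proof (rule FTC_real)
    fix x assume "e - r \<le> x" "x \<le> e + r"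
    then have "(y has_real_derivative v x) (at x)" using dom by (intro y_deriv) auto
    then have "((\<lambda>x. \<Psi> x (y x) - l * x) has_real_derivative N x (y x) (v x) - l * 1) (at x)"
      by (intro DERIV_diff DERIV_cmult d\<Psi> DERIV_ident)
    then show "((\<lambda>x. \<Psi> x (y x) - l * x) has_real_derivative N x (y x) (v x) - l) (at x)" by simp
  qed (use r in simp)
  have intM: "(\<lambda>x. M (x, y x, v x)) integrable_on {e - r..e + r}" using integrable_M[of "e - r" "e + r"] dom r(1) by simp
  note has_integral_le[OF inty integrable_integral[OF intM] lower[folded l_def]]
  moreover note comp
  moreover note has_integral_le[OF integrable_integral[OF Ml] intl lel]
  moreover note has_integral_le[OF integrable_integral[OF Mr] intr ler]
  ultimately have "(\<Psi> (e + r) (y (e + r)) - l * (e + r)) - (\<Psi> (e - r) (y (e - r)) - l * (e - r))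
    \<le> (\<Psi> e (zl e) + k * e - (D/2) * c * ((e - (e - r))^2 / 2))
     - (\<Psi> (e - r) (zl (e - r)) + k * (e - r) - (D/2) * c * ((e - r - (e - r))^2 / 2))
     + ((\<Psi> (e + r) (zr (e + r)) + k * (e + r) + (D/2) * c * ((e + r - (e + r))^2 / 2))
     - (\<Psi> e (zr e) + k * e + (D/2) * c * ((e - (e + r))^2 / 2)))" by linarith
  then have "(D/2) * c * r^2 \<le> 2 * k * r + 2 * l * r" unfolding zle by (simp add: algebra_simps)
  also have "\<dots> = \<kappa> * (2 * H + 6 + 4 * D) * r^2" unfolding k_def l_def by (simp add: power2_eq_square algebra_simps)
  also have "\<dots> \<le> D * c / 4 * r^2" using \<kappa>(3) by (intro mult_right_mono) auto
  finally have "D * c / 4 * r^2 \<le> 0" by (simp add: algebra_simps)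
  then show False using D(1) c(1) r(1) by (simp add: mult_le_0_iff)
qed

text \<open>Either \<open>v\<close> is lower or upper semicontinuous at \<open>e\<close>, or it has
  values below \<open>v e - c1\<close> and above \<open>v e + c2\<close> arbitrarily near
  \<open>e\<close>; in the latter case \<open>Ct_between\<close> fills a neighbourhood of
  \<open>v e\<close> with contact values.\<close>

lemma defect_zero_if_bounded:
  assumes e: "a < e" "e < b"
    and bd: "\<delta>0 > 0" "\<And>x. \<bar>x - e\<bar> < \<delta>0 \<Longrightarrow> a < x \<and> x < b \<and> \<bar>v x\<bar> \<le> B"
  shows "d e = 0"
proof -
  let ?one = "\<lambda>\<tau>. \<forall>c>0. \<exists>\<delta>>0. \<forall>x. \<bar>x - e\<bar> < \<delta> \<longrightarrow> - c \<le> \<tau> * (v x - v e)"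
  show ?thesis
  proof (cases "?one 1 \<or> ?one (- 1)")
    case True
    then show ?thesis using defect_zero_one_sided[OF e _ bd] by blast
  next
    case False
    then obtain c1 c2 where c: "c1 > 0" "c2 > 0"
      and l: "\<And>\<delta>. \<delta> > 0 \<Longrightarrow> \<exists>x. \<bar>x - e\<bar> < \<delta> \<and> v x < v e - c1"
      and u: "\<And>\<delta>. \<delta> > 0 \<Longrightarrow> \<exists>x. \<bar>x - e\<bar> < \<delta> \<and> v e + c2 < v x"
      by (auto simp: not_le) (metis add.commute diff_less_eq less_diff_eq minus_less_iff uminus_add_conv_diff)
    show ?thesis
    proof (rule defect_zero_two_sided[OF e bd])
      show "min c1 c2 > 0" using c by simp
      fix w assume w: "\<bar>w - v e\<bar> \<le> min c1 c2"
      show "Ct e w"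
      proof (rule Ct_between[OF e])
        fix \<epsilon> :: real assume "\<epsilon> > 0"
        then have "min \<epsilon> \<delta>0 > 0" using bd(1) by simp
        then obtain x1 x2 where "\<bar>x1 - e\<bar> < min \<epsilon> \<delta>0" "v x1 < v e - c1" "\<bar>x2 - e\<bar> < min \<epsilon> \<delta>0" "v e + c2 < v x2"
          using l u by meson
        then show "\<exists>x1 x2. a < x1 \<and> x1 < b \<and> \<bar>x1 - e\<bar> < \<epsilon> \<and> v x1 \<le> w
          \<and> a < x2 \<and> x2 < b \<and> \<bar>x2 - e\<bar> < \<epsilon> \<and> w \<le> v x2"
          using bd(2)[of x1] bd(2)[of x2] w by (intro exI[of _ x1] exI[of _ x2]) (auto simp: abs_le_iff)
      qed
    qed
  qed
qed

end

section \<open>The Euler-Lagrange equation\<close>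

context contact
begin

definition bounded_near :: "real \<Rightarrow> bool" where
  "bounded_near s \<longleftrightarrow> (\<exists>\<delta>>0. \<exists>B. \<forall>x. \<bar>x - s\<bar> < \<delta> \<longrightarrow> a < x \<and> x < b \<and> \<bar>v x\<bar> \<le> B)"

text \<open>A negative defect is reduced to \<open>velocity_bounded\<close> by reflection.\<close>

lemma bounded_near_if_small_defect_off:
  assumes e: "a < e" "e < b" and D: "D > 0" "D \<le> \<bar>d e\<bar>" and c\<eta>: "c > 0" "\<eta> > 0"
    and c: "\<And>w. \<bar>w - v e\<bar> \<le> c \<Longrightarrow> \<bar>My (e, y e, w) - My (e, y e, v e)\<bar> \<le> D/100"
    and F: "\<And>s. \<bar>s - e\<bar> < \<eta> \<Longrightarrow> s \<in> F \<Longrightarrow> \<bar>v s - v e\<bar> < c/8"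
    and off: "\<And>s. \<bar>s - e\<bar> < \<eta> \<Longrightarrow> a < s \<Longrightarrow> s < b \<Longrightarrow> s \<notin> F \<Longrightarrow> \<bar>v s - v e\<bar> \<le> c \<Longrightarrow> \<bar>d s\<bar> \<le> D/2"
  shows "bounded_near e"
proof (cases "d e > 0")
  case True
  show ?thesis unfolding bounded_near_def
  proof (rule velocity_bounded[OF e D(1) _ c\<eta> c F])
    show "D \<le> d e" using D True by simp
    show "d s \<le> D/2" if "\<bar>s - e\<bar> < \<eta>" "a < s" "s < b" "s \<notin> F" "\<bar>v s - v e\<bar> \<le> c" for s
      using off[OF that] by simp
  qed
next
  case False
  interpret R: contact a b "\<lambda>(x, z, w). M (x, - z, - w)" "\<lambda>(x, z, w). Mx (x, - z, - w)"
     "\<lambda>(x, z, w). - My (x, - z, - w)" "\<lambda>(x, z, w). - Mw (x, - z, - w)"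
     "\<lambda>x. - y x" "\<lambda>x. - v x" "\<lambda>x. - p x" "\<lambda>x. - p' x"
    by (rule reflect)
  have Rd: "R.d x = - d x" for x by (simp add: R.d_def d_def)
  have "\<exists>\<delta>>0. \<exists>B. \<forall>x. \<bar>x - e\<bar> < \<delta> \<longrightarrow> a < x \<and> x < b \<and> \<bar>- v x\<bar> \<le> B"
  proof (rule R.velocity_bounded[OF e D(1) _ c\<eta>])
    show "D \<le> R.d e" using D False by (simp add: Rd)
    show "\<bar>(case (e, - y e, w) of (x, z, w) \<Rightarrow> - My (x, - z, - w)) -
          (case (e, - y e, - v e) of (x, z, w) \<Rightarrow> - My (x, - z, - w))\<bar> \<le> D / 100"
      if "\<bar>w - - v e\<bar> \<le> c" for w
    proof -
      have "\<bar>- w - v e\<bar> \<le> c" using that by linarith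
      then show ?thesis using c[of "- w"] by (simp add: abs_minus_commute)
    qed
    show "\<bar>- v s - - v e\<bar> < c/8" if "\<bar>s - e\<bar> < \<eta>" "s \<in> F" for s
      using F[OF that] by linarith
    show "R.d s \<le> D/2" if "\<bar>s - e\<bar> < \<eta>" "a < s" "s < b" "s \<notin> F" "\<bar>- v s - - v e\<bar> \<le> c" for s
    proof -
      have "\<bar>v s - v e\<bar> \<le> c" using that(5) by linarith
      then show ?thesis using off[OF that(1-4)] by (simp add: Rd)
    qed
  qed
  then show ?thesis by (simp add: bounded_near_def)
qed

text \<open>Where \<open>v\<close> is unbounded it is unbounded below, before or after reflection.
  Each case contributes one limit besides \<open>d e\<close>, and the reflected one returns with its
  sign changed.\<close>

lemma defect_near_unbounded:
  assumes e: "a < e" "e < b"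
  obtains \<alpha> \<beta> where "\<And>\<epsilon>. \<epsilon> > 0 \<Longrightarrow> \<exists>\<delta>>0. \<forall>s. a < s \<longrightarrow> s < b \<longrightarrow> \<bar>s - e\<bar> < \<delta> \<longrightarrow> \<not> bounded_near s \<longrightarrow>
    \<bar>v s\<bar> \<le> R \<longrightarrow> \<bar>d s - \<alpha>\<bar> < \<epsilon> \<or> \<bar>d s - \<beta>\<bar> < \<epsilon> \<or> \<bar>d s - d e\<bar> < \<epsilon>"
proof -
  interpret R: contact a b "\<lambda>(x, z, w). M (x, - z, - w)" "\<lambda>(x, z, w). Mx (x, - z, - w)"
     "\<lambda>(x, z, w). - My (x, - z, - w)" "\<lambda>(x, z, w). - Mw (x, - z, - w)"
     "\<lambda>x. - y x" "\<lambda>x. - v x" "\<lambda>x. - p x" "\<lambda>x. - p' x"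
    by (rule reflect)
  have Rd: "R.d x = - d x" for x by (simp add: R.d_def d_def)
  have either: "unb_below s \<or> R.unb_below s" if s: "a < s" "s < b" "\<not> bounded_near s" for s
  proof (rule ccontr)
    assume "\<not> ?thesis"
    then obtain \<epsilon>1 B1 \<epsilon>2 B2 where 1: "\<epsilon>1 > 0" "\<And>x. a < x \<Longrightarrow> x < b \<Longrightarrow> \<bar>x - s\<bar> < \<epsilon>1 \<Longrightarrow> B1 \<le> v x"
      and 2: "\<epsilon>2 > 0" "\<And>x. a < x \<Longrightarrow> x < b \<Longrightarrow> \<bar>x - s\<bar> < \<epsilon>2 \<Longrightarrow> B2 \<le> - v x"
      unfolding unb_below_def R.unb_below_def not_le[symmetric] by blast
    define \<delta> where "\<delta> = Min {\<epsilon>1, \<epsilon>2, s - a, b - s}"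
    have \<delta>: "\<delta> > 0" "\<delta> \<le> \<epsilon>1" "\<delta> \<le> \<epsilon>2" "\<delta> \<le> s - a" "\<delta> \<le> b - s" using 1(1) 2(1) s by (auto simp: \<delta>_def)
    have "a < x \<and> x < b \<and> \<bar>v x\<bar> \<le> \<bar>B1\<bar> + \<bar>B2\<bar>" if x: "\<bar>x - s\<bar> < \<delta>" for x
    proof -
      have dom: "a < x" "x < b" using x \<delta> by auto
      have "B1 \<le> v x" "B2 \<le> - v x" using x \<delta> dom by (auto intro!: 1 2)
      then show ?thesis using dom by linarith
    qed
    then show False using s(3) \<delta>(1) unfolding bounded_near_def by blast
  qed
  obtain \<alpha> where \<alpha>: "\<And>\<epsilon>. \<epsilon> > 0 \<Longrightarrow> \<exists>\<delta>>0. \<forall>s. a < s \<longrightarrow> s < b \<longrightarrow> \<bar>s - e\<bar> < \<delta> \<longrightarrow> unb_below s \<longrightarrow> \<bar>v s\<bar> \<le> R \<longrightarrow>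
    \<bar>d s - \<alpha>\<bar> < \<epsilon> \<or> \<bar>d s - d e\<bar> < \<epsilon>" using defect_near_unb_below[OF e, of R] by blast
  obtain \<beta> where \<beta>: "\<And>\<epsilon>. \<epsilon> > 0 \<Longrightarrow> \<exists>\<delta>>0. \<forall>s. a < s \<longrightarrow> s < b \<longrightarrow> \<bar>s - e\<bar> < \<delta> \<longrightarrow> R.unb_below s \<longrightarrow> \<bar>- v s\<bar> \<le> R \<longrightarrow>
    \<bar>R.d s - \<beta>\<bar> < \<epsilon> \<or> \<bar>R.d s - R.d e\<bar> < \<epsilon>" using R.defect_near_unb_below[OF e, of R] by blast
  have "\<exists>\<delta>>0. \<forall>s. a < s \<longrightarrow> s < b \<longrightarrow> \<bar>s - e\<bar> < \<delta> \<longrightarrow> \<not> bounded_near s \<longrightarrow>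
    \<bar>v s\<bar> \<le> R \<longrightarrow> \<bar>d s - \<alpha>\<bar> < \<epsilon> \<or> \<bar>d s - - \<beta>\<bar> < \<epsilon> \<or> \<bar>d s - d e\<bar> < \<epsilon>" if \<epsilon>: "\<epsilon> > 0" for \<epsilon>
  proof -
    obtain \<delta>1 where \<delta>1: "\<delta>1 > 0" "\<And>s. a < s \<Longrightarrow> s < b \<Longrightarrow> \<bar>s - e\<bar> < \<delta>1 \<Longrightarrow> unb_below s \<Longrightarrow> \<bar>v s\<bar> \<le> R \<Longrightarrow>
      \<bar>d s - \<alpha>\<bar> < \<epsilon> \<or> \<bar>d s - d e\<bar> < \<epsilon>" using \<alpha>[OF \<epsilon>] by blast
    obtain \<delta>2 where \<delta>2: "\<delta>2 > 0" "\<And>s. a < s \<Longrightarrow> s < b \<Longrightarrow> \<bar>s - e\<bar> < \<delta>2 \<Longrightarrow> R.unb_below s \<Longrightarrow> \<bar>- v s\<bar> \<le> R \<Longrightarrow>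
      \<bar>R.d s - \<beta>\<bar> < \<epsilon> \<or> \<bar>R.d s - R.d e\<bar> < \<epsilon>" using \<beta>[OF \<epsilon>] by blast
    show ?thesis
    proof (intro exI[of _ "min \<delta>1 \<delta>2"] conjI allI impI)
      fix s assume s: "a < s" "s < b" "\<bar>s - e\<bar> < min \<delta>1 \<delta>2" "\<not> bounded_near s" "\<bar>v s\<bar> \<le> R"
      from either[OF s(1,2,4)] show "\<bar>d s - \<alpha>\<bar> < \<epsilon> \<or> \<bar>d s - - \<beta>\<bar> < \<epsilon> \<or> \<bar>d s - d e\<bar> < \<epsilon>"
      proof
        assume "unb_below s"
        then show ?thesis using \<delta>1(2)[of s] s by auto
      next
        assume "R.unb_below s"
        then have "\<bar>R.d s - \<beta>\<bar> < \<epsilon> \<or> \<bar>R.d s - R.d e\<bar> < \<epsilon>" using \<delta>2(2)[of s] s by auto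
        then show ?thesis unfolding Rd by linarith
      qed
    qed (use \<delta>1 \<delta>2 in auto)
  qed
  then show ?thesis using that by blast
qed

end

context minimal
begin

text \<open>Baire's theorem enters twice. On the closure of the points with nonzero defect it yields
  a place where their velocities are bounded, as the three-limits statement requires. On the closure
  \<open>F'\<close> of the points with defect at least 3 * \<epsilon> it yields small oscillation,
  so that \<open>v\<close> is bounded near a point \<open>z\<close> of \<open>Q\<close>, where the
  defect must then vanish.\<close>

lemma defect_zero:
  assumes e1: "a < e1" "e1 < b"
  shows "d e1 = 0"
proof (rule ccontr)
  assume "d e1 \<noteq> 0"
  define c0 d0 where "c0 = (a + e1) / 2" and "d0 = (e1 + b) / 2"
  have cd: "a < c0" "c0 < e1" "e1 < d0" "d0 < b" using e1 by (auto simp: c0_def d0_def)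
  define E where "E = {x. c0 < x \<and> x < d0 \<and> d x \<noteq> 0}"
  define F where "F = closure E"
  have "e1 \<in> E" using cd \<open>d e1 \<noteq> 0\<close> by (simp add: E_def)
  then have F: "closed F" "F \<noteq> {}" "E \<subseteq> F" unfolding F_def using closure_subset by auto
  have "E \<subseteq> {c0..d0}" by (auto simp: E_def)
  then have F2: "F \<subseteq> {c0..d0}" unfolding F_def by (intro closure_minimal) auto
  have "\<exists>x\<in>F. \<exists>\<delta>>0. \<forall>s\<in>F. \<bar>s - x\<bar> < \<delta> \<longrightarrow> \<bar>v s - v x\<bar> \<le> 1"
    by (rule derivative_small_oscillation[OF y_deriv F(1) F2 F(2) cd(1,4)]) auto
  then obtain x0 \<delta>0 where x0: "x0 \<in> F" "\<delta>0 > 0" "\<And>s. s \<in> F \<Longrightarrow> \<bar>s - x0\<bar> < \<delta>0 \<Longrightarrow> \<bar>v s - v x0\<bar> \<le> 1" by blast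
  obtain e where e: "e \<in> E" "\<bar>e - x0\<bar> < \<delta>0"
    using x0(1,2) unfolding F_def closure_approachable dist_real_def by auto
  have dom: "c0 < e" "e < d0" "a < e" "e < b" "d e \<noteq> 0" using e(1) cd by (auto simp: E_def)
  define B where "B = \<bar>v x0\<bar> + 1"
  have vB: "\<bar>v s\<bar> \<le> B" if "s \<in> E" "\<bar>s - x0\<bar> < \<delta>0" for s
    using x0(3)[of s] that F(3) unfolding B_def by force
  obtain \<alpha> \<beta> where \<alpha>\<beta>: "\<And>\<epsilon>. \<epsilon> > 0 \<Longrightarrow> \<exists>\<delta>>0. \<forall>s. a < s \<longrightarrow> s < b \<longrightarrow> \<bar>s - e\<bar> < \<delta> \<longrightarrow> \<not> bounded_near s \<longrightarrow>
    \<bar>v s\<bar> \<le> B + 1 \<longrightarrow> \<bar>d s - \<alpha>\<bar> < \<epsilon> \<or> \<bar>d s - \<beta>\<bar> < \<epsilon> \<or> \<bar>d s - d e\<bar> < \<epsilon>"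
    using defect_near_unbounded[OF dom(3,4)] by metis
  \<comment> \<open>Each of the three limits is 0 or at least 4 * \<epsilon> in size, so a value
    within \<epsilon> of one of them has size below \<epsilon> or above 3 * \<epsilon>.\<close>
  define T where "T = {\<bar>\<alpha>\<bar>, \<bar>\<beta>\<bar>, \<bar>d e\<bar>} - {0}"
  have T: "finite T" "T \<noteq> {}" using dom(5) by (auto simp: T_def)
  define \<epsilon> where "\<epsilon> = Min T / 4"
  have "Min T \<in> T" using T by simp
  then have \<epsilon>: "\<epsilon> > 0" by (auto simp: \<epsilon>_def T_def)
  have big: "l = 0 \<or> 4 * \<epsilon> \<le> \<bar>l\<bar>" if "l \<in> {\<alpha>, \<beta>, d e}" for l
  proof (cases "l = 0")
    case False
    then have "\<bar>l\<bar> \<in> T" using that by (auto simp: T_def)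
    then show ?thesis using T by (simp add: \<epsilon>_def)
  qed simp
  have dich: "\<bar>x\<bar> < \<epsilon> \<or> 3 * \<epsilon> < \<bar>x\<bar>" if "\<bar>x - l\<bar> < \<epsilon>" "l \<in> {\<alpha>, \<beta>, d e}" for x l
  proof -
    have "l = 0 \<or> 4 * \<epsilon> \<le> \<bar>l\<bar>" by (rule big[OF that(2)])
    then show ?thesis using that(1) by linarith
  qed
  obtain \<delta>1 where \<delta>1: "\<delta>1 > 0" "\<And>s. a < s \<Longrightarrow> s < b \<Longrightarrow> \<bar>s - e\<bar> < \<delta>1 \<Longrightarrow> \<not> bounded_near s \<Longrightarrow>
    \<bar>v s\<bar> \<le> B + 1 \<Longrightarrow> \<bar>d s - \<alpha>\<bar> < \<epsilon> \<or> \<bar>d s - \<beta>\<bar> < \<epsilon> \<or> \<bar>d s - d e\<bar> < \<epsilon>"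
    using \<alpha>\<beta>[OF \<epsilon>] by blast
  define \<eta> where "\<eta> = Min {\<delta>1, e - c0, d0 - e, \<delta>0 - \<bar>e - x0\<bar>}"
  have \<eta>: "\<eta> > 0" "\<eta> \<le> \<delta>1" "\<eta> \<le> e - c0" "\<eta> \<le> d0 - e" "\<eta> \<le> \<delta>0 - \<bar>e - x0\<bar>"
    using \<delta>1(1) dom e(2) by (auto simp: \<eta>_def)
  have inE: "\<bar>v s\<bar> \<le> B" if "\<bar>s - e\<bar> < \<eta>" "d s \<noteq> 0" for s
  proof (rule vB)
    show "s \<in> E" using that \<eta> by (auto simp: E_def)
    show "\<bar>s - x0\<bar> < \<delta>0" using that \<eta> by linarith
  qed
  define Q where "Q = {s. \<bar>s - e\<bar> < \<eta> \<and> 3 * \<epsilon> \<le> \<bar>d s\<bar>}"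
  define F' where "F' = closure Q"
  have "e \<in> Q" using \<eta>(1) big[of "d e"] dom(5) \<epsilon> by (auto simp: Q_def)
  then have F': "closed F'" "F' \<noteq> {}" "Q \<subseteq> F'" unfolding F'_def using closure_subset by auto
  have "Q \<subseteq> {c0..d0}" using \<eta> by (auto simp: Q_def)
  then have F'2: "F' \<subseteq> {c0..d0}" unfolding F'_def by (intro closure_minimal) auto
  \<comment> \<open>The point \<open>z\<close> is found only after \<open>c\<close> has been used in
    Baire's theorem, so \<open>c\<close> must serve all candidates: hence uniform continuity of
    \<open>My\<close> on a compact box.\<close>
  obtain Y where Y: "\<And>x. c0 \<le> x \<Longrightarrow> x \<le> d0 \<Longrightarrow> \<bar>y x\<bar> \<le> Y" using y_bounded[OF cd(1,4)] by metis
  define K where "K = {c0..d0} \<times> {-Y..Y} \<times> {-(B+1)..B+1}"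
  have "compact K" unfolding K_def by (intro compact_Times) auto
  moreover have "K \<subseteq> {a<..<b} \<times> UNIV" using cd by (auto simp: K_def)
  ultimately have "uniformly_continuous_on K My"
    by (intro compact_uniformly_continuous continuous_on_subset[OF cont_My])
  moreover have "3 * \<epsilon> / 100 > 0" using \<epsilon> by simp
  ultimately obtain c1 where c1: "c1 > 0" "\<And>q q'. q \<in> K \<Longrightarrow> q' \<in> K \<Longrightarrow> dist q q' < c1 \<Longrightarrow> dist (My q) (My q') < 3 * \<epsilon> / 100"
    unfolding uniformly_continuous_on_def by metis
  define c where "c = min c1 1 / 2"
  have c: "c > 0" "c < c1" "c < 1" using c1(1) by (auto simp: c_def)
  \<comment> \<open>Two points of \<open>F'\<close> near \<open>x1\<close> then differ in velocity
    by at most \<open>c/10\<close>, below the required \<open>c/8\<close>.\<close>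
  have "\<exists>x\<in>F'. \<exists>\<delta>>0. \<forall>s\<in>F'. \<bar>s - x\<bar> < \<delta> \<longrightarrow> \<bar>v s - v x\<bar> \<le> c/20"
    by (rule derivative_small_oscillation[OF y_deriv F'(1) F'2 F'(2) cd(1,4)]) (use c in auto)
  then obtain x1 \<delta>2 where x1: "x1 \<in> F'" "\<delta>2 > 0" "\<And>s. s \<in> F' \<Longrightarrow> \<bar>s - x1\<bar> < \<delta>2 \<Longrightarrow> \<bar>v s - v x1\<bar> \<le> c/20" by blast
  obtain z where z: "z \<in> Q" "\<bar>z - x1\<bar> < \<delta>2"
    using x1(1,2) unfolding F'_def closure_approachable dist_real_def by auto
  have zz: "\<bar>z - e\<bar> < \<eta>" "3 * \<epsilon> \<le> \<bar>d z\<bar>" using z by (auto simp: Q_def)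
  have zdom: "c0 < z" "z < d0" "a < z" "z < b" using zz(1) \<eta> cd by auto
  have vz: "\<bar>v z\<bar> \<le> B" using inE[OF zz(1)] zz(2) \<epsilon> by force
  have "bounded_near z"
  proof (rule bounded_near_if_small_defect_off[OF zdom(3,4) _ zz(2) c(1)])
    show "0 < 3 * \<epsilon>" using \<epsilon> by simp
    show "0 < min (\<delta>2 - \<bar>z - x1\<bar>) (\<eta> - \<bar>z - e\<bar>)" using z(2) zz(1) by simp
    show "\<bar>My (z, y z, w) - My (z, y z, v z)\<bar> \<le> 3 * \<epsilon> / 100" if w: "\<bar>w - v z\<bar> \<le> c" for w
    proof -
      have yz: "\<bar>y z\<bar> \<le> Y" using Y zdom by simp
      have "\<bar>w\<bar> \<le> B + 1" using w vz c(3) by linarith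
      then have "(z, y z, w) \<in> K" "(z, y z, v z) \<in> K"
        using zdom yz vz by (simp_all add: K_def abs_le_iff)
      moreover have "dist (z, y z, w) (z, y z, v z) < c1"
        using w c(2) by (simp add: dist_Pair_Pair dist_real_def)
      ultimately show ?thesis using c1(2) by (simp add: dist_real_def less_imp_le)
    qed
    fix s assume s: "\<bar>s - z\<bar> < min (\<delta>2 - \<bar>z - x1\<bar>) (\<eta> - \<bar>z - e\<bar>)"
    have near: "\<bar>s - x1\<bar> < \<delta>2" "\<bar>s - e\<bar> < \<eta>" using s by linarith+
    show "\<bar>v s - v z\<bar> < c/8" if "s \<in> F'"
    proof -
      have "\<bar>v s - v x1\<bar> \<le> c/20" "\<bar>v z - v x1\<bar> \<le> c/20"
        using x1(3)[OF that near(1)] x1(3)[OF _ z(2)] z(1) F'(3) by auto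
      then show ?thesis using c(1) by linarith
    qed
    \<comment> \<open>Points with locally bounded velocity have defect 0. At the others the defect
      has size below \<epsilon> or above 3 * \<epsilon>, and being outside \<open>F'\<close>
      excludes the latter.\<close>
    show "\<bar>d s\<bar> \<le> 3 * \<epsilon> / 2" if "a < s" "s < b" "s \<notin> F'" "\<bar>v s - v z\<bar> \<le> c"
    proof (cases "bounded_near s")
      case True
      then have "d s = 0" unfolding bounded_near_def using defect_zero_if_bounded[OF that(1,2)] by blast
      then show ?thesis using \<epsilon> by simp
    next
      case False
      have "\<bar>v s\<bar> \<le> B + 1" using that(4) vz c(3) by linarith
      then have "\<bar>d s - \<alpha>\<bar> < \<epsilon> \<or> \<bar>d s - \<beta>\<bar> < \<epsilon> \<or> \<bar>d s - d e\<bar> < \<epsilon>"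
        using \<delta>1(2)[OF that(1,2) _ False] near(2) \<eta>(2) by linarith
      then have "\<bar>d s\<bar> < \<epsilon> \<or> 3 * \<epsilon> < \<bar>d s\<bar>" using dich by blast
      moreover have "\<not> 3 * \<epsilon> \<le> \<bar>d s\<bar>" using that(3) F'(3) near(2) by (auto simp: Q_def)
      ultimately show ?thesis using \<epsilon> by linarith
    qed
  qed
  then have "d z = 0" unfolding bounded_near_def using defect_zero_if_bounded[OF zdom(3,4)] by blast
  then show False using zz(2) \<epsilon> by simp
qed

end

section \<open>Conformable derivatives\<close>

text \<open>Substituting \<open>h = (x - a) powr (1 - \<alpha>) * \<epsilon>\<close> turns the
  conformable quotient into a positive multiple of the ordinary one.\<close>

lemma conf_quotient_tendsto_iff:
  assumes "a < x"
  shows "(conf_quotient \<alpha> a f x \<longlongrightarrow> D) (at 0) \<longleftrightarrow>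
    (f has_real_derivative D * (x - a) powr (\<alpha> - 1)) (at x)"
proof -
  define k where "k = (x - a) powr (1 - \<alpha>)"
  have k: "k > 0" using assms by (simp add: k_def)
  have k1: "(x - a) powr (\<alpha> - 1) = 1 / k"
    unfolding k_def by (metis minus_diff_eq powr_minus_divide)
  define q where "q h = (f (x + h) - f x) / h" for h
  have conf: "conf_quotient \<alpha> a f x = (\<lambda>\<epsilon>. k * q (k * \<epsilon>))"
  proof
    fix \<epsilon>
    show "conf_quotient \<alpha> a f x \<epsilon> = k * q (k * \<epsilon>)"
      unfolding conf_quotient_def q_def k_def[symmetric] using k by (cases "\<epsilon> = 0") (auto simp: field_simps)
  qed
  have scale: "filterlim (\<lambda>\<epsilon>. c * \<epsilon>) (at 0) (at 0)" if "c \<noteq> 0" for c :: real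
    using that by (auto simp: filterlim_at intro!: tendsto_eq_intros eventually_at_topological[THEN iffD2] exI[of _ UNIV])
  show ?thesis
  proof
    assume "(conf_quotient \<alpha> a f x \<longlongrightarrow> D) (at 0)"
    then have "((\<lambda>h. k * q (k * (1 / k * h))) \<longlongrightarrow> D) (at 0)"
      unfolding conf using k by (intro filterlim_compose[OF _ scale, of "\<lambda>\<epsilon>. k * q (k * \<epsilon>)"]) auto
    then have "((\<lambda>h. k * q h) \<longlongrightarrow> D) (at 0)" using k by simp
    from tendsto_mult_left[OF this, of "1 / k"] have "(q \<longlongrightarrow> D * (1 / k)) (at 0)" using k by simp
    then show "(f has_real_derivative D * (x - a) powr (\<alpha> - 1)) (at x)"
      unfolding k1 DERIV_def q_def .
  next
    assume "(f has_real_derivative D * (x - a) powr (\<alpha> - 1)) (at x)"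
    then have "(q \<longlongrightarrow> D * (1 / k)) (at 0)" unfolding k1 DERIV_def q_def .
    from tendsto_mult_left[OF filterlim_compose[OF this scale], of k k]
    show "(conf_quotient \<alpha> a f x \<longlongrightarrow> D) (at 0)" unfolding conf using k by simp
  qed
qed

lemma conf_deriv_interior_eq:
  assumes "a < x" "(f has_real_derivative D * (x - a) powr (\<alpha> - 1)) (at x)"
  shows "conf_deriv_interior \<alpha> a f x = D"
  unfolding conf_deriv_interior_def
  using assms by (intro tendsto_Lim) (auto simp: conf_quotient_tendsto_iff)

lemma conf_differentiable_deriv:
  assumes "conf_differentiable \<alpha> a b f" "a < x" "x < b"
  shows "(f has_real_derivative conf_deriv \<alpha> a b f x * (x - a) powr (\<alpha> - 1)) (at x)"
proof -
  obtain D where "(conf_quotient \<alpha> a f x \<longlongrightarrow> D) (at 0)"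
    using assms by (metis conf_differentiable_def greaterThanLessThan_iff)
  then have D: "(f has_real_derivative D * (x - a) powr (\<alpha> - 1)) (at x)"
    using assms conf_quotient_tendsto_iff by blast
  then have "conf_deriv_interior \<alpha> a f x = D" using assms(2) conf_deriv_interior_eq by blast
  then show ?thesis using D assms by (simp add: conf_deriv_def)
qed

section \<open>Gluing differentiable functions, and reduction to the classical problem\<close>

lemma DERIV_If:
  fixes f g :: "real \<Rightarrow> real"
  assumes "(f has_real_derivative D) (at c)" "(g has_real_derivative D) (at c)" "f c = g c"
  shows "((\<lambda>x. if x \<le> c then f x else g x) has_real_derivative D) (at c)"
proof -
  have "((\<lambda>x. if x \<le> c then (f x - f c) / (x - c) else (g x - g c) / (x - c)) \<longlongrightarrow> D) (at c)"
  proof (rule filterlim_If)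
    show "((\<lambda>x. (f x - f c) / (x - c)) \<longlongrightarrow> D) (inf (at c) (principal {x. x \<le> c}))"
      by (rule tendsto_mono[OF inf_le1]) (use assms(1) in \<open>simp add: has_field_derivative_iff\<close>)
    show "((\<lambda>x. (g x - g c) / (x - c)) \<longlongrightarrow> D) (inf (at c) (principal {x. \<not> x \<le> c}))"
      by (rule tendsto_mono[OF inf_le1]) (use assms(2) in \<open>simp add: has_field_derivative_iff\<close>)
  qed
  moreover have "(\<lambda>x. if x \<le> c then (f x - f c) / (x - c) else (g x - g c) / (x - c))
    = (\<lambda>x. ((if x \<le> c then f x else g x) - (if c \<le> c then f c else g c)) / (x - c))"
    using assms(3) by auto
  ultimately show ?thesis unfolding has_field_derivative_iff by simp
qed

lemma DERIV_glue:
  fixes y z :: "real \<Rightarrow> real"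
  assumes "k1 < k2" and z: "\<And>t. k1 \<le> t \<Longrightarrow> t \<le> k2 \<Longrightarrow> (z has_real_derivative z' t) (at t)"
    and ends: "z k1 = y k1" "z k2 = y k2" "z' k1 = v k1" "z' k2 = v k2"
    and y: "(y has_real_derivative v x) (at x)"
  shows "((\<lambda>t. if k1 \<le> t \<and> t \<le> k2 then z t else y t) has_real_derivative
    (if k1 \<le> x \<and> x \<le> k2 then z' x else v x)) (at x)"
proof -
  define G where "G t = (if t \<le> k2 then z t else y t)" for t
  have G: "(G has_real_derivative (if x \<le> k2 then z' x else v x)) (at x)" if "k1 \<le> x"
  proof -
    consider "x < k2" | "x = k2" | "k2 < x" by linarith
    then show ?thesis
    proof cases
      case 1
      then have "(z has_real_derivative (if x \<le> k2 then z' x else v x)) (at x)" using z that by simp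
      then show ?thesis
        by (rule has_field_derivative_transform_within_open[of _ _ _ "{..<k2}"]) (use 1 in \<open>auto simp: G_def\<close>)
    next
      case 2
      have "(z has_real_derivative z' k2) (at k2)" using z[of k2] assms(1) by simp
      moreover have "(y has_real_derivative z' k2) (at k2)" using y 2 ends by simp
      ultimately have "(G has_real_derivative z' k2) (at k2)" unfolding G_def[abs_def] using ends by (intro DERIV_If) auto
      then show ?thesis using 2 by simp
    next
      case 3
      then have "(y has_real_derivative (if x \<le> k2 then z' x else v x)) (at x)" using y by simp
      then show ?thesis
        by (rule has_field_derivative_transform_within_open[of _ _ _ "{k2<..}"]) (use 3 in \<open>auto simp: G_def\<close>)
    qed
  qed
  have eq: "(\<lambda>t. if k1 \<le> t \<and> t \<le> k2 then z t else y t) = (\<lambda>t. if t \<le> k1 then y t else G t)"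
    using ends assms(1) by (auto simp: G_def fun_eq_iff)
  consider "x < k1" | "x = k1" | "k1 < x" by linarith
  then show ?thesis
  proof cases
    case 1
    then have "(y has_real_derivative (if k1 \<le> x \<and> x \<le> k2 then z' x else v x)) (at x)" using y by simp
    then show ?thesis unfolding eq
      by (rule has_field_derivative_transform_within_open[of _ _ _ "{..<k1}"]) (use 1 in auto)
  next
    case 2
    have "y k1 = G k1" using ends assms(1) by (simp add: G_def)
    moreover have "(y has_real_derivative v k1) (at k1)" "(G has_real_derivative v k1) (at k1)"
      using y G 2 ends assms(1) by simp_all
    ultimately have "((\<lambda>t. if t \<le> k1 then y t else G t) has_real_derivative v k1) (at k1)"
      by (intro DERIV_If)
    then show ?thesis unfolding eq using 2 ends assms(1) by simp
  next
    case 3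
    then have "(G has_real_derivative (if k1 \<le> x \<and> x \<le> k2 then z' x else v x)) (at x)" using G by simp
    then show ?thesis unfolding eq
      by (rule has_field_derivative_transform_within_open[of _ _ _ "{k1<..}"]) (use 3 in auto)
  qed
qed

text \<open>On \<open>(a,b)\<close> the functional is a classical one: the conformable derivative with respect to \<open>x\<close> is
  the derivative divided by the weight \<open>(x - a) powr (\<alpha> - 1)\<close>.\<close>

lemma euler_lagrange_interior:
  fixes a b \<alpha> :: real and L :: "real \<times> real \<times> real \<Rightarrow> real" and y :: "real \<Rightarrow> real"
  assumes "a < b"
    and L: "\<And>q. q \<in> {a..b} \<times> UNIV \<Longrightarrow> (L has_derivative blinfun_apply (f' q)) (at q within {a..b} \<times> UNIV)"
    and f': "continuous_on ({a..b} \<times> UNIV) f'"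
    and y: "conf_differentiable \<alpha> a b y"
    and p: "conf_differentiable \<alpha> a b (\<lambda>x. blinfun_apply (f' (x, y x, conf_deriv \<alpha> a b y x)) (0, 0, 1))"
    and ext: "extremizer \<alpha> a b L y" and x: "a < x" "x < b"
  shows "blinfun_apply (f' (x, y x, conf_deriv \<alpha> a b y x)) (0, 1, 0)
    = conf_deriv \<alpha> a b (\<lambda>x. blinfun_apply (f' (x, y x, conf_deriv \<alpha> a b y x)) (0, 0, 1)) x"
proof -
  define \<rho> where "\<rho> x = (x - a) powr (\<alpha> - 1)" for x
  define \<rho>1 where "\<rho>1 x = (x - a) powr (1 - \<alpha>)" for x
  define P where "P = (\<lambda>x. blinfun_apply (f' (x, y x, conf_deriv \<alpha> a b y x)) (0, 0, 1))"
  have \<rho>\<rho>: "\<rho> x * \<rho>1 x = 1" "\<rho> x > 0" "\<rho>1 x > 0" if "a < x" for x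
    using that by (auto simp: \<rho>_def \<rho>1_def powr_add[symmetric])
  \<comment> \<open>The sign turns a maximum into a minimum.\<close>
  obtain \<sigma> :: real where \<sigma>: "\<sigma> = 1 \<or> \<sigma> = - 1" and
    opt: "\<And>z. admissible \<alpha> a b L z \<Longrightarrow> z a = y a \<Longrightarrow> z b = y b \<Longrightarrow>
      \<sigma> * functional_J \<alpha> a b L y \<le> \<sigma> * functional_J \<alpha> a b L z"
  proof (cases "\<forall>z. admissible \<alpha> a b L z \<and> z a = y a \<and> z b = y b \<longrightarrow> functional_J \<alpha> a b L y \<le> functional_J \<alpha> a b L z")
    case True
    then show ?thesis using that[of 1] by simp
  next
    case False
    then show ?thesis using that[of "-1"] ext by (auto simp: extremizer_def)
  qed
  have adm: "admissible \<alpha> a b L y" using ext by (simp add: extremizer_def)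
  define g where "g q = (fst q, fst (snd q), snd (snd q) * \<rho>1 (fst q))" for q :: "real \<times> real \<times> real"
  define r' where "r' x = (\<alpha> - 1) * (x - a) powr (\<alpha> - 2)" for x
  define r1' where "r1' x = (1 - \<alpha>) * (x - a) powr (- \<alpha>)" for x
  have d\<rho>: "(\<rho> has_real_derivative r' x) (at x)" "(\<rho>1 has_real_derivative r1' x) (at x)" if "a < x" for x
    unfolding \<rho>_def[abs_def] \<rho>1_def[abs_def] r'_def r1'_def using that
    by (auto intro!: derivative_eq_intros)
  define Lx Ly Lv where "Lx q = blinfun_apply (f' q) (1, 0, 0)" and "Ly q = blinfun_apply (f' q) (0, 1, 0)"
    and "Lv q = blinfun_apply (f' q) (0, 0, 1)" for q
  have f'_eq: "blinfun_apply (f' q) h = Lx q * fst h + Ly q * fst (snd h) + Lv q * snd (snd h)" for q h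
  proof -
    have "h = fst h *\<^sub>R (1, 0, 0) + fst (snd h) *\<^sub>R (0, 1, 0) + snd (snd h) *\<^sub>R (0, 0, 1)"
      by (simp add: prod_eq_iff)
    then have "blinfun_apply (f' q) h = blinfun_apply (f' q) (fst h *\<^sub>R (1, 0, 0) + fst (snd h) *\<^sub>R (0, 1, 0) + snd (snd h) *\<^sub>R (0, 0, 1))"
      by simp
    then show ?thesis by (simp only: blinfun.add_right blinfun.scaleR_right) (simp add: Lx_def Ly_def Lv_def mult.commute)
  qed
  have contL': "continuous_on ({a..b} \<times> UNIV) Lx" "continuous_on ({a..b} \<times> UNIV) Ly" "continuous_on ({a..b} \<times> UNIV) Lv"
    unfolding Lx_def Ly_def Lv_def by (intro continuous_intros f')+
  have contL: "continuous_on ({a..b} \<times> UNIV) L" using L by (rule has_derivative_continuous_on)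
  let ?S = "{a<..<b} \<times> (UNIV :: (real \<times> real) set)"
  have openS: "open ?S" by (intro open_Times) auto
  have L_at: "(L has_derivative (\<lambda>h. Lx q * fst h + Ly q * fst (snd h) + Lv q * snd (snd h))) (at q)" if "q \<in> ?S" for q
  proof -
    have "q \<in> {a..b} \<times> UNIV" using that by auto
    have "(L has_derivative blinfun_apply (f' q)) (at q within ?S)"
      by (rule has_derivative_subset[OF L[OF \<open>q \<in> {a..b} \<times> UNIV\<close>]]) auto
    moreover have "blinfun_apply (f' q) = (\<lambda>h. Lx q * fst h + Ly q * fst (snd h) + Lv q * snd (snd h))"
      by (intro fun_eq_iff[THEN iffD2] allI) (rule f'_eq)
    ultimately show ?thesis using at_within_open[OF that openS] by simp
  qed
  have cont\<rho>: "continuous_on {a<..<b} \<rho>" "continuous_on {a<..<b} \<rho>1" "continuous_on {a<..<b} r'" "continuous_on {a<..<b} r1'"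
    unfolding \<rho>_def \<rho>1_def r'_def r1'_def by (auto intro!: continuous_intros)
  have cont\<rho>': "continuous_on ?S (\<lambda>q. k (fst q))" if "continuous_on {a<..<b} k" for k :: "real \<Rightarrow> real"
  proof (rule continuous_on_compose2[OF that])
    show "continuous_on ?S fst" by (intro continuous_intros)
  qed auto
  have contg: "continuous_on ?S g" unfolding g_def
    by (intro continuous_intros cont\<rho>' cont\<rho>)
  have contLg: "continuous_on ?S (\<lambda>q. k (g q))" if "continuous_on ({a..b} \<times> UNIV) k" for k :: "real \<times> real \<times> real \<Rightarrow> real"
    by (rule continuous_on_compose2[OF that contg]) (force simp: g_def)
  \<comment> \<open>The weighted integrand in terms of the ordinary derivative, which
    \<open>g\<close> converts into the conformable one. In \<open>Mw\<close> the factors \<rho> and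
    \<rho>1 cancel, so the momentum is \<open>\<sigma> * P\<close>, whose conformable
    differentiability is assumed.\<close>
  define M where "M q = \<sigma> * (\<rho> (fst q) * L (g q))" for q
  define Mx where "Mx q = \<sigma> * (r' (fst q) * L (g q) + \<rho> (fst q) * (Lx (g q) + Lv (g q) * (snd (snd q) * r1' (fst q))))" for q
  define My where "My q = \<sigma> * (\<rho> (fst q) * Ly (g q))" for q
  define Mw where "Mw q = \<sigma> * (\<rho> (fst q) * \<rho>1 (fst q) * Lv (g q))" for q
  define v where "v x = conf_deriv \<alpha> a b y x * \<rho> x" for x
  define p' where "p' x = \<sigma> * (conf_deriv \<alpha> a b P x * \<rho> x)" for x
  have v\<rho>: "v x * \<rho>1 x = conf_deriv \<alpha> a b y x" if "a < x" for x
    using \<rho>\<rho>(1)[OF that] by (simp add: v_def)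
  have dM: "(M has_derivative (\<lambda>h. Mx q * fst h + My q * fst (snd h) + Mw q * snd (snd h))) (at q)" if q: "q \<in> ?S" for q
  proof -
    have fq: "a < fst q" "g q \<in> ?S" using q by (auto simp: g_def)
    have d1: "((\<lambda>q. \<rho> (fst q)) has_derivative (\<lambda>h. r' (fst q) * fst h)) (at q)"
      using has_derivative_compose[OF has_derivative_fst[OF has_derivative_ident], of \<rho> _ q UNIV]
        d\<rho>(1)[OF fq(1)] unfolding has_field_derivative_def by auto
    have d2: "((\<lambda>q. \<rho>1 (fst q)) has_derivative (\<lambda>h. r1' (fst q) * fst h)) (at q)"
      using has_derivative_compose[OF has_derivative_fst[OF has_derivative_ident], of \<rho>1 _ q UNIV]
        d\<rho>(2)[OF fq(1)] unfolding has_field_derivative_def by auto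
    have dg: "(g has_derivative (\<lambda>h. (fst h, fst (snd h), snd (snd q) * (r1' (fst q) * fst h) + snd (snd h) * \<rho>1 (fst q)))) (at q)"
      unfolding g_def[abs_def] by (auto intro!: derivative_eq_intros d2)
    have d3: "((\<lambda>q. L (g q)) has_derivative (\<lambda>h. Lx (g q) * fst h + Ly (g q) * fst (snd h)
       + Lv (g q) * (snd (snd q) * (r1' (fst q) * fst h) + snd (snd h) * \<rho>1 (fst q)))) (at q)"
      using has_derivative_compose[OF dg L_at[OF fq(2)]] by simp
    show ?thesis unfolding M_def[abs_def]
      by (rule has_derivative_eq_rhs[OF has_derivative_mult_right[OF has_derivative_mult[OF d1 d3]]])
        (auto simp: Mx_def My_def Mw_def fun_eq_iff algebra_simps)
  qed
  have along_M: "\<sigma> * (along \<alpha> a b L z x * (x - a) powr (\<alpha> - 1)) = M (x, z x, z' x)"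
    if "a < x" "x < b" "(z has_real_derivative z' x) (at x)" for z z' x
  proof -
    have "z' x = (z' x * \<rho>1 x) * (x - a) powr (\<alpha> - 1)" using \<rho>\<rho>(1)[OF that(1)] by (simp add: \<rho>_def mult.commute)
    then have "conf_deriv_interior \<alpha> a z x = z' x * \<rho>1 x" using that conf_deriv_interior_eq by metis
    then have "conf_deriv \<alpha> a b z x = z' x * \<rho>1 x" using that by (simp add: conf_deriv_def)
    then show ?thesis by (simp add: along_def M_def g_def \<rho>_def)
  qed
  have yv: "(y has_real_derivative v x) (at x)" if "a < x" "x < b" for x
    using conf_differentiable_deriv[OF y that] by (simp add: v_def \<rho>_def)
  let ?fy = "\<lambda>x. along \<alpha> a b L y x * (x - a) powr (\<alpha> - 1)"
  have int_fy: "?fy integrable_on {a..b}" using adm by (simp add: admissible_def conf_integrable_def)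
  interpret minimal a b M Mx My Mw y v "\<lambda>x. \<sigma> * P x" p'
  proof
    show "(M has_derivative (\<lambda>h. Mx q * fst h + My q * fst (snd h) + Mw q * snd (snd h))) (at q)"
      if "q \<in> {a<..<b} \<times> UNIV" for q by (rule dM[OF that])
    show "continuous_on ({a<..<b} \<times> UNIV) Mx" "continuous_on ({a<..<b} \<times> UNIV) My" "continuous_on ({a<..<b} \<times> UNIV) Mw"
      unfolding Mx_def My_def Mw_def by (intro continuous_intros contLg contL contL' cont\<rho>' cont\<rho>)+
    fix x assume x: "a < x" "x < b"
    show "(y has_real_derivative v x) (at x)" by (rule yv[OF x])
    have "(P has_real_derivative conf_deriv \<alpha> a b P x * \<rho> x) (at x)"
      using conf_differentiable_deriv[OF p x] by (simp add: P_def \<rho>_def)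
    then show "((\<lambda>x. \<sigma> * P x) has_real_derivative p' x) (at x)"
      unfolding p'_def by (rule DERIV_cmult)
    show "\<sigma> * P x = Mw (x, y x, v x)"
      using \<rho>\<rho>(1)[OF x(1)] v\<rho>[OF x(1)] by (simp add: Mw_def g_def P_def Lv_def)
  next
    fix k1 k2 assume k: "a < k1" "k1 < k2" "k2 < b"
    have "(\<lambda>x. \<sigma> * ?fy x) integrable_on {k1..k2}"
      using integrable_subinterval_real[OF int_fy, of k1 k2] k by (intro integrable_on_mult_right) auto
    then show "(\<lambda>x. M (x, y x, v x)) integrable_on {k1..k2}"
      by (rule integrable_eq) (use k in \<open>auto intro!: along_M yv\<close>)
  next
    fix k1 k2 z z' assume k: "a < k1" "k1 < k2" "k2 < b"
      and dz: "\<And>x. k1 \<le> x \<Longrightarrow> x \<le> k2 \<Longrightarrow> (z has_real_derivative z' x) (at x)"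
      and ends: "z k1 = y k1" "z k2 = y k2" "z' k1 = v k1" "z' k2 = v k2"
      and intz: "(\<lambda>x. M (x, z x, z' x)) integrable_on {k1..k2}"
    define Z where "Z t = (if k1 \<le> t \<and> t \<le> k2 then z t else y t)" for t
    define V where "V t = (if k1 \<le> t \<and> t \<le> k2 then z' t else v t)" for t
    have dZ: "(Z has_real_derivative V x) (at x)" if "a < x" "x < b" for x
      unfolding Z_def[abs_def] V_def by (rule DERIV_glue[OF k(2) dz ends yv[OF that]])
    let ?fZ = "\<lambda>x. along \<alpha> a b L Z x * (x - a) powr (\<alpha> - 1)"
    have fZ: "\<sigma> * ?fZ x = M (x, Z x, V x)" if "a < x" "x < b" for x using along_M[where z=Z and z'=V] dZ that by blast
    have fy: "\<sigma> * ?fy x = M (x, y x, v x)" if "a < x" "x < b" for x using along_M[where z=y and z'=v] yv that by blast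
    have eq: "?fZ x = ?fy x" if "a < x" "x < b" "x \<le> k1 \<or> k2 \<le> x" for x
    proof -
      have "Z x = y x" "V x = v x" using that(3) ends k by (auto simp: Z_def V_def)
      then have "\<sigma> * ?fZ x = \<sigma> * ?fy x" using fZ[OF that(1,2)] fy[OF that(1,2)] by simp
      then show ?thesis using \<sigma> by auto
    qed
    have sub: "?fy integrable_on {a..k1}" "?fy integrable_on {k1..k2}" "?fy integrable_on {k2..b}"
      using integrable_subinterval_real[OF int_fy] k by auto
    \<comment> \<open>At \<open>a\<close> itself the conformable derivative is a limit, which
      \<open>eq\<close> does not treat; a single point is negligible.\<close>
    have l: "?fZ integrable_on {a..k1}" "integral {a..k1} ?fZ = integral {a..k1} ?fy"
      using integrable_spike[OF sub(1), of "{a}" ?fZ] integral_spike[of "{a}" "{a..k1}" ?fy ?fZ] eq k by auto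
    have r: "?fZ integrable_on {k2..b}" "integral {k2..b} ?fZ = integral {k2..b} ?fy"
      using integrable_spike[OF sub(3), of "{b}" ?fZ] integral_spike[of "{b}" "{k2..b}" ?fy ?fZ] eq k by auto
    have mid_eq: "M (x, z x, z' x) = \<sigma> * ?fZ x" if "x \<in> {k1..k2}" for x
      using fZ[of x] that k by (auto simp: Z_def V_def)
    have "(\<lambda>x. \<sigma> * ?fZ x) integrable_on {k1..k2}" by (rule integrable_eq[OF intz mid_eq])
    then have "(\<lambda>x. \<sigma> * (\<sigma> * ?fZ x)) integrable_on {k1..k2}" by (rule integrable_on_mult_right)
    then have m: "?fZ integrable_on {k1..k2}" using \<sigma> by auto
    have intZ1: "?fZ integrable_on {a..k2}" by (rule Henstock_Kurzweil_Integration.integrable_combine[OF _ _ l(1) m]) (use k in auto)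
    have intZ: "?fZ integrable_on {a..b}" by (rule Henstock_Kurzweil_Integration.integrable_combine[OF _ _ intZ1 r(1)]) (use k in auto)
    have ZJ: "integral {a..b} ?fZ = integral {a..k1} ?fZ + integral {k1..k2} ?fZ + integral {k2..b} ?fZ"
      using Henstock_Kurzweil_Integration.integral_combine[OF _ _ intZ, of k2]
        Henstock_Kurzweil_Integration.integral_combine[OF _ _ intZ1, of k1] k by simp
    have inty1: "?fy integrable_on {a..k2}" using integrable_subinterval_real[OF int_fy] k by auto
    have yJ: "integral {a..b} ?fy = integral {a..k1} ?fy + integral {k1..k2} ?fy + integral {k2..b} ?fy"
      using Henstock_Kurzweil_Integration.integral_combine[OF _ _ int_fy, of k2]
        Henstock_Kurzweil_Integration.integral_combine[OF _ _ inty1, of k1] k by simp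
    \<comment> \<open>Near \<open>a\<close> and \<open>b\<close> the glued function is
      \<open>y\<close>, so the limits that define the endpoint values of the conformable derivative
      survive.\<close>
    have ci: "conf_deriv_interior \<alpha> a Z x = conf_deriv_interior \<alpha> a y x" if "a < x" "x < b" "x < k1 \<or> k2 < x" for x
    proof -
      have "V x = v x" using that(3) by (auto simp: V_def)
      moreover have "v x = (v x * \<rho>1 x) * (x - a) powr (\<alpha> - 1)" using \<rho>\<rho>(1)[OF that(1)] by (simp add: \<rho>_def mult.commute)
      ultimately show ?thesis
        using conf_deriv_interior_eq[OF that(1)] dZ[OF that(1,2)] yv[OF that(1,2)] by metis
    qed
    have "conf_differentiable \<alpha> a b Z" unfolding conf_differentiable_def
    proof (intro conjI ballI)
      fix x assume "x \<in> {a<..<b}"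
      then have x: "a < x" "x < b" by auto
      have "V x = (V x * \<rho>1 x) * (x - a) powr (\<alpha> - 1)" using \<rho>\<rho>(1)[OF x(1)] by (simp add: \<rho>_def mult.commute)
      then have "(Z has_real_derivative V x * \<rho>1 x * (x - a) powr (\<alpha> - 1)) (at x)" using dZ[OF x] by metis
      then show "\<exists>D. (conf_quotient \<alpha> a Z x \<longlongrightarrow> D) (at 0)"
        using conf_quotient_tendsto_iff[OF x(1)] by blast
    next
      obtain D where "(conf_deriv_interior \<alpha> a y \<longlongrightarrow> D) (at_right a)" using y by (auto simp: conf_differentiable_def)
      moreover have "\<forall>\<^sub>F x in at_right a. conf_deriv_interior \<alpha> a y x = conf_deriv_interior \<alpha> a Z x"
        using eventually_at_right_real[OF k(1)] by eventually_elim (use ci k in auto)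
      ultimately show "\<exists>D. (conf_deriv_interior \<alpha> a Z \<longlongrightarrow> D) (at_right a)" using Lim_transform_eventually by blast
    next
      obtain D where "(conf_deriv_interior \<alpha> a y \<longlongrightarrow> D) (at_left b)" using y by (auto simp: conf_differentiable_def)
      moreover have "\<forall>\<^sub>F x in at_left b. conf_deriv_interior \<alpha> a y x = conf_deriv_interior \<alpha> a Z x"
        using eventually_at_left_real[OF k(3)] by eventually_elim (use ci k in auto)
      ultimately show "\<exists>D. (conf_deriv_interior \<alpha> a Z \<longlongrightarrow> D) (at_left b)" using Lim_transform_eventually by blast
    qed
    moreover have "continuous_on {a..b} Z"
    proof -
      have cy: "continuous_on {a..b} y" using adm by (simp add: admissible_def)
      have cz: "continuous_on {k1..k2} z"
        using dz DERIV_isCont by (intro continuous_at_imp_continuous_on) fastforce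
      have "continuous_on ({k1..k2} \<union> ({a..k1} \<union> {k2..b})) Z"
        unfolding Z_def[abs_def]
      proof (rule continuous_on_If)
        show "continuous_on ({a..k1} \<union> {k2..b}) y" by (rule continuous_on_subset[OF cy]) (use k in auto)
      qed (use cz k ends in auto)
      moreover have "{k1..k2} \<union> ({a..k1} \<union> {k2..b}) = {a..b}" using k by auto
      ultimately show ?thesis by simp
    qed
    ultimately have "admissible \<alpha> a b L Z" using intZ by (simp add: admissible_def conf_integrable_def)
    moreover have "Z a = y a" "Z b = y b" using k by (auto simp: Z_def)
    ultimately have "\<sigma> * integral {a..b} ?fy \<le> \<sigma> * integral {a..b} ?fZ"
      using opt[of Z] by (simp add: functional_J_def conf_integral_def)
    then have "\<sigma> * integral {k1..k2} ?fy \<le> \<sigma> * integral {k1..k2} ?fZ" unfolding ZJ yJ l r by (simp add: algebra_simps)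
    moreover have "integral {k1..k2} (\<lambda>x. M (x, y x, v x)) = \<sigma> * integral {k1..k2} ?fy"
      unfolding integral_mult_right[symmetric] by (rule integral_cong) (use fy k in auto)
    moreover have "integral {k1..k2} (\<lambda>x. M (x, z x, z' x)) = \<sigma> * integral {k1..k2} ?fZ"
      unfolding integral_mult_right[symmetric] by (rule integral_cong) (rule mid_eq)
    ultimately show "integral {k1..k2} (\<lambda>x. M (x, y x, v x)) \<le> integral {k1..k2} (\<lambda>x. M (x, z x, z' x))" by simp
  qed
  have "\<sigma> * (\<rho> x * Ly (x, y x, conf_deriv \<alpha> a b y x)) = \<sigma> * (conf_deriv \<alpha> a b P x * \<rho> x)"
    using defect_zero[OF x] v\<rho>[OF x(1)] by (simp add: d_def My_def g_def p'_def)
  then show ?thesis using \<sigma> \<rho>\<rho>(2)[OF x(1)] by (auto simp: Ly_def P_def)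
qed

section \<open>The endpoints and the theorem\<close>

lemma conf_deriv_tendsto_endpoints:
  assumes "a < b" "conf_differentiable \<alpha> a b f"
  shows "(conf_deriv_interior \<alpha> a f \<longlongrightarrow> conf_deriv \<alpha> a b f a) (at_right a)"
    and "(conf_deriv_interior \<alpha> a f \<longlongrightarrow> conf_deriv \<alpha> a b f b) (at_left b)"
  using assms unfolding conf_differentiable_def conf_deriv_def
  by (auto simp: tendsto_Lim[OF trivial_limit_at_right_real] tendsto_Lim[OF trivial_limit_at_left_real])

theorem theorem10:
  fixes a b \<alpha> y\<^sub>a y\<^sub>b :: real
    and L :: "real \<times> real \<times> real \<Rightarrow> real"
    and y :: "real \<Rightarrow> real"
  assumes "a < b"
    and "0 < \<alpha>" and "\<alpha> \<le> 1"
    and "C1_on ({a..b} \<times> UNIV) L"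
    and "conf_differentiable \<alpha> a b y"
    and "y a = y\<^sub>a" and "y b = y\<^sub>b"
    and "(\<lambda>x. y x * along \<alpha> a b (partial_v L) y x) differentiable_on {a..b}"
    and "conf_differentiable \<alpha> a b (along \<alpha> a b (partial_v L) y)"
    and "extremizer \<alpha> a b L y"
  shows "\<forall>x\<in>{a..b}. along \<alpha> a b (partial_y L) y x
           - conf_deriv \<alpha> a b (along \<alpha> a b (partial_v L) y) x = 0"
proof -
  let ?S = "{a..b} \<times> (UNIV :: (real \<times> real) set)"
  obtain f' where L: "\<And>q. q \<in> ?S \<Longrightarrow> (L has_derivative blinfun_apply (f' q)) (at q within ?S)"
    and f': "continuous_on ?S f'" using assms(4) unfolding C1_on_def by blast
  define Ly Lv where "Ly q = blinfun_apply (f' q) (0, 1, 0)" and "Lv q = blinfun_apply (f' q) (0, 0, 1)" for q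
  \<comment> \<open>The lines in the \<open>y\<close> and \<open>v\<close> directions stay inside
    \<open>[a,b] \<times> \<real>\<times>\<real>\<close> even over \<open>a\<close> and
    \<open>b\<close>, so the derivative within this set yields two-sided partial
    derivatives.\<close>
  have Lyv: "partial_y L (x, u, w) = Ly (x, u, w)" "partial_v L (x, u, w) = Lv (x, u, w)" if x: "x \<in> {a..b}" for x u w
  proof -
    have line: "((\<lambda>t. L (k t)) has_real_derivative blinfun_apply (f' (k t0)) k') (at t0)"
      if k: "(k has_derivative (\<lambda>t. t *\<^sub>R k')) (at t0)" "range k \<subseteq> ?S" for k k' t0
    proof -
      have "(L has_derivative blinfun_apply (f' (k t0))) (at (k t0) within range k)"
        by (rule has_derivative_subset[OF L k(2)]) (use k(2) in blast)
      from has_derivative_in_compose[OF k(1) this] show ?thesis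
        unfolding has_field_derivative_def by (simp add: blinfun.scaleR_right mult.commute[of _ "blinfun_apply _ _"])
    qed
    have "((\<lambda>u. L (x, u, w)) has_real_derivative Ly (x, u, w)) (at u)"
      unfolding Ly_def by (rule line[of "\<lambda>u. (x, u, w)"]) (use x in \<open>auto intro!: derivative_eq_intros\<close>)
    moreover have "((\<lambda>w. L (x, u, w)) has_real_derivative Lv (x, u, w)) (at w)"
      unfolding Lv_def by (rule line[of "\<lambda>w. (x, u, w)"]) (use x in \<open>auto intro!: derivative_eq_intros\<close>)
    ultimately show "partial_y L (x, u, w) = Ly (x, u, w)" "partial_v L (x, u, w) = Lv (x, u, w)"
      unfolding partial_y_def partial_v_def by (auto dest: DERIV_imp_deriv)
  qed
  define P where "P = along \<alpha> a b (partial_v L) y"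
  \<comment> \<open>\<open>P1\<close> uses the given derivative of \<open>L\<close> in place of
    \<open>deriv\<close>. The two functions need agree only on \<open>[a,b]\<close>, which settles
    the conformable derivatives inside and hence their endpoint limits.\<close>
  define P1 where "P1 = (\<lambda>x. Lv (x, y x, conf_deriv \<alpha> a b y x))"
  have PP: "P x = P1 x" if "x \<in> {a..b}" for x using Lyv[OF that] by (simp add: P_def P1_def along_def)
  have quot: "(conf_quotient \<alpha> a P1 x \<longlongrightarrow> D) (at 0) \<longleftrightarrow> (conf_quotient \<alpha> a P x \<longlongrightarrow> D) (at 0)"
    if "x \<in> {a<..<b}" for x D
  proof -
    have "(P1 has_real_derivative E) (at x) \<longleftrightarrow> (P has_real_derivative E) (at x)" for E
      using that PP by (auto intro: has_field_derivative_transform_within_open[of _ _ _ "{a<..<b}"])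
    then show ?thesis using that by (simp add: conf_quotient_tendsto_iff)
  qed
  have int_eq: "conf_deriv_interior \<alpha> a P1 x = conf_deriv_interior \<alpha> a P x" if "x \<in> {a<..<b}" for x
    unfolding conf_deriv_interior_def Topological_Spaces.Lim_def using quot[OF that] by simp
  have evr: "\<forall>\<^sub>F x in at_right a. conf_deriv_interior \<alpha> a P x = conf_deriv_interior \<alpha> a P1 x"
    using eventually_at_right_real[OF assms(1)] by eventually_elim (simp add: int_eq)
  have evl: "\<forall>\<^sub>F x in at_left b. conf_deriv_interior \<alpha> a P x = conf_deriv_interior \<alpha> a P1 x"
    using eventually_at_left_real[OF assms(1)] by eventually_elim (simp add: int_eq)
  have P: "conf_differentiable \<alpha> a b P" using assms(9) by (simp add: P_def)
  then have P1: "conf_differentiable \<alpha> a b P1"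
    unfolding conf_differentiable_def using quot Lim_transform_eventually[OF _ evr] Lim_transform_eventually[OF _ evl] by blast
  have el: "Ly (x, y x, conf_deriv_interior \<alpha> a y x) = conf_deriv_interior \<alpha> a P x" if x: "x \<in> {a<..<b}" for x
    using euler_lagrange_interior[OF assms(1) L f' assms(5) P1[unfolded P1_def Lv_def] assms(10), of x] x int_eq[OF x]
    by (simp add: Ly_def P1_def Lv_def conf_deriv_def)
  have Ly: "continuous_on ?S Ly" unfolding Ly_def by (intro continuous_intros f')
  have cy: "continuous_on {a..b} y" using assms(10) by (simp add: extremizer_def admissible_def)
  have evr': "\<forall>\<^sub>F x in at_right a. x \<in> {a<..<b}" and evl': "\<forall>\<^sub>F x in at_left b. x \<in> {a<..<b}"
    using eventually_at_right_real[OF assms(1)] eventually_at_left_real[OF assms(1)] by auto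
  \<comment> \<open>Both sides of the interior equation have limits at \<open>a\<close>: the left by
    continuity of \<open>Ly\<close> and \<open>y\<close> and the definition of the endpoint
    derivative, the right by that definition alone.\<close>
  have "Ly (a, y a, conf_deriv \<alpha> a b y a) = conf_deriv \<alpha> a b P a"
  proof (rule tendsto_unique[OF trivial_limit_at_right_real])
    have ya: "(y \<longlongrightarrow> y a) (at_right a)"
      by (rule continuous_on_tendsto_compose[OF cy tendsto_ident_at]) (use assms(1) evr' in \<open>auto elim: eventually_mono\<close>)
    show "((\<lambda>x. Ly (x, y x, conf_deriv_interior \<alpha> a y x)) \<longlongrightarrow> Ly (a, y a, conf_deriv \<alpha> a b y a)) (at_right a)"
      by (rule continuous_on_tendsto_compose[OF Ly])
        (use assms(1) evr' in \<open>auto intro!: tendsto_Pair tendsto_ident_at ya conf_deriv_tendsto_endpoints assms(5) elim: eventually_mono\<close>)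
    show "((\<lambda>x. Ly (x, y x, conf_deriv_interior \<alpha> a y x)) \<longlongrightarrow> conf_deriv \<alpha> a b P a) (at_right a)"
      by (rule Lim_transform_eventually[OF conf_deriv_tendsto_endpoints(1)[OF assms(1) P]])
        (use evr' in \<open>auto simp: el elim: eventually_mono\<close>)
  qed
  moreover have "Ly (b, y b, conf_deriv \<alpha> a b y b) = conf_deriv \<alpha> a b P b"
  proof (rule tendsto_unique[OF trivial_limit_at_left_real])
    have yb: "(y \<longlongrightarrow> y b) (at_left b)"
      by (rule continuous_on_tendsto_compose[OF cy tendsto_ident_at]) (use assms(1) evl' in \<open>auto elim: eventually_mono\<close>)
    show "((\<lambda>x. Ly (x, y x, conf_deriv_interior \<alpha> a y x)) \<longlongrightarrow> Ly (b, y b, conf_deriv \<alpha> a b y b)) (at_left b)"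
      by (rule continuous_on_tendsto_compose[OF Ly])
        (use assms(1) evl' in \<open>auto intro!: tendsto_Pair tendsto_ident_at yb conf_deriv_tendsto_endpoints assms(5) elim: eventually_mono\<close>)
    show "((\<lambda>x. Ly (x, y x, conf_deriv_interior \<alpha> a y x)) \<longlongrightarrow> conf_deriv \<alpha> a b P b) (at_left b)"
      by (rule Lim_transform_eventually[OF conf_deriv_tendsto_endpoints(2)[OF assms(1) P]])
        (use evl' in \<open>auto simp: el elim: eventually_mono\<close>)
  qed
  moreover have "Ly (x, y x, conf_deriv \<alpha> a b y x) = conf_deriv \<alpha> a b P x" if "a < x" "x < b" for x
    using el[of x] that by (simp add: conf_deriv_def)
  ultimately have "Ly (x, y x, conf_deriv \<alpha> a b y x) = conf_deriv \<alpha> a b P x" if "x \<in> {a..b}" for x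
    using that by (cases "x = a \<or> x = b") auto
  then show ?thesis using Lyv by (simp add: along_def P_def)
qed

end
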